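(* Assume that all non-trivial zeros $\rho$ of the Riemann zeta function $\zeta(s)$ are simple and that the series over $\rho$ in (iii) below converges for every $x>0$. Then the following are equivalent. (i) (Jacobi theta relation) $W_1(1/x)=\sqrt{x}\,W_1(x)$ for $\Re(x)>0$, where $W_1(x)=1+2\sum_{n=1}^{\infty}e^{-\pi n^2x}$. (ii) (Functional equation for $\zeta^{-1}(s)$) $$\pi^{-\frac s2}\Gamma\left(\frac s2\right)\zeta^{-1}(1-s)=\pi^{-\frac{1-s}2}\Gamma\left(\frac{1-s}2\right)\zeta^{-1}(s).$$ (iii) (Identity of Hardy, Littlewood and Ramanujan) For any $x>0$, $$\sum_{n=1}^\infty\frac{\mu(n)}{n}\exp\left(-\frac{x}{n^2}\right)=\sqrt{\frac{\pi}{x}}\sum_{n=1}^\infty\frac{\mu(n)}{n}\exp\left(-\frac{\pi^2}{n^2x}\right)-\frac{1}{2\sqrt{\pi}}\sum_{\rho}\left(\frac{\pi}{\sqrt{x}}\right)^{\rho}\frac{\Gamma\left(\frac{1-\rho}{2}\right)}{\zeta'(\rho)},$$ where the sum over $\rho$ runs through the non-trivial zeros of $\zeta(s)$.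
   Context: $\mu(n)$ is the Möbius function. Non-trivial zeros of $\zeta(s)$ are those in the strip $0<\Re(s)<1$. The square root is principal. *)

theory Defs
  imports "HOL-Complex_Analysis.Complex_Analysis" "HOL-Computational_Algebra.Squarefree"
begin

definition mobius :: "nat \<Rightarrow> real" where
  "mobius n = (if squarefree n then (- 1) ^ card (prime_factors n) else 0)"

(* The analytic continuation of the Dirichlet series to the plane punctured at 1. HOL functions
   are total, so a value at the pole must be fixed for the continuation to be unique as a
   function; the value 0 is arbitrary. *)
definition riemann_zeta :: "complex \<Rightarrow> complex" where
  "riemann_zeta = (THE f. f holomorphic_on - {1} \<and>
     (\<forall>s. Re s > 1 \<longrightarrow> (\<lambda>n. 1 / of_nat (Suc n) powr s) sums f s) \<and> f 1 = 0)"

definition nontrivial_zeros :: "complex set" where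
  "nontrivial_zeros = {\<rho>. 0 < Re \<rho> \<and> Re \<rho> < 1 \<and> riemann_zeta \<rho> = 0}"

(* Series over the non-trivial zeros carry the usual ordering by height: they are limits, as the
   real number T tends to infinity, of the sums over the zeros with imaginary part at most T in
   absolute value. Absolute convergence is not required. *)
definition zeros_partial_sum :: "(complex \<Rightarrow> complex) \<Rightarrow> real \<Rightarrow> complex" where
  "zeros_partial_sum g T = (\<Sum>\<rho> \<in> {\<rho> \<in> nontrivial_zeros. \<bar>Im \<rho>\<bar> \<le> T}. g \<rho>)"

definition zeros_summable :: "(complex \<Rightarrow> complex) \<Rightarrow> bool" where
  "zeros_summable g \<longleftrightarrow> (\<exists>L. (zeros_partial_sum g \<longlongrightarrow> L) at_top)"

definition zeros_sum :: "(complex \<Rightarrow> complex) \<Rightarrow> complex" where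
  "zeros_sum g = Lim at_top (zeros_partial_sum g)"

definition HLR_zero_term :: "real \<Rightarrow> complex \<Rightarrow> complex" where
  "HLR_zero_term x \<rho> =
     complex_of_real (pi / sqrt x) powr \<rho> * Gamma ((1 - \<rho>) / 2) / deriv riemann_zeta \<rho>"

definition W1 :: "complex \<Rightarrow> complex" where
  "W1 x = 1 + 2 * (\<Sum>n. exp (- of_real pi * of_nat (Suc n) ^ 2 * x))"

definition Jacobi_theta_relation :: bool where
  "Jacobi_theta_relation \<longleftrightarrow> (\<forall>x. Re x > 0 \<longrightarrow> W1 (1 / x) = csqrt x * W1 x)"

(* An identity of meromorphic functions: it is asserted wherever all Gamma factors and both
   reciprocals are defined. The points left out form a discrete set that contains 0 and 1, so the
   conventional values of Gamma and riemann_zeta at their poles, and of division by zero, are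
   never used. *)
definition zeta_inverse_functional_equation :: bool where
  "zeta_inverse_functional_equation \<longleftrightarrow>
     (\<forall>s. s / 2 \<notin> \<int>\<^sub>\<le>\<^sub>0 \<longrightarrow> (1 - s) / 2 \<notin> \<int>\<^sub>\<le>\<^sub>0 \<longrightarrow>
        riemann_zeta s \<noteq> 0 \<longrightarrow> riemann_zeta (1 - s) \<noteq> 0 \<longrightarrow>
        of_real pi powr (- (s / 2)) * Gamma (s / 2) * inverse (riemann_zeta (1 - s)) =
        of_real pi powr (- ((1 - s) / 2)) * Gamma ((1 - s) / 2) * inverse (riemann_zeta s))"

(* The series over n converge only conditionally, and suminf has an unspecified value on divergent
   series, so their convergence is stated as part of the identity. *)
definition HLR_identity :: bool where
  "HLR_identity \<longleftrightarrow>
     (\<forall>x::real. x > 0 \<longrightarrow>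
        summable (\<lambda>n. mobius (Suc n) / real (Suc n) * exp (- (x / real (Suc n) ^ 2))) \<and>
        summable (\<lambda>n. mobius (Suc n) / real (Suc n) * exp (- (pi ^ 2 / (real (Suc n) ^ 2 * x)))) \<and>
        complex_of_real (\<Sum>n. mobius (Suc n) / real (Suc n) * exp (- (x / real (Suc n) ^ 2))) =
        complex_of_real (sqrt (pi / x) *
          (\<Sum>n. mobius (Suc n) / real (Suc n) * exp (- (pi ^ 2 / (real (Suc n) ^ 2 * x)))))
        - complex_of_real (1 / (2 * sqrt pi)) * zeros_sum (HLR_zero_term x))"

end

theory Submission
  imports Defs "HOL-Probability.Characteristic_Functions" "HOL-Real_Asymp.Real_Asymp" "HOL-Number_Theory.Prime_Powers"
begin

text \<open>
  The two equivalences hold because each of the three statements is true; the assumptions on the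
  zeros enter in (iii).

  (i) The function \<open>exp (- pi x z\<^sup>2) / (exp (2 pi \<i> z) - 1)\<close> has the terms of \<open>W1 x\<close> as residues
  at the integers. On the lines \<open>Im z = -1\<close> and \<open>Im z = 1\<close> its denominator expands into a
  geometric series, which turns the integrals into Fourier transforms of Gaussians, that is, into
  the terms of \<open>W1 (1 / x)\<close>. The residue theorem for growing rectangles equates the two
  (\<open>theta_sum_tendsto\<close>), and analytic continuation leads from positive to complex \<open>x\<close>.

  (ii) The Mellin transform of the theta series is \<open>pi\<^bsup>-s/2\<^esup> \<Gamma>(s/2) \<zeta>(s)\<close>. Folding it at 1 by
  means of (i) (\<open>theta_mellin_split\<close>) yields \<open>completed_zeta\<close>, an entire function that is visibly
  invariant under \<open>s \<mapsto> 1 - s\<close>. It provides the continuation of zeta (\<open>riemann_zeta_eq\<close>), and its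
  symmetry is the functional equation.

  (iii) Let \<open>y = pi / sqrt x\<close> and integrate \<open>y\<^bsup>s\<^esup> \<Gamma>((1 - s)/2) / \<zeta>(s)\<close> over the boundary of a tall
  rectangle with vertical sides on \<open>Re s = 3/2\<close> and \<open>Re s = -1/2\<close>. At a simple zero \<open>\<rho>\<close> the
  residue is the term of the series over the zeros. On \<open>Re s = 3/2\<close> the expansion
  \<open>1 / \<zeta>(s) = \<Sum> \<mu>(n) n\<^bsup>-s\<^esup>\<close> and Mellin inversion (\<open>Mellin_inversion_exp_minus_1\<close>) give the series
  of \<open>\<mu>(n)/n * (exp (- (y/n)\<^sup>2) - 1)\<close>. Here the 1 may be dropped because \<open>\<Sum> \<mu>(n)/n = 0\<close>
  (\<open>sums_mobius_over_n\<close>), a statement of the depth of the prime number theorem: it follows from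
  the absence of zeros on \<open>Re s = 1\<close> by Newman's Tauberian theorem. The functional equation
  carries the line \<open>Re s = -1/2\<close> to \<open>Re s = 3/2\<close> with \<open>pi / y\<close> in place of \<open>y\<close>, which gives the
  other series.

  The horizontal sides have to tend to 0 along some heights \<open>T \<rightarrow> \<infinity>\<close>. Gamma decays exponentially on
  them, so a bound \<open>exp (O(log T * log log T))\<close> for \<open>1 / \<zeta>\<close> is sufficient
  (\<open>zeta_lower_bound_on_horizontal_lines\<close>): dividing out the zeros near \<open>2 + \<i>N\<close> by Blaschke
  factors leaves a function without zeros, to which the Borel--Caratheodory inequality applies,
  and a height that keeps away from the \<open>O(log N)\<close> zeros in question exists by the pigeonhole
  principle. The assumed convergence of the series over the zeros identifies its sum with the
  limit along these heights.
\<close>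

section \<open>Rectangles and real Gaussian integrals\<close>

lemma contour_integral_linepath_same_Im:
  assumes "Im z = c" "Im z' = c" "Re z = a" "Re z' = b" "a < b"
  shows   "contour_integral (linepath z z') f = integral {a..b} (\<lambda>x. f (Complex x c))"
proof -
  have zz': "z = Complex a c" "z' = Complex b c"
    using assms by (auto simp: complex_eq_iff)
  have "contour_integral (linepath z z') f =
         (z' - z) * integral {0..1} (\<lambda>x. f (linepath z z' x))"
    by (simp add: contour_integral_integral)
  also have "z' - z = of_real (b - a)"
    by (simp add: zz' Complex_eq algebra_simps)
  also have "integral {0..1} (\<lambda>x. f (linepath z z' x)) =
             integral {0..1} (\<lambda>x. f (Complex (linepath a b x) c))"
    by (simp add: linepath_def Complex_eq scaleR_conv_of_real algebra_simps zz')
  also have "\<dots> = integral {0..(b - a) / (b - a)} (\<lambda>x. f (Complex (a + (b - a) * x) c))"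
    using \<open>a < b\<close> by (simp add: algebra_simps linepath_def)
  also have "{0..(b - a) / (b - a)} = (\<lambda>x. x / (b - a)) ` {0..b - a}"
    using \<open>a < b\<close> by simp
  also have "integral \<dots> (\<lambda>x. f (Complex (a + (b - a) * x) c)) =
             integral {a-a..b-a} (\<lambda>x. f (Complex (x + a) c)) / of_real (b - a)"
    using \<open>a < b\<close> by (subst integral_stretch_real) (auto simp: scaleR_conv_of_real add_ac)
  also have "\<dots> = integral {a..b} (\<lambda>x. f (Complex x c)) / of_real (b - a)"
    by (subst integral_shift_real_ivl) (rule refl)
  finally show ?thesis
    using \<open>a < b\<close> by simp
qed

text
\<open>The residue theorem with the four sides written as integrals over real intervals, so that letting a rectangle grow becomes a statement about limits of real integrals.\<close>
lemma rectangle_residue_formula: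
  fixes f :: "complex \<Rightarrow> complex"
  assumes "a < b" "c < d" and "open S" "convex S" "cbox (Complex a c) (Complex b d) \<subseteq> S"
    and "finite P" "P \<subseteq> box (Complex a c) (Complex b d)" and hol: "f holomorphic_on S - P"
  shows "integral {a..b} (\<lambda>x. f (Complex x c)) - integral {a..b} (\<lambda>x. f (Complex x d))
           + \<i> * (integral {c..d} (\<lambda>y. f (Complex b y)) - integral {c..d} (\<lambda>y. f (Complex a y)))
         = 2 * of_real pi * \<i> * (\<Sum>p\<in>P. residue f p)"
proof -
  let ?R = "rectpath (Complex a c) (Complex b d)"
  let ?l1 = "linepath (Complex a c) (Complex b c)" and ?l2 = "linepath (Complex b c) (Complex b d)"
  let ?l3 = "linepath (Complex b d) (Complex a d)" and ?l4 = "linepath (Complex a d) (Complex a c)"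
  have img: "path_image ?R = cbox (Complex a c) (Complex b d) - box (Complex a c) (Complex b d)"
    using assms by (intro path_image_rectpath_cbox_minus_box) auto
  have sub: "path_image ?R \<subseteq> S - P"
    using img assms by auto
  have "contour_integral ?R f = 2 * pi * \<i> * (\<Sum>p\<in>P. winding_number ?R p * residue f p)"
  proof (rule Residue_theorem[where S = S])
    show "connected S" using assms by (simp add: convex_connected)
    show "\<forall>z. z \<notin> S \<longrightarrow> winding_number ?R z = 0"
      using assms by (intro allI impI winding_number_rectpath_outside) auto
  qed (use assms sub in auto)
  also have "(\<Sum>p\<in>P. winding_number ?R p * residue f p) = (\<Sum>p\<in>P. residue f p)"
    using assms by (intro sum.cong) (auto simp: winding_number_rectpath subset_eq)
  finally have 1: "contour_integral ?R f = 2 * pi * \<i> * (\<Sum>p\<in>P. residue f p)" .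
  have cont: "continuous_on (path_image ?R) f"
    using hol sub by (meson holomorphic_on_imp_continuous_on continuous_on_subset)
  have pi: "path_image ?R = path_image ?l1 \<union> path_image ?l2 \<union> path_image ?l3 \<union> path_image ?l4"
    by (auto simp: rectpath_def Let_def path_image_join)
  have int: "f contour_integrable_on ?l1" "f contour_integrable_on ?l2"
            "f contour_integrable_on ?l3" "f contour_integrable_on ?l4"
    by (rule contour_integrable_continuous_linepath,
        rule continuous_on_subset[OF cont], use pi in auto)+
  have "contour_integral ?R f = contour_integral ?l1 f + contour_integral ?l2 f
           + contour_integral ?l3 f + contour_integral ?l4 f"
    using int by (simp add: rectpath_def Let_def)
  also have "contour_integral ?l3 f = - contour_integral (linepath (Complex a d) (Complex b d)) f"
    by (rule contour_integral_reverse_linepath)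
       (rule continuous_on_subset[OF cont], use pi closed_segment_commute in auto)
  also have "contour_integral ?l4 f = - contour_integral (linepath (Complex a c) (Complex a d)) f"
    by (rule contour_integral_reverse_linepath)
       (rule continuous_on_subset[OF cont], use pi closed_segment_commute in auto)
  finally have 2: "contour_integral ?R f = contour_integral ?l1 f + contour_integral ?l2 f
      - contour_integral (linepath (Complex a d) (Complex b d)) f
      - contour_integral (linepath (Complex a c) (Complex a d)) f" by simp
  show ?thesis
    using 1 assms(1,2) unfolding 2
    by (simp add: contour_integral_linepath_same_Re[of _ b _ c d]
      contour_integral_linepath_same_Re[of _ a _ c d]
      contour_integral_linepath_same_Im[of _ c _ a b]
      contour_integral_linepath_same_Im[of _ d _ a b] algebra_simps)
qed

lemma tendsto_integral_symmetric:
  fixes h :: "real \<Rightarrow> complex"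
  assumes "integrable lborel h"
  shows "((\<lambda>T. integral {-T..T} h) \<longlongrightarrow> (LINT t|lborel. h t)) at_top"
proof -
  have [measurable]: "h \<in> borel_measurable lborel" using assms by auto
  have eq: "integral {-T..T} h = (LINT t|lborel. indicator {-T..T} t *\<^sub>R h t)" for T
  proof -
    have "set_integrable lborel {-T..T} h"
      unfolding set_integrable_def using assms by (intro integrable_mult_indicator) auto
    then show ?thesis
      using set_borel_integral_eq_integral(2)[of "{-T..T}" h] by (simp add: set_lebesgue_integral_def)
  qed
  show ?thesis unfolding eq
  proof (rule integral_dominated_convergence_at_top[where w = "\<lambda>t. norm (h t)"])
    show "AE x in lborel. ((\<lambda>T. indicator {-T..T} x *\<^sub>R h x) \<longlongrightarrow> h x) at_top"
    proof (intro AE_I2)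
      fix x :: real
      have "eventually (\<lambda>T. indicator {-T..T} x *\<^sub>R h x = h x) at_top"
        using eventually_ge_at_top[of "\<bar>x\<bar>"] by eventually_elim (auto simp: indicator_def)
      then show "((\<lambda>T. indicator {-T..T} x *\<^sub>R h x) \<longlongrightarrow> h x) at_top"
        by (rule tendsto_eventually)
    qed
  qed (use assms in \<open>auto simp: indicator_def intro!: always_eventually\<close>)
qed

text \<open>A rescaling of the characteristic function of the standard normal distribution.\<close>
lemma
  fixes x b :: real
  assumes x: "x > 0"
  shows integrable_gaussian_fourier:
      "integrable lborel (\<lambda>u. exp (- of_real pi * of_real x * of_real u ^ 2 + \<i> * of_real b * of_real u) :: complex)"
    and integral_gaussian_fourier:
      "(LINT u|lborel. exp (- of_real pi * of_real x * of_real u ^ 2 + \<i> * of_real b * of_real u))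
         = complex_of_real (exp (- b\<^sup>2 / (4 * pi * x)) / sqrt x)"
proof -
  define c where "c = sqrt (2 * pi * x)"
  have c: "c > 0" "c\<^sup>2 = 2 * pi * x" using x by (auto simp: c_def)
  define g where "g = (\<lambda>v. std_normal_density v *\<^sub>R iexp ((b / c) * v))"
  have int_g: "integrable lborel g"
    unfolding g_def
    by (rule Bochner_Integration.integrable_bound[of lborel std_normal_density])
       (auto intro!: AE_I2)
  have val_g: "(LINT v|lborel. g v) = complex_of_real (exp (- ((b / c)\<^sup>2) / 2))"
  proof -
    have "char std_normal_distribution (b / c) = (LINT v|std_normal_distribution. iexp ((b / c) * v))"
      by (simp add: char_def)
    also have "\<dots> = (LINT v|lborel. g v)"
      unfolding g_def by (subst integral_density) auto
    finally show ?thesis by (simp add: char_std_normal_distribution)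
  qed
  have eq: "(\<lambda>u. exp (- of_real pi * of_real x * of_real u ^ 2 + \<i> * of_real b * of_real u))
     = (\<lambda>u. of_real (sqrt (2*pi)) * g (0 + c * u))"
  proof
    fix u :: real
    have "std_normal_density (c * u) = exp (- (pi * x * u\<^sup>2)) / sqrt (2 * pi)"
      by (simp add: std_normal_density_def power_mult_distrib c mult_ac)
    then have "sqrt (2 * pi) * std_normal_density (c * u) = exp (- pi * x * u\<^sup>2)"
      by simp
    then have "complex_of_real (sqrt (2 * pi)) * of_real (std_normal_density (c * u)) = of_real (exp (- pi * x * u\<^sup>2))"
      by (metis of_real_mult)
    moreover have "g (0 + c * u) = of_real (std_normal_density (c * u)) * exp (\<i> * of_real b * of_real u)"
      using c by (simp add: g_def scaleR_conv_of_real mult_ac)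
    ultimately have "of_real (sqrt (2*pi)) * g (0 + c * u) = of_real (exp (- pi * x * u\<^sup>2)) * exp (\<i> * of_real b * of_real u)"
      by (simp only: mult.assoc[symmetric])
    also have "\<dots> = exp (- of_real pi * of_real x * of_real u ^ 2 + \<i> * of_real b * of_real u)"
      unfolding exp_add by (simp flip: exp_of_real)
    finally show "exp (- of_real pi * of_real x * of_real u ^ 2 + \<i> * of_real b * of_real u) = of_real (sqrt (2*pi)) * g (0 + c * u)" ..
  qed
  show "integrable lborel (\<lambda>u. exp (- of_real pi * of_real x * of_real u ^ 2 + \<i> * of_real b * of_real u) :: complex)"
    unfolding eq using int_g c
    by (intro integrable_mult_right) (subst lborel_integrable_real_affine_iff, auto)
  have "(LINT u|lborel. g (0 + c * u)) = (LINT v|lborel. g v) / c"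
    using lborel_integral_real_affine[of c g 0] c by (simp add: scaleR_conv_of_real)
  then have "(LINT u|lborel. of_real (sqrt (2*pi)) * g (0 + c * u))
       = of_real (sqrt (2*pi)) * (of_real (exp (- ((b / c)\<^sup>2) / 2)) / of_real c)"
    by (simp add: val_g)
  also have "\<dots> = complex_of_real (sqrt (2*pi) / c * exp (- ((b / c)\<^sup>2) / 2))" by simp
  also have "sqrt (2*pi) / c = 1 / sqrt x"
    using x by (simp add: c_def real_sqrt_mult)
  also have "- ((b / c)\<^sup>2) / 2 = - b\<^sup>2 / (4 * pi * x)"
    by (simp add: power_divide c)
  finally show "(LINT u|lborel. exp (- of_real pi * of_real x * of_real u ^ 2 + \<i> * of_real b * of_real u))
         = complex_of_real (exp (- b\<^sup>2 / (4 * pi * x)) / sqrt x)"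
    unfolding eq by simp
qed

section \<open>The Jacobi theta relation\<close>

lemma exp_2pi_i_minus_one_eq_0_iff:
  "exp (2 * of_real pi * \<i> * z) - 1 = 0 \<longleftrightarrow> z \<in> \<int>"
proof -
  have "exp (2 * of_real pi * \<i> * z) = 1 \<longleftrightarrow> (\<exists>n::int. 2 * pi * z = of_int (2 * n) * pi)"
    unfolding exp_eq_1 by (auto simp: complex_eq_iff)
  also have "\<dots> \<longleftrightarrow> z \<in> \<int>"
    by (auto simp: Ints_def)
  finally show ?thesis by simp
qed

text
\<open>The kernel \<open>g\<close> has simple poles exactly at the integers, and its residue at \<open>n\<close> is the theta term \<open>exp (- pi x n\<^sup>2)\<close> up to \<open>2 pi \<i>\<close>. On \<open>Im z = -1\<close> and on \<open>Im z = 1\<close> the factor \<open>1 / (exp (2 pi \<i> z) - 1)\<close> is a geometric series, whose terms turn the Gaussian into Fourier integrals. Evaluating the contour integral in these two ways is the theta relation.\<close>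
context
  fixes x :: real and g :: "complex \<Rightarrow> complex"
  assumes x: "x > 0"
  defines "g \<equiv> (\<lambda>z. exp (- of_real pi * of_real x * z ^ 2) / (exp (2 * of_real pi * \<i> * z) - 1))"
begin

lemma theta_kernel_residue:
  "residue g (of_int n) = of_real (exp (- pi * x * (real_of_int n)\<^sup>2)) / (2 * of_real pi * \<i>)"
proof -
  have "exp (2 * of_real pi * \<i> * of_int n) = 1"
    using exp_2pi_i_minus_one_eq_0_iff[of "of_int n"] by simp
  then show ?thesis unfolding g_def
    by (subst residue_simple_pole_deriv[where s = UNIV and g' = "2 * of_real pi * \<i>"])
       (auto intro!: holomorphic_intros derivative_eq_intros simp flip: exp_of_real)
qed

lemma theta_kernel_rectangle:
  fixes N :: nat
  defines "a \<equiv> real N + 1 / 2"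
  shows "integral {-a..a} (\<lambda>u. g (Complex u (-1))) - integral {-a..a} (\<lambda>u. g (Complex u 1))
     + \<i> * (integral {-1..1} (\<lambda>y. g (Complex a y)) - integral {-1..1} (\<lambda>y. g (Complex (-a) y)))
     = (\<Sum>n\<in>{-int N..int N}. of_real (exp (- pi * x * (real_of_int n)\<^sup>2)))"
proof -
  define P :: "complex set" where "P = of_int ` {-int N..int N}"
  define S where "S = {z. Re z > - (real N + 1)} \<inter> {z. Re z < real N + 1}"
  have "integral {-a..a} (\<lambda>u. g (Complex u (-1))) - integral {-a..a} (\<lambda>u. g (Complex u 1))
     + \<i> * (integral {-1..1} (\<lambda>y. g (Complex a y)) - integral {-1..1} (\<lambda>y. g (Complex (-a) y)))
     = 2 * of_real pi * \<i> * (\<Sum>p\<in>P. residue g p)"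
  proof (rule rectangle_residue_formula)
    show "open S" unfolding S_def by (intro open_Int open_halfspace_Re_gt open_halfspace_Re_lt)
    show "convex S" unfolding S_def by (intro convex_Int convex_halfspace_Re_gt convex_halfspace_Re_lt)
    have "z \<in> P" if z: "z \<in> S" "z \<in> \<int>" for z
    proof -
      obtain n where n: "z = of_int n" using z by (auto elim: Ints_cases)
      with z have "real_of_int n < real N + 1" "real_of_int n > - (real N + 1)" by (auto simp: S_def)
      then have "n \<in> {-int N..int N}" by simp
      with n show ?thesis by (auto simp: P_def)
    qed
    then show "g holomorphic_on S - P"
      unfolding g_def by (intro holomorphic_intros) (use exp_2pi_i_minus_one_eq_0_iff in blast)
    show "P \<subseteq> box (Complex (-a) (-1)) (Complex a 1)"
    proof
      fix z assume "z \<in> P"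
      then obtain n where n: "z = of_int n" "- int N \<le> n" "n \<le> int N" by (auto simp: P_def)
      then have "real_of_int n \<le> real N" "real_of_int n \<ge> - real N" by linarith+
      then show "z \<in> box (Complex (-a) (-1)) (Complex a 1)"
        using n by (auto simp: in_box_complex_iff a_def)
    qed
  qed (auto simp: a_def P_def S_def in_cbox_complex_iff)
  also have "(\<Sum>p\<in>P. residue g p) = (\<Sum>n\<in>{-int N..int N}. residue g (of_int n))"
    unfolding P_def by (subst sum.reindex) (auto simp: inj_on_def)
  also have "\<dots> = (\<Sum>n\<in>{-int N..int N}. of_real (exp (- pi * x * (real_of_int n)\<^sup>2))) / (2 * of_real pi * \<i>)"
    by (simp only: theta_kernel_residue sum_divide_distrib)
  finally show ?thesis by simp
qed

text
\<open>Where \<open>Re z\<close> is halfway between two integers, \<open>exp (2 pi \<i> z)\<close> is a negative real number, so the denominator has modulus at least 1 and the Gaussian alone decides the size.\<close>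
lemma theta_kernel_vertical_bound:
  fixes N :: nat
  assumes a: "\<bar>a\<bar> = real N + 1 / 2" and y: "\<bar>y\<bar> \<le> 1"
  shows "norm (g (Complex a y)) \<le> exp (- pi * x * ((real N + 1 / 2)\<^sup>2 - 1))"
proof -
  have "exp (2 * of_real pi * \<i> * Complex a y) = of_real (exp (- 2 * pi * y)) * cis (2 * pi * a)"
    by (simp add: exp_eq_polar)
  also have "cis (2 * pi * a) = -1"
  proof -
    have "cis (2 * pi * a) = cis (2 * pi * \<bar>a\<bar>) \<or> cis (2 * pi * a) = cnj (cis (2 * pi * \<bar>a\<bar>))"
      by (cases "a \<ge> 0") (auto simp: cis_cnj)
    moreover have "cis (2 * pi * \<bar>a\<bar>) = cis (2 * pi * of_int (int N)) * cis pi"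
      unfolding a cis_mult by (simp add: algebra_simps)
    then have "cis (2 * pi * \<bar>a\<bar>) = -1"
      using cis_multiple_2pi[of "of_int (int N)"] by (simp del: cis_multiple_2pi)
    ultimately show ?thesis by auto
  qed
  finally have "exp (2 * of_real pi * \<i> * Complex a y) - 1 = - of_real (exp (- 2 * pi * y) + 1)"
    by simp
  then have "norm (exp (2 * of_real pi * \<i> * Complex a y) - 1) = exp (- 2 * pi * y) + 1"
    by (simp only: norm_minus_cancel norm_of_real) simp
  then have den: "norm (exp (2 * of_real pi * \<i> * Complex a y) - 1) \<ge> 1" by simp
  have "Re (- of_real pi * of_real x * Complex a y ^ 2) = - pi * x * (\<bar>a\<bar>\<^sup>2 - y\<^sup>2)"
    by (simp add: power2_eq_square algebra_simps)
  then have num: "norm (exp (- of_real pi * of_real x * Complex a y ^ 2)) = exp (- pi * x * ((real N + 1 / 2)\<^sup>2 - y\<^sup>2))"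
    unfolding norm_exp_eq_Re a by simp
  have "y\<^sup>2 \<le> 1" using y by (simp add: abs_square_le_1)
  then have "- pi * x * ((real N + 1 / 2)\<^sup>2 - y\<^sup>2) \<le> - pi * x * ((real N + 1 / 2)\<^sup>2 - 1)"
    using x by (simp add: mult_left_mono)
  then have "norm (exp (- of_real pi * of_real x * Complex a y ^ 2)) \<le> exp (- pi * x * ((real N + 1 / 2)\<^sup>2 - 1))"
    unfolding num by simp
  with den show ?thesis
    unfolding g_def norm_divide
    using frac_le[of "exp (- pi * x * ((real N + 1 / 2)\<^sup>2 - 1))" "norm (exp (- of_real pi * of_real x * Complex a y ^ 2))" 1
      "norm (exp (2 * of_real pi * \<i> * Complex a y) - 1)"] by simp
qed

lemma theta_kernel_vertical_tendsto:
  fixes \<sigma> :: real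
  assumes "\<bar>\<sigma>\<bar> = 1"
  shows "(\<lambda>N. integral {-1..1} (\<lambda>y. g (Complex (\<sigma> * (real N + 1 / 2)) y))) \<longlonglongrightarrow> 0"
proof (rule Lim_null_comparison)
  show "\<forall>\<^sub>F N in sequentially. norm (integral {-1..1} (\<lambda>y. g (Complex (\<sigma> * (real N + 1 / 2)) y)))
           \<le> exp (- pi * x * ((real N + 1 / 2)\<^sup>2 - 1)) * (1 - (-1))"
  proof (intro always_eventually allI integral_bound)
    fix N :: nat and y :: real assume "y \<in> {-1..1}"
    then show "norm (g (Complex (\<sigma> * (real N + 1 / 2)) y)) \<le> exp (- pi * x * ((real N + 1 / 2)\<^sup>2 - 1))"
      using assms by (intro theta_kernel_vertical_bound) (auto simp: abs_mult)
  next
    fix N :: nat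
    have "exp (2 * of_real pi * \<i> * Complex (\<sigma> * (real N + 1 / 2)) y) - 1 \<noteq> 0" for y
    proof
      assume "exp (2 * of_real pi * \<i> * Complex (\<sigma> * (real N + 1 / 2)) y) - 1 = 0"
      then have "Complex (\<sigma> * (real N + 1 / 2)) y \<in> \<int>"
        using exp_2pi_i_minus_one_eq_0_iff by blast
      then obtain n where "Complex (\<sigma> * (real N + 1 / 2)) y = of_int n" by (auto elim: Ints_cases)
      then have "\<sigma> * (real N + 1 / 2) = real_of_int n" by (simp add: complex_eq_iff)
      moreover have "\<sigma> = 1 \<or> \<sigma> = -1" using assms by auto
      ultimately have "real_of_int (2 * int N + 1) = real_of_int (2 * n) \<or> real_of_int (2 * int N + 1) = real_of_int (- 2 * n)"
        by auto
      then show False unfolding of_int_eq_iff by presburger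
    qed
    then show "continuous_on {-1..1} (\<lambda>y. g (Complex (\<sigma> * (real N + 1 / 2)) y))"
      unfolding g_def Complex_eq by (intro continuous_intros) auto
  qed auto
  show "(\<lambda>N. exp (- pi * x * ((real N + 1 / 2)\<^sup>2 - 1)) * (1 - (-1))) \<longlonglongrightarrow> 0"
    using x by real_asymp
qed

text
\<open>Both horizontal sides at once: \<open>\<sigma> = 1\<close> is the side \<open>Im z = -1\<close> and \<open>\<sigma> = -1\<close> the side \<open>Im z = 1\<close>. The shift from the real axis only changes the frequency of the Gaussian wave and a constant factor.\<close>
lemma theta_kernel_fourier_term:
  fixes \<sigma> u :: real and k :: nat
  assumes \<sigma>: "\<sigma>\<^sup>2 = 1"
  defines "z \<equiv> Complex u (-\<sigma>)"
  shows "exp (- of_real pi * of_real x * z ^ 2) * exp (- 2 * of_real pi * \<i> * of_real \<sigma> * z) ^ k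
     = exp (- of_real pi * of_real x * of_real u ^ 2 + \<i> * of_real (2 * pi * \<sigma> * (x - real k)) * of_real u)
         * of_real (exp (pi * x - 2 * pi * real k))"
proof -
  have \<sigma>': "\<sigma> * \<sigma> = 1" "\<sigma> * (\<sigma> * r) = r" for r using \<sigma> by (auto simp: power2_eq_square simp flip: mult.assoc)
  have "exp (- of_real pi * of_real x * z ^ 2) * exp (- 2 * of_real pi * \<i> * of_real \<sigma> * z) ^ k
     = exp (- of_real pi * of_real x * z ^ 2 + of_nat k * (- 2 * of_real pi * \<i> * of_real \<sigma> * z))"
    by (simp only: exp_add exp_of_nat_mult)
  also have "- of_real pi * of_real x * z ^ 2 + of_nat k * (- 2 * of_real pi * \<i> * of_real \<sigma> * z)
     = (- of_real pi * of_real x * of_real u ^ 2 + \<i> * of_real (2 * pi * \<sigma> * (x - real k)) * of_real u)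
        + of_real (pi * x - 2 * pi * real k)"
    by (simp add: complex_eq_iff z_def power2_eq_square algebra_simps \<sigma>')
  also have "exp \<dots> = exp (- of_real pi * of_real x * of_real u ^ 2 + \<i> * of_real (2 * pi * \<sigma> * (x - real k)) * of_real u)
         * of_real (exp (pi * x - 2 * pi * real k))"
    by (simp only: exp_add exp_of_real)
  finally show ?thesis .
qed

text
\<open>On either side the geometric ratio has the constant modulus \<open>exp (- 2 pi)\<close>, so sum and integral may be interchanged, and completing the square leaves the theta term at \<open>1 / x\<close>. The offset \<open>m\<close> will be 1 on the lower and 0 on the upper side.\<close>
lemma
  fixes \<sigma> :: real and m :: nat
  assumes \<sigma>: "\<sigma>\<^sup>2 = 1"
  defines "F \<equiv> (\<lambda>u. \<Sum>k. exp (- of_real pi * of_real x * Complex u (-\<sigma>) ^ 2)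
                   * exp (- 2 * of_real pi * \<i> * of_real \<sigma> * Complex u (-\<sigma>)) ^ (k + m))"
  shows theta_kernel_line_integrable: "integrable lborel F"
    and theta_kernel_line_sums:
      "(\<lambda>k. complex_of_real (exp (- pi * (real (k + m))\<^sup>2 / x) / sqrt x)) sums (LINT u|lborel. F u)"
proof -
  define t where "t = (\<lambda>k u. exp (- of_real pi * of_real x * Complex u (-\<sigma>) ^ 2)
                   * exp (- 2 * of_real pi * \<i> * of_real \<sigma> * Complex u (-\<sigma>)) ^ (k + m))"
  define e where "e = (\<lambda>k u. exp (- of_real pi * of_real x * of_real u ^ 2 + \<i> * of_real (2 * pi * \<sigma> * (x - real (k+m))) * of_real u) :: complex)"
  have te: "t k = (\<lambda>u. e k u * of_real (exp (pi * x - 2 * pi * real (k + m))))" for k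
    unfolding t_def e_def by (intro ext theta_kernel_fourier_term[OF \<sigma>])
  have int: "integrable lborel (t k)" for k
    unfolding te e_def by (intro integrable_mult_left integrable_gaussian_fourier x)
  have norm_t: "norm (t k u) = exp (- pi * x * u\<^sup>2 + pi * x) * exp (- 2 * pi) ^ (k + m)" for k u
    unfolding te e_def norm_mult norm_exp_eq_Re norm_of_real
    by (simp add: power2_eq_square algebra_simps flip: exp_add exp_of_nat_mult)
  have geo: "summable (\<lambda>k. C * exp (- 2 * pi) ^ (k + m))" for C :: real
    by (auto intro!: summable_mult summable_ignore_initial_segment summable_geometric)
  have int_norm: "summable (\<lambda>k. LINT u|lborel. norm (t k u))"
    unfolding norm_t using geo by (simp add: summable_mult)
  have F: "F = (\<lambda>u. \<Sum>k. t k u)" by (simp add: F_def t_def)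
  show "integrable lborel F" unfolding F
    by (rule integrable_suminf[OF int _ int_norm]) (use geo norm_t in auto)
  have "(\<lambda>k. LINT u|lborel. t k u) sums (LINT u|lborel. F u)" unfolding F
    by (rule sums_integral[OF int _ int_norm]) (use geo norm_t in auto)
  moreover have "(LINT u|lborel. t k u) = complex_of_real (exp (- pi * (real (k + m))\<^sup>2 / x) / sqrt x)" for k
  proof -
    have "(LINT u|lborel. t k u) = complex_of_real (exp (- (2 * pi * \<sigma> * (x - real (k+m)))\<^sup>2 / (4 * pi * x)) / sqrt x)
        * of_real (exp (pi * x - 2 * pi * real (k + m)))"
      unfolding te e_def by (subst integral_mult_left_zero) (simp only: integral_gaussian_fourier[OF x])
    also have "\<dots> = complex_of_real (exp (- (2 * pi * \<sigma> * (x - real (k+m)))\<^sup>2 / (4 * pi * x) + (pi * x - 2 * pi * real (k + m))) / sqrt x)"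
      unfolding exp_add by simp
    also have "- (2 * pi * \<sigma> * (x - real (k+m)))\<^sup>2 / (4 * pi * x) + (pi * x - 2 * pi * real (k + m)) = - pi * (real (k + m))\<^sup>2 / x"
      using x \<sigma> by (simp add: power_mult_distrib) (simp add: field_simps power2_eq_square)
    finally show ?thesis .
  qed
  ultimately show "(\<lambda>k. complex_of_real (exp (- pi * (real (k + m))\<^sup>2 / x) / sqrt x)) sums (LINT u|lborel. F u)"
    by simp
qed

lemma theta_kernel_fourier_series:
  fixes \<sigma> u :: real
  assumes \<sigma>: "\<sigma>\<^sup>2 = 1"
  defines "q \<equiv> exp (- 2 * of_real pi * \<i> * of_real \<sigma> * Complex u (-\<sigma>))"
    and "E \<equiv> exp (- of_real pi * of_real x * Complex u (-\<sigma>) ^ 2)"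
  shows "(\<Sum>k. E * q ^ (k + m)) = E * q ^ m / (1 - q)" and "norm q < 1"
proof -
  have "Re (- 2 * of_real pi * \<i> * of_real \<sigma> * Complex u (-\<sigma>)) = - 2 * pi"
    using \<sigma> by (simp add: power2_eq_square)
  then show q: "norm q < 1" unfolding q_def norm_exp_eq_Re by simp
  have "(\<lambda>k. E * q ^ m * q ^ k) sums (E * q ^ m * (1 / (1 - q)))"
    by (intro sums_mult geometric_sums q)
  then show "(\<Sum>k. E * q ^ (k + m)) = E * q ^ m / (1 - q)"
    by (simp add: sums_iff power_add mult_ac)
qed

text
\<open>Below the axis \<open>exp (2 pi \<i> z)\<close> is large, and the expansion in its reciprocal starts with the first power; above the axis it is small, and the expansion starts with the constant term.\<close>
lemma theta_kernel_bottom: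
  "g (Complex u (-1)) = (\<Sum>k. exp (- of_real pi * of_real x * Complex u (-1) ^ 2)
                   * exp (- 2 * of_real pi * \<i> * of_real 1 * Complex u (-1)) ^ (k + 1))"
proof -
  define w where "w = 2 * of_real pi * \<i> * Complex u (-1)"
  have "norm (exp (-w)) < 1"
    using theta_kernel_fourier_series(2)[of 1 u] by (simp add: w_def)
  then have "exp (- w) \<noteq> 1" by (metis norm_one less_irrefl)
  then have "exp w \<noteq> 1" "1 - exp (-w) \<noteq> 0" by (auto simp: exp_minus)
  then have q: "exp (-w) / (1 - exp (-w)) = 1 / (exp w - 1)"
    by (simp add: field_simps exp_minus)
  then have "exp (- of_real pi * of_real x * Complex u (-1) ^ 2) * exp (-w) / (1 - exp (-w)) = g (Complex u (-1))"
    unfolding times_divide_eq_right[symmetric] q by (simp add: g_def w_def)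
  then show ?thesis
    by (subst theta_kernel_fourier_series(1)) (simp_all add: w_def)
qed

lemma theta_kernel_top:
  "- g (Complex u 1) = (\<Sum>k. exp (- of_real pi * of_real x * Complex u (-(-1)) ^ 2)
                   * exp (- 2 * of_real pi * \<i> * of_real (-1) * Complex u (-(-1))) ^ (k + 0))"
  by (subst theta_kernel_fourier_series(1)) (simp_all add: g_def minus_divide_right)

lemma theta_sum_tendsto:
  "(\<lambda>N. \<Sum>n\<in>{-int N..int N}. complex_of_real (exp (- pi * x * (real_of_int n)\<^sup>2)))
     \<longlonglongrightarrow> (\<Sum>k. complex_of_real (exp (- pi * (real (k + 1))\<^sup>2 / x) / sqrt x))
         + (\<Sum>k. complex_of_real (exp (- pi * (real (k + 0))\<^sup>2 / x) / sqrt x))"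
proof -
  have a: "filterlim (\<lambda>N. real N + 1 / 2) at_top sequentially" by real_asymp
  have bot: "(\<lambda>N. integral {-(real N + 1 / 2)..real N + 1 / 2} (\<lambda>u. g (Complex u (-1))))
     \<longlonglongrightarrow> (\<Sum>k. complex_of_real (exp (- pi * (real (k + 1))\<^sup>2 / x) / sqrt x))"
    using filterlim_compose[OF tendsto_integral_symmetric[OF theta_kernel_line_integrable[of 1 1]] a]
          theta_kernel_line_sums[of 1 1]
    unfolding theta_kernel_bottom by (simp add: sums_iff)
  have top: "(\<lambda>N. integral {-(real N + 1 / 2)..real N + 1 / 2} (\<lambda>u. - g (Complex u 1)))
     \<longlonglongrightarrow> (\<Sum>k. complex_of_real (exp (- pi * (real (k + 0))\<^sup>2 / x) / sqrt x))"
    using filterlim_compose[OF tendsto_integral_symmetric[OF theta_kernel_line_integrable[of "-1" 0]] a]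
          theta_kernel_line_sums[of "-1" 0]
    unfolding theta_kernel_top by (simp add: sums_iff)
  have "(\<lambda>N. integral {-(real N + 1 / 2)..real N + 1 / 2} (\<lambda>u. g (Complex u (-1)))
     + integral {-(real N + 1 / 2)..real N + 1 / 2} (\<lambda>u. - g (Complex u 1))
     + \<i> * (integral {-1..1} (\<lambda>y. g (Complex (1 * (real N + 1 / 2)) y))
     - integral {-1..1} (\<lambda>y. g (Complex ((-1) * (real N + 1 / 2)) y))))
     \<longlonglongrightarrow> (\<Sum>k. complex_of_real (exp (- pi * (real (k + 1))\<^sup>2 / x) / sqrt x))
         + (\<Sum>k. complex_of_real (exp (- pi * (real (k + 0))\<^sup>2 / x) / sqrt x)) + \<i> * (0 - 0)"
    by (intro tendsto_intros bot top theta_kernel_vertical_tendsto) auto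
  then show ?thesis
    unfolding theta_kernel_rectangle[symmetric] by (simp add: algebra_simps)
qed

end

definition theta_tail :: "real \<Rightarrow> real" where
  "theta_tail x = (\<Sum>n. exp (- pi * (real (Suc n))\<^sup>2 * x))"

lemma theta_term_le:
  assumes "y \<ge> 0"
  shows "exp (- pi * (real (Suc n))\<^sup>2 * y) \<le> exp (- pi * y) * exp (- pi * y) ^ n"
proof -
  have "(real (Suc n)) \<le> (real (Suc n))\<^sup>2" by (intro self_le_power) auto
  then have "pi * real (Suc n) * y \<le> pi * (real (Suc n))\<^sup>2 * y" using assms
    by (intro mult_mono) auto
  then have "exp (- pi * (real (Suc n))\<^sup>2 * y) \<le> exp (real (Suc n) * (- pi * y))" by (simp add: mult_ac)
  also have "\<dots> = exp (- pi * y) ^ Suc n" by (simp only: exp_of_nat_mult)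
  finally show ?thesis by simp
qed

lemma summable_theta_majorant:
  "y > 0 \<Longrightarrow> summable (\<lambda>n. exp (- pi * y) * exp (- pi * y) ^ n)"
  by (intro summable_mult summable_geometric) auto

lemma summable_theta_tail:
  assumes "x > 0" shows "summable (\<lambda>n. exp (- pi * (real (Suc n))\<^sup>2 * x))"
  by (rule summable_comparison_test'[OF summable_theta_majorant[OF assms], of 0])
     (use theta_term_le[of x] assms in auto)

text
\<open>The two evaluations of the contour integral compared. The residues at \<open>n\<close> and \<open>- n\<close> agree; the lower side contributes the terms with \<open>k \<ge> 1\<close> and the upper side those with \<open>k \<ge> 0\<close>.\<close>
lemma theta_tail_reciprocal:
  assumes x: "x > 0"
  shows "1 + 2 * theta_tail (1 / x) = sqrt x * (1 + 2 * theta_tail x)"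
proof -
  have sum_eq: "(\<Sum>n\<in>{-int N..int N}. exp (- pi * x * (real_of_int n)\<^sup>2))
      = 1 + 2 * (\<Sum>n<N. exp (- pi * (real (Suc n))\<^sup>2 * x))" for N
  proof (induction N)
    case (Suc N)
    have "{-int (Suc N)..int (Suc N)} = insert (- int (Suc N)) (insert (int (Suc N)) {-int N..int N})"
      by auto
    then show ?case using Suc by (simp add: mult_ac power2_eq_square algebra_simps)
  qed auto
  have "(\<lambda>N. complex_of_real (1 + 2 * (\<Sum>n<N. exp (- pi * (real (Suc n))\<^sup>2 * x)))) \<longlonglongrightarrow> of_real (1 + 2 * theta_tail x)"
    unfolding theta_tail_def
    by (intro tendsto_of_real tendsto_intros summable_LIMSEQ summable_theta_tail x)
  moreover have "(\<lambda>N. complex_of_real (1 + 2 * (\<Sum>n<N. exp (- pi * (real (Suc n))\<^sup>2 * x))))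
     \<longlonglongrightarrow> (\<Sum>k. complex_of_real (exp (- pi * (real (k + 1))\<^sup>2 / x) / sqrt x))
         + (\<Sum>k. complex_of_real (exp (- pi * (real (k + 0))\<^sup>2 / x) / sqrt x))"
    using theta_sum_tendsto[OF x] unfolding sum_eq of_real_sum[symmetric] .
  moreover have "(\<Sum>k. complex_of_real (exp (- pi * (real (k + 1))\<^sup>2 / x) / sqrt x)) = of_real (theta_tail (1 / x) / sqrt x)"
  proof -
    have "(\<lambda>k. exp (- pi * (real (Suc k))\<^sup>2 * (1 / x)) / sqrt x) sums (theta_tail (1 / x) / sqrt x)"
      unfolding theta_tail_def using x by (intro sums_divide summable_sums summable_theta_tail) auto
    then show ?thesis
      by (intro sums_unique[symmetric] sums_of_real) simp
  qed
  moreover have "(\<Sum>k. complex_of_real (exp (- pi * (real (k + 0))\<^sup>2 / x) / sqrt x)) = of_real ((theta_tail (1 / x) + 1) / sqrt x)"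
  proof -
    have "(\<lambda>k. exp (- pi * (real k)\<^sup>2 * (1 / x))) sums (theta_tail (1 / x) + 1)"
      using sums_Suc[OF summable_sums[OF summable_theta_tail[of "1 / x"]]] x
      by (simp add: theta_tail_def)
    then show ?thesis
      by (intro sums_unique[symmetric] sums_of_real) (auto dest: sums_divide[where c = "sqrt x"])
  qed
  ultimately have "complex_of_real (1 + 2 * theta_tail x) = of_real (theta_tail (1 / x) / sqrt x) + of_real ((theta_tail (1 / x) + 1) / sqrt x)"
    using LIMSEQ_unique by metis
  then have "1 + 2 * theta_tail x = theta_tail (1 / x) / sqrt x + (theta_tail (1 / x) + 1) / sqrt x"
    unfolding of_real_add[symmetric] of_real_eq_iff .
  then show ?thesis using x by (simp add: field_simps)
qed

lemma of_real_islimpt: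
  assumes "(x::real) islimpt A" shows "complex_of_real x islimpt (of_real ` A)"
  using assms unfolding islimpt_sequential
proof safe
  fix f :: "nat \<Rightarrow> real" assume f: "\<forall>n. f n \<in> A - {x}" "f \<longlonglongrightarrow> x"
  then show "\<exists>f. (\<forall>n. f n \<in> complex_of_real ` A - {of_real x}) \<and> f \<longlonglongrightarrow> of_real x"
    using tendsto_of_real[OF f(2), where ?'a = complex] by (intro exI[of _ "\<lambda>n. of_real (f n)"]) auto
qed

lemma W1_holomorphic: "W1 holomorphic_on {x. Re x > 0}"
proof -
  define f where "f = (\<lambda>n (x::complex). exp (- of_real pi * of_nat (Suc n) ^ 2 * x))"
  have "\<exists>g g'. \<forall>x\<in>{x. Re x > 0}. (\<lambda>n. f n x) sums g x \<and> (\<lambda>n. deriv (f n) x) sums g' x \<and> (g has_field_derivative g' x) (at x)"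
  proof (rule series_and_derivative_comparison_local)
    show "open {x::complex. Re x > 0}" by (rule open_halfspace_Re_gt)
    show "(f n has_field_derivative deriv (f n) x) (at x)" for n x
      unfolding f_def by (rule holomorphic_derivI[of _ UNIV]) (auto intro!: holomorphic_intros)
    fix x :: complex assume "x \<in> {x. Re x > 0}"
    then have x: "Re x > 0" by simp
    show "\<exists>d h. 0 < d \<and> summable h \<and> (\<forall>\<^sub>F n in sequentially. \<forall>y\<in>ball x d \<inter> {x. Re x > 0}. norm (f n y) \<le> h n)"
    proof (intro exI conjI always_eventually allI ballI)
      show "summable (\<lambda>n. exp (- pi * (Re x / 2)) * exp (- pi * (Re x / 2)) ^ n)"
        by (rule summable_theta_majorant) (use x in auto)
      fix n y assume y: "y \<in> ball x (Re x / 2) \<inter> {x. Re x > 0}"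
      have "\<bar>Re x - Re y\<bar> \<le> norm (x - y)" using abs_Re_le_cmod[of "x - y"] by simp
      with y have "Re y \<ge> Re x / 2" unfolding mem_ball dist_norm Int_iff by linarith
      have "Re (- of_real pi * of_nat (Suc n) ^ 2 * y) = - pi * (real (Suc n))\<^sup>2 * Re y"
        by (simp add: power2_eq_square algebra_simps)
      then have "norm (f n y) = exp (- pi * (real (Suc n))\<^sup>2 * Re y)"
        unfolding f_def norm_exp_eq_Re by simp
      also have "\<dots> \<le> exp (- pi * (real (Suc n))\<^sup>2 * (Re x / 2))"
        using \<open>Re y \<ge> Re x / 2\<close> by (simp only: exp_le_cancel_iff minus_mult_left[symmetric] neg_le_iff_le, intro mult_left_mono) auto
      also have "\<dots> \<le> exp (- pi * (Re x / 2)) * exp (- pi * (Re x / 2)) ^ n"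
        by (rule theta_term_le) (use x in auto)
      finally show "norm (f n y) \<le> exp (- pi * (Re x / 2)) * exp (- pi * (Re x / 2)) ^ n" .
    qed (use x in auto)
  qed
  then obtain g g' where g: "\<And>x. Re x > 0 \<Longrightarrow> (\<lambda>n. f n x) sums g x"
      "\<And>x. Re x > 0 \<Longrightarrow> (g has_field_derivative g' x) (at x)" by blast
  have "g holomorphic_on {x. Re x > 0}"
    using g(2) by (subst holomorphic_on_open) (auto simp: open_halfspace_Re_gt)
  then have "(\<lambda>x. 1 + 2 * g x) holomorphic_on {x. Re x > 0}"
    by (intro holomorphic_intros)
  then show ?thesis
    by (rule holomorphic_transform) (use g(1) in \<open>auto simp: W1_def f_def sums_iff\<close>)
qed

lemma W1_of_real:
  assumes "x > 0" shows "W1 (of_real x) = of_real (1 + 2 * theta_tail x)"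
proof -
  have "(\<lambda>n. complex_of_real (exp (- pi * (real (Suc n))\<^sup>2 * x))) sums of_real (theta_tail x)"
    unfolding theta_tail_def by (intro sums_of_real summable_sums summable_theta_tail assms)
  then show ?thesis
    unfolding W1_def by (simp add: sums_iff exp_of_real[symmetric])
qed

text \<open>Both sides are holomorphic in the half plane and agree on the positive real axis.\<close>
theorem Jacobi_theta_relation_holds: "Jacobi_theta_relation"
proof -
  have "W1 (1 / z) - csqrt z * W1 z = 0" if "Re z > 0" for z
  proof (rule analytic_continuation[where S = "{x. Re x > 0}" and U = "of_real ` {0<..}" and \<xi> = 1
        and f = "\<lambda>z. W1 (1 / z) - csqrt z * W1 z"])
    have "Re (1 / w) > 0" if "Re w > 0" for w
      using that by (cases "w = 0") (auto simp: Re_divide sum_power2_gt_zero_iff complex_eq_iff)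
    then have "(\<lambda>w. W1 (1 / w)) holomorphic_on {x. Re x > 0}"
      by (intro holomorphic_on_compose_gen[OF _ W1_holomorphic, unfolded o_def] holomorphic_intros) auto
    then show "(\<lambda>z. W1 (1 / z) - csqrt z * W1 z) holomorphic_on {x. Re x > 0}"
      by (intro holomorphic_intros W1_holomorphic) (auto simp: complex_nonpos_Reals_iff)
    show "connected {x::complex. Re x > 0}"
      by (intro convex_connected convex_halfspace_Re_gt)
    have "(1::real) islimpt {0<..}" by (intro interior_limit_point) (auto simp: interior_open)
    then show "1 islimpt (complex_of_real ` {0<..})" using of_real_islimpt[of 1] by simp
    fix z assume "z \<in> complex_of_real ` {0<..}"
    then obtain x where x: "x > 0" "z = of_real x" by auto
    then have "W1 (1 / z) = of_real (1 + 2 * theta_tail (1 / x))"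
      using W1_of_real[of "1 / x"] by simp
    also have "\<dots> = csqrt z * W1 z"
      using x unfolding theta_tail_reciprocal[OF x(1)] by (simp add: W1_of_real)
    finally show "W1 (1 / z) - csqrt z * W1 z = 0" by simp
  qed (use that in \<open>auto simp: open_halfspace_Re_gt\<close>)
  then show ?thesis by (auto simp: Jacobi_theta_relation_def)
qed

section \<open>The completed zeta function as a Mellin transform\<close>

text
\<open>Expanding the exponential under the integral gives a power series that converges everywhere; the interchange is dominated by \<open>G u * exp (norm z * u)\<close>.\<close>
lemma entire_exponential_moments:
  fixes G :: "real \<Rightarrow> real"
  assumes nonneg: "\<And>u. G u \<ge> 0" and zero: "\<And>u. u < 0 \<Longrightarrow> G u = 0"
    and meas [measurable]: "G \<in> borel_measurable borel"
    and int: "\<And>R. integrable lborel (\<lambda>u. G u * exp (R * u))"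
  shows "(\<lambda>z. LINT u|lborel. of_real (G u) * exp (of_real u * z)) holomorphic_on UNIV"
proof -
  define a where "a = (\<lambda>n. complex_of_real (LINT u|lborel. G u * u ^ n / fact n))"
  have "(\<lambda>n. a n * (z - 0) ^ n) sums (LINT u|lborel. of_real (G u) * exp (of_real u * z))" for z :: complex
  proof -
    define f where "f = (\<lambda>n u. complex_of_real (G u) * ((of_real u * z) ^ n / fact n))"
    have [measurable]: "f n \<in> borel_measurable borel" for n
      unfolding f_def by measurable
    have nf: "norm (f n u) = G u * ((u * norm z) ^ n / fact n)" for n u
      using nonneg[of u] zero[of u]
      by (cases "u < 0") (auto simp: f_def norm_mult norm_divide norm_power power_mult_distrib)
    have exp_sums: "(\<lambda>n. G u * ((u * norm z) ^ n / fact n)) sums (G u * exp (norm z * u))" for u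
      using sums_mult[OF exp_converges[of "u * norm z"], of "G u"]
      by (simp add: divide_inverse mult_ac)
    have part: "(\<Sum>k<n. norm (f k u)) \<le> G u * exp (norm z * u)" for n u
    proof -
      have "norm (f k u) \<ge> 0" for k by simp
      then have "(\<Sum>k<n. norm (f k u)) \<le> (\<Sum>k. norm (f k u))"
        by (intro sum_le_suminf) (use exp_sums in \<open>auto simp only: nf sums_iff\<close>)
      then show ?thesis using exp_sums[of u] by (simp only: nf sums_iff)
    qed
    have f_le: "norm (f n u) \<le> G u * exp (norm z * u)" for n u
      using part[of u "Suc n"] sum_nonneg[of "{..<n}" "\<lambda>k. norm (f k u)"] by simp
    have int_f: "integrable lborel (f n)" for n
      by (rule Bochner_Integration.integrable_bound[OF int[of "norm z"]])
         (use f_le nonneg in \<open>auto intro!: AE_I2\<close>)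
    have sm: "summable (\<lambda>n. LINT u|lborel. norm (f n u))"
    proof (rule summableI_nonneg_bounded)
      fix n
      have "(\<Sum>k<n. LINT u|lborel. norm (f k u)) = (LINT u|lborel. (\<Sum>k<n. norm (f k u)))"
        by (subst Bochner_Integration.integral_sum) (auto intro!: integrable_norm int_f)
      also have "\<dots> \<le> (LINT u|lborel. G u * exp (norm z * u))"
        by (intro integral_mono Bochner_Integration.integrable_sum integrable_norm int_f int part)
      finally show "(\<Sum>k<n. LINT u|lborel. norm (f k u)) \<le> (LINT u|lborel. G u * exp (norm z * u))" .
    qed auto
    have "(\<lambda>n. LINT u|lborel. f n u) sums (LINT u|lborel. (\<Sum>n. f n u))"
      by (rule sums_integral[OF int_f _ sm]) (use exp_sums in \<open>auto simp: nf sums_iff\<close>)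
    moreover have "(\<Sum>n. f n u) = of_real (G u) * exp (of_real u * z)" for u
      unfolding f_def using sums_mult[OF exp_converges[of "of_real u * z"], of "of_real (G u)"]
      by (simp add: sums_iff divide_inverse scaleR_conv_of_real mult_ac)
    moreover have "(LINT u|lborel. f n u) = a n * (z - 0) ^ n" for n
    proof -
      have "f n u = complex_of_real (G u * u ^ n / fact n) * z ^ n" for u
        by (simp add: f_def power_mult_distrib)
      then have "(LINT u|lborel. f n u) = (LINT u|lborel. complex_of_real (G u * u ^ n / fact n)) * z ^ n"
        by (simp only: integral_mult_left_zero)
      also have "(LINT u|lborel. complex_of_real (G u * u ^ n / fact n)) = a n"
        unfolding a_def by (rule integral_complex_of_real)
      finally show ?thesis by simp
    qed
    ultimately show ?thesis by simp
  qed
  then have "(\<lambda>z. LINT u|lborel. of_real (G u) * exp (of_real u * z)) holomorphic_on ball 0 r" for r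
    by (intro power_series_holomorphic) auto
  then have "(\<lambda>z. LINT u|lborel. of_real (G u) * exp (of_real u * z)) field_differentiable at z" for z :: complex
    by (rule holomorphic_on_imp_differentiable_at[of _ "ball 0 (norm z + 1)"]) auto
  then show ?thesis by (simp add: holomorphic_on_def field_differentiable_at_within)
qed

text \<open>The part \<open>t \<ge> 1\<close> of the Mellin integral of the theta tail in the variable \<open>u = ln t\<close>.\<close>
definition theta_weight :: "real \<Rightarrow> real" where
  "theta_weight u = (if u < 0 then 0 else theta_tail (exp u))"

lemma theta_tail_nonneg: "x > 0 \<Longrightarrow> theta_tail x \<ge> 0"
  unfolding theta_tail_def by (intro suminf_nonneg summable_theta_tail) auto

lemma theta_tail_measurable [measurable]: "theta_tail \<in> borel_measurable borel"
  unfolding theta_tail_def by measurable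

lemma theta_weight_measurable [measurable]: "theta_weight \<in> borel_measurable borel"
  unfolding theta_weight_def by measurable

lemma theta_weight_nonneg: "theta_weight u \<ge> 0"
  by (simp add: theta_weight_def theta_tail_nonneg)

lemma theta_tail_le:
  assumes "x \<ge> 1"
  shows "theta_tail x \<le> exp (- pi * x) / (1 - exp (- pi))"
proof -
  have g: "(\<lambda>n. exp (- pi * x) * exp (- pi * x) ^ n) sums (exp (- pi * x) * (1 / (1 - exp (- pi * x))))"
    using assms by (intro sums_mult geometric_sums) auto
  have "theta_tail x \<le> exp (- pi * x) * (1 / (1 - exp (- pi * x)))"
    unfolding theta_tail_def using assms g
    by (subst sums_unique[OF g], intro suminf_le theta_term_le summable_theta_tail)
       (auto intro: sums_summable)
  also have "\<dots> \<le> exp (- pi * x) * (1 / (1 - exp (- pi)))"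
    using assms by (intro mult_left_mono divide_left_mono) auto
  finally show ?thesis by simp
qed

text
\<open>The weight is at most a constant times \<open>exp (- pi * exp u)\<close>, and \<open>exp u \<ge> u\<^sup>2 / 2\<close>, so that completing the square yields a Gaussian majorant for every exponential rate \<open>R\<close>.\<close>
lemma theta_weight_integrable: "integrable lborel (\<lambda>u. theta_weight u * exp (R * u))"
proof (rule Bochner_Integration.integrable_bound)
  have "integrable lborel (\<lambda>u. norm (exp (- of_real pi * of_real (1/4) * of_real u ^ 2 + \<i> * of_real 0 * of_real u) :: complex))"
    by (intro integrable_norm integrable_gaussian_fourier) auto
  then show "integrable lborel (\<lambda>u. exp (R\<^sup>2 / pi) / (1 - exp (- pi)) * exp (- pi / 4 * u\<^sup>2))"
    by (intro integrable_mult_right) (simp add: norm_exp_eq_Re power2_eq_square)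
  show "AE u in lborel. norm (theta_weight u * exp (R * u)) \<le> norm (exp (R\<^sup>2 / pi) / (1 - exp (- pi)) * exp (- pi / 4 * u\<^sup>2))"
  proof (intro AE_I2)
    fix u :: real
    show "norm (theta_weight u * exp (R * u)) \<le> norm (exp (R\<^sup>2 / pi) / (1 - exp (- pi)) * exp (- pi / 4 * u\<^sup>2))"
    proof (cases "u < 0")
      case False
      then have u: "u \<ge> 0" by simp
      have "1 + u + u\<^sup>2 / 2 \<le> exp u" using exp_lower_Taylor_quadratic[OF u] by simp
      then have "u\<^sup>2 / 2 \<le> exp u" using u by linarith
      then have 1: "- pi * exp u \<le> - pi * (u\<^sup>2 / 2)" by simp
      have "0 \<le> (R - pi / 2 * u)\<^sup>2 / pi" by simp
      also have "\<dots> = R\<^sup>2 / pi - R * u + pi / 4 * u\<^sup>2" by (simp add: power2_eq_square field_simps)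
      finally have 2: "- pi * exp u + R * u \<le> R\<^sup>2 / pi + - pi / 4 * u\<^sup>2" using 1 by argo
      have "theta_weight u * exp (R * u) \<le> exp (- pi * exp u) / (1 - exp (- pi)) * exp (R * u)"
        using False u theta_tail_le[of "exp u"] by (intro mult_right_mono) (auto simp: theta_weight_def)
      also have "\<dots> = exp (- pi * exp u + R * u) / (1 - exp (- pi))"
        by (simp add: exp_add exp_diff exp_minus field_simps)
      also have "\<dots> \<le> exp (R\<^sup>2 / pi + - pi / 4 * u\<^sup>2) / (1 - exp (- pi))"
        using 2 by (intro divide_right_mono) auto
      also have "\<dots> = exp (R\<^sup>2 / pi) / (1 - exp (- pi)) * exp (- pi / 4 * u\<^sup>2)"
        by (simp only: exp_add) simp
      finally show ?thesis using theta_weight_nonneg[of u] by (simp add: abs_mult)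
    qed (auto simp: theta_weight_def)
  qed
qed measurable

definition theta_moment :: "complex \<Rightarrow> complex" where
  "theta_moment z = (LINT u|lborel. of_real (theta_weight u) * exp (of_real u * z))"

lemma theta_moment_holomorphic: "theta_moment holomorphic_on A"
proof -
  have "theta_moment holomorphic_on UNIV"
    unfolding theta_moment_def[abs_def]
    by (rule entire_exponential_moments)
       (auto intro: theta_weight_nonneg theta_weight_integrable, simp add: theta_weight_def)
  then show ?thesis by (rule holomorphic_on_subset) auto
qed

text
\<open>This is \<open>2 \<xi>(s) = s (s - 1) pi\<^bsup>-s/2\<^esup> \<Gamma>(s/2) \<zeta>(s)\<close> with Riemann's \<open>\<xi>\<close>. Taking the folded Mellin integral as the definition makes it entire and symmetric under \<open>s \<mapsto> 1 - s\<close> at sight; the relation to the Dirichlet series is proved afterwards.\<close>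
definition completed_zeta :: "complex \<Rightarrow> complex" where
  "completed_zeta s = 1 + s * (s - 1) * (theta_moment (s / 2) + theta_moment ((1 - s) / 2))"

lemma completed_zeta_holomorphic [holomorphic_intros]: "completed_zeta holomorphic_on A"
proof -
  have "(\<lambda>s. theta_moment (s / 2)) holomorphic_on A" "(\<lambda>s. theta_moment ((1 - s) / 2)) holomorphic_on A"
    by (intro holomorphic_on_compose_gen[OF _ theta_moment_holomorphic[of UNIV], unfolded o_def] holomorphic_intros; simp)+
  then show ?thesis unfolding completed_zeta_def[abs_def] by (intro holomorphic_intros)
qed

lemma completed_zeta_reflect: "completed_zeta (1 - s) = completed_zeta s"
  by (simp add: completed_zeta_def algebra_simps)

lemma completed_zeta_0_1 [simp]: "completed_zeta 0 = 1" "completed_zeta 1 = 1"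
  by (simp_all add: completed_zeta_def)

text \<open>Euler's integral for \<open>Gamma q\<close> after the substitution \<open>t = c * exp u\<close>.\<close>
lemma
  fixes c q :: real
  assumes c: "c > 0" and q: "q > 0"
  shows integrable_exp_exp: "integrable lborel (\<lambda>u. exp (- c * exp u) * exp (q * u))"
    and integral_exp_exp: "(LINT u|lborel. exp (- c * exp u) * exp (q * u)) = Gamma q / c powr q"
proof -
  define f where "f = (\<lambda>t::real. t powr (q - 1) / exp t)"
  define h where "h = (\<lambda>u. exp (- c * exp u) * exp (q * u))"
  have img: "range (\<lambda>u. c * exp u) = {0<..}"
  proof -
    have "t = c * exp (ln (t / c))" if "t > 0" for t using that c by simp
    then have "t \<in> range (\<lambda>u. c * exp u)" if "t > 0" for t using that by blast
    then show ?thesis using c by auto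
  qed
  have "f absolutely_integrable_on {0<..} \<and> integral {0<..} f = Gamma q"
  proof
    have neg: "negligible {t \<in> {0..} - {0<..}. f t \<noteq> 0}" "negligible {t \<in> {0<..} - {0..}. f t \<noteq> 0}"
      by (rule negligible_subset[of "{0}"]; force)+
    have *: "(f has_integral Gamma q) {0<..}"
      using Gamma_integral_real[OF q] unfolding f_def[symmetric] has_integral_spike_set_eq[OF neg] .
    then show "f absolutely_integrable_on {0<..}"
      by (intro nonnegative_absolutely_integrable_1) (auto simp: f_def integrable_on_def)
    show "integral {0<..} f = Gamma q" using * by (rule integral_unique)
  qed
  then have "(\<lambda>u. \<bar>c * exp u\<bar> * f (c * exp u)) absolutely_integrable_on UNIV
       \<and> integral UNIV (\<lambda>u. \<bar>c * exp u\<bar> * f (c * exp u)) = Gamma q"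
    unfolding img[symmetric]
    by (subst has_absolute_integral_change_of_variables_1')
       (use c in \<open>auto simp: inj_on_def has_real_derivative_iff_has_vector_derivative[symmetric] intro!: derivative_eq_intros\<close>)
  moreover have "\<bar>c * exp u\<bar> * f (c * exp u) = c powr q * h u" for u
  proof -
    have "c * exp u * (c * exp u) powr (q - 1) = (c * exp u) powr q"
      using c powr_mult_base[of "c * exp u" "q - 1"] by simp
    also have "\<dots> = c powr q * exp (q * u)"
      using c by (simp add: powr_mult powr_def[of "exp u"])
    finally show ?thesis using c by (simp add: f_def h_def exp_minus field_simps)
  qed
  ultimately have *: "(\<lambda>u. c powr q * h u) absolutely_integrable_on UNIV" "integral UNIV (\<lambda>u. c powr q * h u) = Gamma q"
    by auto
  have [measurable]: "h \<in> borel_measurable borel" unfolding h_def by measurable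
  have "integrable lborel (\<lambda>u. c powr q * h u)"
    using *(1) unfolding set_integrable_def by (simp add: integrable_completion)
  then show i: "integrable lborel (\<lambda>u. exp (- c * exp u) * exp (q * u))"
    using c unfolding h_def[symmetric] by simp
  have "(LINT u|lborel. c powr q * h u) = Gamma q"
    using *(2) integral_lborel[OF \<open>integrable lborel (\<lambda>u. c powr q * h u)\<close>] by simp
  then show "(LINT u|lborel. exp (- c * exp u) * exp (q * u)) = Gamma q / c powr q"
    using c unfolding h_def[symmetric] by (simp add: field_simps)
qed

text \<open>Termwise integration: the Mellin transform of the theta tail is \<open>\<Gamma>(q) pi\<^bsup>-q\<^esup> \<zeta>(2q)\<close>.\<close>
lemma
  fixes q :: real
  assumes q: "q > 1 / 2"
  shows integrable_theta_mellin: "integrable lborel (\<lambda>u. theta_tail (exp u) * exp (q * u))"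
    and theta_mellin_sums: "(\<lambda>n. Gamma q * pi powr (-q) * real (Suc n) powr (- (2 * q))) sums (LINT u|lborel. theta_tail (exp u) * exp (q * u))"
proof -
  define f where "f = (\<lambda>n u. exp (- (pi * (real (Suc n))\<^sup>2) * exp u) * exp (q * u))"
  have int: "integrable lborel (f n)" for n
    unfolding f_def by (rule integrable_exp_exp) (use q in auto)
  have val: "(LINT u|lborel. f n u) = Gamma q * pi powr (-q) * real (Suc n) powr (- (2 * q))" for n
  proof -
    have "(LINT u|lborel. f n u) = Gamma q / (pi * (real (Suc n))\<^sup>2) powr q"
      unfolding f_def by (rule integral_exp_exp) (use q in auto)
    also have "(pi * (real (Suc n))\<^sup>2) powr q = pi powr q * real (Suc n) powr (2 * q)"
    proof -
      have "(real (Suc n))\<^sup>2 = real (Suc n) powr 2" by simp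
      then have "((real (Suc n))\<^sup>2) powr q = real (Suc n) powr (2 * q)"
        by (simp only: powr_powr)
      then show ?thesis by (simp add: powr_mult del: of_nat_Suc)
    qed
    finally show ?thesis by (simp add: powr_minus field_simps)
  qed
  have sm: "summable (\<lambda>n. LINT u|lborel. norm (f n u))"
  proof -
    have "summable (\<lambda>n. real (Suc n) powr (- (2 * q)))"
      using q by (subst summable_Suc_iff) (simp add: summable_real_powr_iff)
    then have "summable (\<lambda>n. LINT u|lborel. f n u)"
      unfolding val by (intro summable_mult)
    then show ?thesis by (simp add: f_def)
  qed
  have eq: "(\<Sum>n. f n u) = theta_tail (exp u) * exp (q * u)" "summable (\<lambda>n. norm (f n u))" for u
    using summable_theta_tail[of "exp u"]
    by (auto simp: f_def theta_tail_def suminf_mult2 intro!: summable_mult2)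
  show "integrable lborel (\<lambda>u. theta_tail (exp u) * exp (q * u))"
    unfolding eq(1)[symmetric] by (rule integrable_suminf[OF int _ sm]) (rule AE_I2, rule eq)
  show "(\<lambda>n. Gamma q * pi powr (-q) * real (Suc n) powr (- (2 * q))) sums (LINT u|lborel. theta_tail (exp u) * exp (q * u))"
    unfolding eq(1)[symmetric] val[symmetric] by (rule sums_integral[OF int _ sm]) (rule AE_I2, rule eq)
qed

lemma integral_exp_decay:
  assumes "b > (0::real)"
  shows "integrable lborel (\<lambda>u. indicator {0..} u * exp (- b * u))" "(LINT u|lborel. indicator {0..} u * exp (- b * u)) = 1 / b"
proof -
  have h: "((\<lambda>u. exp (- b * u)) has_integral exp (- b * 0) / b) {0..}"
    by (rule has_integral_exp_minus_to_infinity[OF assms])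
  then have "set_integrable lebesgue {0..} (\<lambda>u. exp (- b * u))"
    by (intro nonnegative_absolutely_integrable_1) (auto simp: integrable_on_def)
  then show i: "integrable lborel (\<lambda>u. indicator {0..} u * exp (- b * u))"
    unfolding set_integrable_def by (simp add: integrable_completion)
  then have "set_integrable lborel {0..} (\<lambda>u. exp (- b * u))" by (simp add: set_integrable_def)
  from set_borel_integral_eq_integral(2)[OF this] h
  show "(LINT u|lborel. indicator {0..} u * exp (- b * u)) = 1 / b"
    by (simp add: set_lebesgue_integral_def integral_unique)
qed

text
\<open>Riemann's argument. The half \<open>u < 0\<close> of the integral is folded onto \<open>u > 0\<close> by the theta relation, whose elementary terms produce the two poles \<open>1 / (2q - 1)\<close> and \<open>1 / (2q)\<close>.\<close>
lemma theta_mellin_split: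
  fixes q :: real
  assumes q: "q > 1 / 2"
  shows "(LINT u|lborel. theta_tail (exp u) * exp (q * u)) =
           (LINT u|lborel. theta_weight u * exp (u * q)) + (LINT u|lborel. theta_weight u * exp (u * (1/2 - q)))
            + (1 / (2 * q - 1) - 1 / (2 * q))"
proof -
  define h where "h = (\<lambda>u. theta_tail (exp u) * exp (q * u))"
  have inth: "integrable lborel h" unfolding h_def by (rule integrable_theta_mellin[OF q])
  have [measurable]: "h \<in> borel_measurable borel" unfolding h_def by measurable
  have w: "integrable lborel (\<lambda>u. theta_weight u * exp (u * R))" for R
    using theta_weight_integrable[of R] by (simp add: mult.commute)
  have pos: "indicator {0..} u * h u = theta_weight u * exp (u * q)" for u
    by (auto simp: h_def theta_weight_def indicator_def mult_ac)
  have neg: "indicator {..<0} (- u) = (indicator {0<..} u :: real)" for u :: real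
    by (auto simp: indicator_def)
  define B where "B = (\<lambda>u::real. indicator {0..} u * exp (- (q - 1/2) * u))"
  define C where "C = (\<lambda>u::real. indicator {0..} u * exp (- q * u))"
  have refl: "indicator {0..} u * h (- u) = theta_weight u * exp (u * (1/2 - q))
      + ((1/2) * B u - (1/2) * C u)" for u :: real
  proof (cases "u < 0")
    case False
    have "1 + 2 * theta_tail (1 / exp u) = sqrt (exp u) * (1 + 2 * theta_tail (exp u))"
      by (rule theta_tail_reciprocal) auto
    also have "sqrt (exp u) = exp (u / 2)"
      by (rule real_sqrt_unique) (auto simp flip: exp_double)
    finally have "theta_tail (exp (- u)) = exp (u / 2) * theta_tail (exp u) + (exp (u / 2) - 1) / 2"
      by (simp add: exp_minus inverse_eq_divide field_simps)
    then have "h (- u) = (exp (u / 2) * theta_tail (exp u) + (exp (u / 2) - 1) / 2) * exp (- q * u)"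
      by (simp add: h_def)
    also have "\<dots> = theta_tail (exp u) * (exp (u / 2) * exp (- q * u)) + ((exp (u / 2) * exp (- q * u)) - exp (- q * u)) / 2"
      by (simp add: field_simps)
    also have "exp (u / 2) * exp (- q * u) = exp (- (q - 1/2) * u)"
      by (simp add: field_simps flip: exp_add)
    finally show ?thesis using False by (simp add: theta_weight_def B_def C_def field_simps)
  qed (auto simp: theta_weight_def B_def C_def)
  have B: "integrable lborel B" "(LINT u|lborel. B u) = 1 / (q - 1/2)"
    unfolding B_def by (rule integral_exp_decay; use q in simp)+
  have C: "integrable lborel C" "(LINT u|lborel. C u) = 1 / q"
    unfolding C_def by (rule integral_exp_decay; use q in simp)+
  have val_refl: "(LINT u|lborel. indicator {0..} u * h (- u)) = (LINT u|lborel. theta_weight u * exp (u * (1/2 - q)))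
      + ((1/2) * (1 / (q - 1/2)) - (1/2) * (1 / q))"
    unfolding refl B(2)[symmetric] C(2)[symmetric]
    using w[of "1/2 - q"] B(1) C(1) by simp
  have "(LINT u|lborel. h u) = (LINT u|lborel. indicator {0..} u * h u + indicator {..<0} u * h u)"
    by (intro Bochner_Integration.integral_cong) (auto simp: indicator_def)
  also have "\<dots> = (LINT u|lborel. indicator {0..} u * h u) + (LINT u|lborel. indicator {..<0} u * h u)"
    using integrable_mult_indicator[of "{0..}" lborel h] integrable_mult_indicator[of "{..<0}" lborel h] inth
    by (intro Bochner_Integration.integral_add) auto
  also have "(LINT u|lborel. indicator {..<0} u * h u) = (LINT u|lborel. indicator {..<0} (0 + (-1) * u) * h (0 + (-1) * u))"
    by (subst lborel_integral_real_affine[of "-1" _ 0]) auto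
  also have "\<dots> = (LINT u|lborel. indicator {0<..} u * h (- u))" by (simp add: neg)
  also have "\<dots> = (LINT u|lborel. indicator {0..} u * h (- u))"
  proof (rule integral_cong_AE)
    have "AE u in lborel. u \<noteq> (0::real)" by (rule AE_lborel_singleton)
    then show "AE u in lborel. indicator {0<..} u * h (- u) = indicator {0..} u * h (- u)"
      by eventually_elim (auto simp: indicator_def)
  qed measurable
  also note val_refl
  also have "(1/2) * (1 / (q - 1/2)) - (1/2) * (1 / q) = 1 / (2 * q - 1) - 1 / (2 * q)"
    by (simp add: right_diff_distrib)
  finally show ?thesis unfolding pos unfolding h_def by simp
qed

section \<open>Dirichlet series and the functional equation of zeta\<close>

lemma powr_minus_of_nat_norm:
  "norm (of_nat (Suc n) powr (- s) :: complex) = real (Suc n) powr (- Re s)"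
  by (subst norm_powr_real_powr) auto

lemma Dirichlet_series_absolutely_convergent:
  fixes a :: "nat \<Rightarrow> complex" and c :: real
  assumes "summable (\<lambda>n. norm (a n) * real (Suc n) powr (- c))" and "Re s \<ge> c"
  shows "summable (\<lambda>n. norm (a n * of_nat (Suc n) powr (- s)))"
proof (rule summable_comparison_test'[OF assms(1), of 0])
  fix n
  have "real (Suc n) powr (- Re s) \<le> real (Suc n) powr (- c)"
    using assms(2) by (intro powr_mono) auto
  then show "norm (norm (a n * of_nat (Suc n) powr (- s))) \<le> norm (a n) * real (Suc n) powr (- c)"
    unfolding norm_mult powr_minus_of_nat_norm by (simp add: mult_left_mono)
qed

lemma Dirichlet_series_derivative:
  fixes a :: "nat \<Rightarrow> complex" and c :: real
  assumes sm: "\<And>\<sigma>. \<sigma> > c \<Longrightarrow> summable (\<lambda>n. norm (a n) * real (Suc n) powr (- \<sigma>))"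
  obtains F F' where "\<And>s. Re s > c \<Longrightarrow> (\<lambda>n. a n * of_nat (Suc n) powr (- s)) sums F s"
    "\<And>s. Re s > c \<Longrightarrow> (\<lambda>n. - of_real (ln (real (Suc n))) * a n * of_nat (Suc n) powr (- s)) sums F' s"
    "\<And>s. Re s > c \<Longrightarrow> (F has_field_derivative F' s) (at s)"
proof -
  define f where "f = (\<lambda>n s. a n * of_nat (Suc n) powr (- s))"
  define f' where "f' = (\<lambda>n s. - of_real (ln (real (Suc n))) * a n * of_nat (Suc n) powr (- s) :: complex)"
  have "\<exists>g g'. \<forall>x\<in>{s. Re s > c}. (\<lambda>n. f n x) sums g x \<and> (\<lambda>n. f' n x) sums g' x \<and> (g has_field_derivative g' x) (at x)"
  proof (rule series_and_derivative_comparison_local)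
    show "open {s. Re s > c}" by (rule open_halfspace_Re_gt)
    fix s assume "s \<in> {s. Re s > c}"
    then have s: "Re s > c" by simp
    have "Ln (of_nat (Suc n)) = of_real (ln (real (Suc n)))" for n
      by (subst of_real_of_nat_eq[symmetric], subst Ln_of_real) auto
    then have pw: "of_nat (Suc n) powr (- z) = exp (- z * of_real (ln (real (Suc n))))" for n and z :: complex
      by (simp add: powr_def del: of_nat_Suc)
    show "(f n has_field_derivative f' n s) (at s)" for n
      unfolding f_def f'_def pw by (auto intro!: derivative_eq_intros simp del: of_nat_Suc)
    define \<delta> where "\<delta> = (Re s - c) / 2"
    show "\<exists>d h. 0 < d \<and> summable h \<and> (\<forall>\<^sub>F n in sequentially. \<forall>y\<in>ball s d \<inter> {s. Re s > c}. norm (f n y) \<le> h n)"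
    proof (intro exI conjI always_eventually allI ballI)
      show "0 < \<delta>" using s by (simp add: \<delta>_def)
      show "summable (\<lambda>n. norm (a n) * real (Suc n) powr (- (c + \<delta>)))"
        by (rule sm) (use s in \<open>simp add: \<delta>_def\<close>)
      fix n y assume y: "y \<in> ball s \<delta> \<inter> {s. Re s > c}"
      have "\<bar>Re s - Re y\<bar> \<le> norm (s - y)" using abs_Re_le_cmod[of "s - y"] by simp
      then have "\<bar>Re s - Re y\<bar> < (Re s - c) / 2" using y unfolding mem_ball dist_norm Int_iff \<delta>_def by linarith
      then have "c + (Re s - c) / 2 \<le> Re y" by argo
      then have "real (Suc n) powr (- Re y) \<le> real (Suc n) powr (- (c + \<delta>))"
        by (intro powr_mono) (auto simp: \<delta>_def)
      then show "norm (f n y) \<le> norm (a n) * real (Suc n) powr (- (c + \<delta>))"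
        unfolding f_def norm_mult powr_minus_of_nat_norm by (intro mult_left_mono) auto
    qed
  qed
  then show ?thesis using that unfolding f_def f'_def by blast
qed

lemma summable_Suc_powr: "\<sigma> > 1 \<Longrightarrow> summable (\<lambda>n. real (Suc n) powr (- \<sigma>))"
  by (subst summable_Suc_iff) (simp add: summable_real_powr_iff)

text
\<open>The entire function \<open>(s - 1) \<zeta>(s)\<close>. The factor \<open>1 / Gamma (s / 2 + 1)\<close> combines the reciprocal of \<open>Gamma (s / 2)\<close> with the division by \<open>s\<close>, so that no exceptional value has to be filled in.\<close>
definition regular_zeta :: "complex \<Rightarrow> complex" where
  "regular_zeta s = completed_zeta s * exp (s / 2 * of_real (ln pi)) * rGamma (s / 2 + 1) / 2"

lemma regular_zeta_holomorphic [holomorphic_intros]: "regular_zeta holomorphic_on A"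
  unfolding regular_zeta_def[abs_def] by (intro holomorphic_intros) auto

lemma regular_zeta_of_real:
  fixes x :: real
  assumes x: "x > 1"
  shows "(\<lambda>n. of_nat (Suc n) powr (- complex_of_real x)) sums (regular_zeta (of_real x) / (of_real x - 1))"
proof -
  define q where "q = x / 2"
  have q: "q > 1 / 2" "x = 2 * q" using x by (auto simp: q_def)
  define I where "I = (LINT u|lborel. theta_tail (exp u) * exp (q * u))"
  have mom: "theta_moment (of_real r) = of_real (LINT u|lborel. theta_weight u * exp (u * r))" for r
    unfolding theta_moment_def integral_complex_of_real[symmetric] by (simp add: exp_of_real[symmetric])
  have "(1 - complex_of_real x) / 2 = of_real (1 / 2 - q)" "complex_of_real x / 2 = of_real q"
    using q by (auto simp: field_simps)
  then have m: "theta_moment (of_real x / 2) + theta_moment ((1 - of_real x) / 2)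
     = of_real (I - (1 / (2 * q - 1) - 1 / (2 * q)))"
    using theta_mellin_split[OF q(1)] by (simp only: mom I_def) simp
  have c: "completed_zeta (of_real x) = of_real (x * (x - 1) * I)"
  proof -
    have "1 + x * (x - 1) * (I - (1 / (2 * q - 1) - 1 / (2 * q))) = x * (x - 1) * I"
      using q by (simp add: field_simps)
    then have "of_real (1 + x * (x - 1) * (I - (1 / (2 * q - 1) - 1 / (2 * q)))) = complex_of_real (x * (x - 1) * I)"
      by (simp only:)
    then show ?thesis unfolding completed_zeta_def m by simp
  qed
  have G: "Gamma (q + 1) = q * Gamma q"
  proof (rule Gamma_plus1)
    show "q \<notin> \<int>\<^sub>\<le>\<^sub>0" using q by (auto elim!: nonpos_Ints_cases)
  qed
  have "rGamma (complex_of_real x / 2 + 1) = of_real (rGamma (q + 1))"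
    using q by (simp flip: rGamma_complex_of_real)
  also have "rGamma (q + 1) = 1 / (q * Gamma q)"
    unfolding rGamma_inverse_Gamma G by (rule inverse_eq_divide)
  finally have rG: "rGamma (complex_of_real x / 2 + 1) = of_real (1 / (q * Gamma q))" .
  have e: "exp (complex_of_real x / 2 * of_real (ln pi)) = of_real (pi powr q)"
    by (simp add: powr_def q exp_of_real[symmetric])
  have Gp: "Gamma q > 0" using q by (intro Gamma_real_pos) auto
  have "regular_zeta (of_real x) / (of_real x - 1) = of_real (x * (x - 1) * I * pi powr q * (1 / (q * Gamma q)) / 2 / (x - 1))"
    unfolding regular_zeta_def c rG e by simp
  also have "x * (x - 1) * I * pi powr q * (1 / (q * Gamma q)) / 2 / (x - 1) = pi powr q / Gamma q * I"
    using q Gp by (simp add: divide_simps)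
  finally have Z: "regular_zeta (of_real x) / (of_real x - 1) = of_real (pi powr q / Gamma q * I)" .
  have "(\<lambda>n. pi powr q / Gamma q * (Gamma q * pi powr (-q) * real (Suc n) powr (- (2 * q)))) sums (pi powr q / Gamma q * I)"
    unfolding I_def by (intro sums_mult theta_mellin_sums q)
  note S = this
  have "(\<lambda>n. real (Suc n) powr (- x)) sums (pi powr q / Gamma q * I)"
  proof -
    have "pi powr q / Gamma q * (Gamma q * pi powr (-q) * r) = r" for r
      using Gp by (simp add: powr_minus)
    then show ?thesis using S unfolding q(2)[symmetric] by (simp only:)
  qed
  then have "(\<lambda>n. complex_of_real (real (Suc n) powr (- x))) sums (regular_zeta (of_real x) / (of_real x - 1))"
    unfolding Z by (rule sums_of_real)
  moreover have "complex_of_real (real (Suc n) powr (- x)) = of_nat (Suc n) powr (- complex_of_real x)" for n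
    by (simp add: powr_of_real[symmetric] del: of_nat_Suc)
  ultimately show ?thesis by simp
qed

text
\<open>Both sides are holomorphic for \<open>Re s > 1\<close> and agree on the real ray, where the Mellin integral has been computed.\<close>
lemma regular_zeta_sums:
  assumes "Re s > 1"
  shows "(\<lambda>n. of_nat (Suc n) powr (- s)) sums (regular_zeta s / (s - 1))"
proof -
  obtain F F' where F: "\<And>s. Re s > 1 \<Longrightarrow> (\<lambda>n. 1 * of_nat (Suc n) powr (- s)) sums F s"
    "\<And>s. Re s > 1 \<Longrightarrow> (F has_field_derivative F' s) (at s)"
    by (rule Dirichlet_series_derivative[of 1 "\<lambda>_. 1"]) (use summable_Suc_powr in simp, blast)
  have "F holomorphic_on {s. Re s > 1}"
    using F(2) by (subst holomorphic_on_open) (auto simp: open_halfspace_Re_gt)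
  then have "(\<lambda>s. regular_zeta s / (s - 1) - F s) holomorphic_on {s. Re s > 1}"
    by (intro holomorphic_intros) auto
  then have "regular_zeta s / (s - 1) - F s = 0"
  proof (rule analytic_continuation[where U = "of_real ` {1<..}" and \<xi> = "of_real 2"])
    show "connected {s::complex. Re s > 1}"
      by (intro convex_connected convex_halfspace_Re_gt)
    show "complex_of_real 2 islimpt (of_real ` {1<..})"
      by (rule of_real_islimpt, rule interior_limit_point) (auto simp: interior_open)
    fix z :: complex assume "z \<in> of_real ` {1<..}"
    then obtain x where x: "x > 1" "z = of_real x" by auto
    then show "regular_zeta z / (z - 1) - F z = 0"
      using regular_zeta_of_real[OF x(1)] F(1)[of z] by (simp add: sums_iff)
  qed (use assms in \<open>auto simp: open_halfspace_Re_gt\<close>)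
  with F(1)[OF assms] show ?thesis by simp
qed

text
\<open>The plane punctured at 1 is connected, so the continuation is determined by the Dirichlet series; this identifies the function defined by description with the explicit one.\<close>
lemma riemann_zeta_eq: "riemann_zeta = (\<lambda>s. if s = 1 then 0 else regular_zeta s / (s - 1))" (is "_ = ?Z")
  unfolding riemann_zeta_def
proof (rule the_equality)
  have "(\<lambda>s. regular_zeta s / (s - 1)) holomorphic_on -{1}"
    by (intro holomorphic_intros) auto
  then have 1: "?Z holomorphic_on -{1}" by (rule holomorphic_transform) auto
  have 2: "(\<lambda>n. 1 / of_nat (Suc n) powr s) sums ?Z s" if "Re s > 1" for s
    using regular_zeta_sums[OF that] that by (auto simp: powr_minus_divide)
  show "?Z holomorphic_on -{1} \<and> (\<forall>s. Re s > 1 \<longrightarrow> (\<lambda>n. 1 / of_nat (Suc n) powr s) sums ?Z s) \<and> ?Z 1 = 0"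
    by (intro conjI allI impI 1 2) auto
  fix f :: "complex \<Rightarrow> complex"
  assume f: "f holomorphic_on -{1} \<and> (\<forall>s. Re s > 1 \<longrightarrow> (\<lambda>n. 1 / of_nat (Suc n) powr s) sums f s) \<and> f 1 = 0"
  have "f s = ?Z s" if "s \<noteq> 1" for s
  proof (rule analytic_continuation_open[where s = "{s. Re s > 1}" and s' = "-{1}" and f = f and g = ?Z])
    show "{s::complex. Re s > 1} \<noteq> {}" by (auto intro: exI[of _ "2::complex"])
    show "connected (- {1::complex})"
      by (intro connected_punctured_universe) auto
    fix z :: complex assume "z \<in> {s. Re s > 1}"
    then show "f z = ?Z z" using f 2[of z] sums_unique2 by blast
  qed (use f 1 that in \<open>auto simp: open_halfspace_Re_gt\<close>)
  then show "f = ?Z" using f by auto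
qed

lemma riemann_zeta_sums:
  "Re s > 1 \<Longrightarrow> (\<lambda>n. of_nat (Suc n) powr (- s)) sums riemann_zeta s"
  using regular_zeta_sums[of s] by (auto simp: riemann_zeta_eq)

lemma regular_zeta_eq: "s \<noteq> 1 \<Longrightarrow> regular_zeta s = (s - 1) * riemann_zeta s"
  by (simp add: riemann_zeta_eq)

lemma riemann_zeta_holomorphic [holomorphic_intros]: "1 \<notin> A \<Longrightarrow> riemann_zeta holomorphic_on A"
proof -
  assume "1 \<notin> A"
  then have "(\<lambda>s. regular_zeta s / (s - 1)) holomorphic_on A"
    by (intro holomorphic_intros) auto
  then show ?thesis by (rule holomorphic_transform) (use \<open>1 \<notin> A\<close> in \<open>auto simp: riemann_zeta_eq\<close>)
qed

lemma regular_zeta_1: "regular_zeta 1 = 1"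
proof -
  have "exp (of_real (ln pi) / 2) = complex_of_real (sqrt pi)"
    by (simp add: exp_of_real[symmetric] powr_half_sqrt[symmetric] powr_def)
  moreover have "rGamma (1 / 2 + 1 :: complex) = 2 / of_real (sqrt pi)"
  proof -
    have "(1 / 2 :: complex) \<notin> \<int>\<^sub>\<le>\<^sub>0"
      by (auto elim!: nonpos_Ints_cases simp: complex_eq_iff)
    then have "Gamma (1 / 2 + 1 :: complex) = 1 / 2 * of_real (sqrt pi)"
      using Gamma_plus1[of "1/2 :: complex"] unfolding Gamma_one_half_complex by blast
    then show ?thesis unfolding rGamma_inverse_Gamma by (simp only:) simp
  qed
  ultimately show ?thesis by (simp add: regular_zeta_def)
qed

lemma completed_zeta_eq:
  assumes "s / 2 \<notin> \<int>\<^sub>\<le>\<^sub>0" "s \<noteq> 1"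
  shows "completed_zeta s = s * (s - 1) * (of_real pi powr (- (s / 2)) * Gamma (s / 2) * riemann_zeta s)"
proof -
  have s0: "s \<noteq> 0" using assms by auto
  have pi: "of_real pi powr (- (s / 2)) = exp (- (s / 2 * of_real (ln pi)))"
    by (simp add: powr_def Ln_of_real)
  have "Gamma (s / 2 + 1) = s / 2 * Gamma (s / 2)" using assms by (intro Gamma_plus1) auto
  moreover have "Gamma (s / 2) \<noteq> 0" using assms by (simp add: Gamma_eq_zero_iff)
  ultimately have "Gamma (s / 2 + 1) * 2 = s * Gamma (s / 2)" "Gamma (s / 2 + 1) \<noteq> 0"
    using s0 by auto
  then have "rGamma (s / 2 + 1) * (s * Gamma (s / 2)) = 2"
    unfolding rGamma_inverse_Gamma by (metis mult.assoc left_inverse mult_1)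
  then have "s * (s - 1) * (exp (- (s / 2 * of_real (ln pi))) * Gamma (s / 2) * (regular_zeta s / (s - 1)))
      = completed_zeta s * (exp (- (s / 2 * of_real (ln pi))) * exp (s / 2 * of_real (ln pi)))"
  proof -
    have "s * (s - 1) * (exp (- (s / 2 * of_real (ln pi))) * Gamma (s / 2) * (regular_zeta s / (s - 1)))
      = exp (- (s / 2 * of_real (ln pi))) * (s * Gamma (s / 2)) * regular_zeta s"
      using assms(2) by simp
    also have "\<dots> = completed_zeta s * (exp (- (s / 2 * of_real (ln pi))) * exp (s / 2 * of_real (ln pi)))
        * (rGamma (s / 2 + 1) * (s * Gamma (s / 2))) / 2"
      unfolding regular_zeta_def by simp
    finally show ?thesis
      unfolding \<open>rGamma (s / 2 + 1) * (s * Gamma (s / 2)) = 2\<close> by simp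
  qed
  also have "exp (- (s / 2 * of_real (ln pi))) * exp (s / 2 * of_real (ln pi)) = 1"
    by (simp flip: exp_add)
  finally show ?thesis unfolding pi using assms(2) by (simp add: riemann_zeta_eq)
qed

text \<open>The symmetry of the completed zeta function, divided by both zeta values.\<close>
theorem zeta_inverse_functional_equation_holds: zeta_inverse_functional_equation
  unfolding zeta_inverse_functional_equation_def
proof (intro allI impI)
  fix s :: complex
  assume s: "s / 2 \<notin> \<int>\<^sub>\<le>\<^sub>0" "(1 - s) / 2 \<notin> \<int>\<^sub>\<le>\<^sub>0" "riemann_zeta s \<noteq> 0" "riemann_zeta (1 - s) \<noteq> 0"
  have "s \<noteq> 0" "s \<noteq> 1" using s by auto
  have "s * (s - 1) * (of_real pi powr (- (s / 2)) * Gamma (s / 2) * riemann_zeta s)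
     = (1 - s) * ((1 - s) - 1) * (of_real pi powr (- ((1 - s) / 2)) * Gamma ((1 - s) / 2) * riemann_zeta (1 - s))"
    using completed_zeta_eq[of s] completed_zeta_eq[of "1 - s"] completed_zeta_reflect[of s] s \<open>s \<noteq> 0\<close> \<open>s \<noteq> 1\<close> by simp
  also have "(1 - s) * ((1 - s) - 1) = s * (s - 1)" by (simp add: algebra_simps)
  finally have "of_real pi powr (- (s / 2)) * Gamma (s / 2) * riemann_zeta s
     = of_real pi powr (- ((1 - s) / 2)) * Gamma ((1 - s) / 2) * riemann_zeta (1 - s)"
    using \<open>s \<noteq> 0\<close> \<open>s \<noteq> 1\<close> by simp
  then show "of_real pi powr (- (s / 2)) * Gamma (s / 2) * inverse (riemann_zeta (1 - s)) =
        of_real pi powr (- ((1 - s) / 2)) * Gamma ((1 - s) / 2) * inverse (riemann_zeta s)"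
    using s by (simp add: field_simps)
qed

section \<open>The Moebius series and the line Re s = 1\<close>

lemma has_sum_times:
  fixes f g :: "nat \<Rightarrow> complex"
  assumes f: "summable (\<lambda>n. norm (f n))" "f sums A" and g: "summable (\<lambda>n. norm (g n))" "g sums B"
  shows "((\<lambda>(i, j). f i * g j) has_sum (A * B)) (UNIV \<times> UNIV)"
proof -
  have fs: "(f has_sum A) UNIV" "(g has_sum B) UNIV" using f g by (intro norm_summable_imp_has_sum; simp)+
  have fa: "(\<lambda>i. norm (f i)) summable_on UNIV" "(\<lambda>i. norm (g i)) summable_on UNIV"
    using f g by (simp_all add: summable_on_UNIV_nonneg_real_iff)
  have "(\<lambda>x. norm ((\<lambda>(i, j). f i * g j) x)) summable_on (UNIV \<times> UNIV)"
    unfolding Infinite_Sum.abs_summable_on_Sigma_iff using fa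
    by (auto simp: norm_mult infsum_cmult_right' infsum_nonneg abs_mult intro!: summable_on_cmult_right summable_on_cmult_left)
  then have "(\<lambda>(i, j). f i * g j) summable_on (UNIV \<times> UNIV)"
    by (rule Infinite_Sum.abs_summable_summable)
  then obtain S where S: "((\<lambda>(i, j). f i * g j) has_sum S) (UNIV \<times> UNIV)"
    by (auto simp: summable_on_def)
  have "((\<lambda>i. f i * B) has_sum S) UNIV"
    by (rule has_sum_SigmaD[OF S]) (auto intro!: has_sum_cmult_right fs)
  moreover have "((\<lambda>i. f i * B) has_sum (A * B)) UNIV"
    by (intro has_sum_cmult_left fs)
  ultimately have "S = A * B" using has_sum_unique by blast
  with S show ?thesis by simp
qed

text \<open>The pairs \<open>(i, j)\<close> of the double series are grouped by the product \<open>(i + 1) * (j + 1)\<close>.\<close>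
lemma Dirichlet_convolution_sums:
  fixes f g :: "nat \<Rightarrow> complex"
  assumes f: "summable (\<lambda>n. norm (f (Suc n)))" "(\<lambda>n. f (Suc n)) sums A"
    and g: "summable (\<lambda>n. norm (g (Suc n)))" "(\<lambda>n. g (Suc n)) sums B"
  shows "(\<lambda>k. \<Sum>d | d dvd Suc k. f d * g (Suc k div d)) sums (A * B)"
proof -
  have "((\<lambda>(i, j). f (Suc i) * g (Suc j)) has_sum (A * B)) (UNIV \<times> UNIV)"
    using has_sum_times[OF f g] by simp
  then have "((\<lambda>(k, d). f d * g (Suc k div d)) has_sum (A * B)) (SIGMA k:UNIV. {d. d dvd Suc k})"
  proof (subst has_sum_reindex_bij_witness[where T = "UNIV \<times> UNIV" and h = "\<lambda>(i, j). f (Suc i) * g (Suc j)"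
      and i = "\<lambda>(i, j). (Suc i * Suc j - 1, Suc i)" and j = "\<lambda>(k, d). (d - 1, Suc k div d - 1)"])
    fix a assume "a \<in> (SIGMA k:UNIV. {d. d dvd Suc k})"
    then obtain k d where a: "a = (k, d)" "d dvd Suc k" by auto
    then obtain e where e: "Suc k = d * e" by auto
    then have "d > 0" "e > 0" by (auto intro: Nat.gr0I)
    then have *: "Suc k div d = e" "Suc (d - 1) = d" "Suc (e - 1) = e" "d * e - 1 = k" using e by auto
    show "(case case a of (k, d) \<Rightarrow> (d - 1, Suc k div d - 1) of (i, j) \<Rightarrow> (Suc i * Suc j - 1, Suc i)) = a"
      unfolding a prod.case * ..
    show "(case case a of (k, d) \<Rightarrow> (d - 1, Suc k div d - 1) of (i, j) \<Rightarrow> f (Suc i) * g (Suc j)) = (case a of (k, d) \<Rightarrow> f d * g (Suc k div d))"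
      unfolding a prod.case * ..
  next
    fix b :: "nat \<times> nat" assume "b \<in> UNIV \<times> UNIV"
    obtain i j where b: "b = (i, j)" by (cases b)
    have *: "Suc (Suc i * Suc j - 1) = Suc i * Suc j" "Suc i * Suc j div Suc i - 1 = j" "Suc i - 1 = i"
      by (auto simp del: mult_Suc mult_Suc_right)
    show "(case case b of (i, j) \<Rightarrow> (Suc i * Suc j - 1, Suc i) of (k, d) \<Rightarrow> (d - 1, Suc k div d - 1)) = b"
      unfolding b prod.case * ..
    show "(case b of (i, j) \<Rightarrow> (Suc i * Suc j - 1, Suc i)) \<in> (SIGMA k:UNIV. {d. d dvd Suc k})"
      unfolding b prod.case by (auto simp: * simp del: mult_Suc mult_Suc_right)
  qed auto
  then have "((\<lambda>k. \<Sum>d | d dvd Suc k. f d * g (Suc k div d)) has_sum (A * B)) UNIV"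
    by (rule has_sum_SigmaD) (auto intro!: has_sum_finiteI)
  then show ?thesis by (rule has_sum_imp_sums)
qed

lemma abs_mobius_le_1: "\<bar>mobius n\<bar> \<le> 1"
  by (simp add: mobius_def)

lemma mobius_mult_prime:
  assumes "prime p" "\<not> p dvd d"
  shows "mobius (p * d) = - mobius d"
proof -
  have cp: "coprime p d" using assms by (simp add: prime_imp_coprime)
  have d0: "d \<noteq> 0" using assms by (metis dvd_0_right)
  have "squarefree (p * d) \<longleftrightarrow> squarefree d"
    using squarefree_mult_coprime[OF cp squarefree_prime[OF assms(1)]] squarefree_multD(2) by blast
  moreover have "prime_factors (p * d) = insert p (prime_factors d)"
    using assms d0 by (auto simp: prime_factors_product prime_prime_factors)
  moreover have "p \<notin> prime_factors d" using assms by auto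
  ultimately show ?thesis by (simp add: mobius_def)
qed

text
\<open>For a prime \<open>p\<close> dividing \<open>n\<close>, the squarefree divisors \<open>d\<close> prime to \<open>p\<close> and their multiples \<open>p * d\<close> cancel in pairs.\<close>
lemma sum_mobius_divisors:
  assumes "n > 0"
  shows "(\<Sum>d | d dvd n. mobius d) = (if n = 1 then 1 else 0)"
proof (cases "n = 1")
  case True then show ?thesis by (simp add: mobius_def)
next
  case False
  then obtain p where p: "prime p" "p dvd n" using prime_factor_nat by blast
  define A where "A = {d. d dvd n \<and> \<not> p dvd d}"
  have fin: "finite {d. d dvd n}" using assms by simp
  have "(\<Sum>d | d dvd n. mobius d) = (\<Sum>d\<in>A. mobius d) + (\<Sum>d\<in>{d. d dvd n \<and> p dvd d}. mobius d)"
    unfolding A_def using fin by (subst sum.union_disjoint[symmetric]) (auto intro!: sum.cong)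
  also have "(\<Sum>d\<in>{d. d dvd n \<and> p dvd d}. mobius d) = (\<Sum>d\<in>{d. d dvd n \<and> p dvd d \<and> squarefree d}. mobius d)"
    using fin by (intro sum.mono_neutral_right) (auto simp: mobius_def)
  also have "\<dots> = (\<Sum>d\<in>{d\<in>A. squarefree d}. mobius (p * d))"
  proof (rule sum.reindex_bij_witness[of _ "\<lambda>d. p * d" "\<lambda>d. d div p"])
    fix d assume "d \<in> {d. d dvd n \<and> p dvd d \<and> squarefree d}"
    then obtain e where e: "d = p * e" "d dvd n" "squarefree d" by auto
    have p0: "p > 0" using p prime_gt_0_nat by simp
    have "\<not> p dvd e"
    proof
      assume "p dvd e"
      then have "p ^ 2 dvd d" using e by (auto simp: power2_eq_square)
      then show False using e p by (auto simp: squarefree_def)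
    qed
    then show "d div p \<in> {d \<in> A. squarefree d}" "p * (d div p) = d" "mobius (p * (d div p)) = mobius d"
      using e p0 by (auto simp: A_def dest: squarefree_multD dvd_mult_right)
  next
    fix e assume "e \<in> {d \<in> A. squarefree d}"
    then have e: "e dvd n" "\<not> p dvd e" "squarefree e" by (auto simp: A_def)
    have p0: "p > 0" using p prime_gt_0_nat by simp
    have cp: "coprime p e" using e p by (simp add: prime_imp_coprime)
    show "p * e div p = e" using p0 by simp
    show "p * e \<in> {d. d dvd n \<and> p dvd d \<and> squarefree d}"
      using e p cp squarefree_mult_coprime[OF cp squarefree_prime[OF p(1)]] by (auto intro!: divides_mult)
  qed
  also have "\<dots> = (\<Sum>d\<in>{d\<in>A. squarefree d}. - mobius d)"
    using p by (intro sum.cong) (auto simp: mobius_mult_prime A_def)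
  also have "\<dots> = (\<Sum>d\<in>A. - mobius d)"
    using fin by (intro sum.mono_neutral_left) (auto simp: A_def mobius_def)
  finally show ?thesis using False by (simp add: sum_negf)
qed

lemma Dirichlet_convolution_powr:
  fixes s :: complex
  assumes "d dvd Suc k"
  shows "(a * of_nat d powr (- s)) * (b * of_nat (Suc k div d) powr (- s)) = a * b * of_nat (Suc k) powr (- s)"
proof -
  obtain e where e: "Suc k = d * e" using assms by auto
  then have "d > 0" "e > 0" "Suc k div d = e" by (auto intro: Nat.gr0I)
  then have "of_nat (Suc k) powr (- s) = of_nat d powr (- s) * of_nat e powr (- s)"
    unfolding e of_nat_mult by (intro powr_times_real) auto
  then show ?thesis using \<open>Suc k div d = e\<close> by simp
qed

lemma mobius_Dirichlet_summable:
  "Re s > 1 \<Longrightarrow> summable (\<lambda>n. norm (of_real (mobius (Suc n)) * of_nat (Suc n) powr (- s) :: complex))"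
proof (rule Dirichlet_series_absolutely_convergent[where c = "Re s"])
  assume "Re s > 1"
  then show "summable (\<lambda>n. norm (complex_of_real (mobius (Suc n))) * real (Suc n) powr - Re s)"
    by (intro summable_comparison_test'[OF summable_Suc_powr[of "Re s"], of 0])
       (use abs_mobius_le_1 in \<open>auto simp: abs_mult intro!: mult_left_le_one_le\<close>)
qed auto

lemma zeta_Dirichlet_summable:
  "Re s > 1 \<Longrightarrow> summable (\<lambda>n. norm (of_nat (Suc n) powr (- s) :: complex))"
  unfolding powr_minus_of_nat_norm by (rule summable_Suc_powr)

lemma zeta_times_mobius_series:
  assumes "Re s > 1"
  shows "(\<Sum>n. of_real (mobius (Suc n)) * of_nat (Suc n) powr (- s)) * riemann_zeta s = 1"
proof -
  define f where "f = (\<lambda>n. of_real (mobius n) * of_nat n powr (- s) :: complex)"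
  define g where "g = (\<lambda>n. 1 * of_nat n powr (- s) :: complex)"
  have 1: "(\<lambda>k. \<Sum>d | d dvd Suc k. f d * g (Suc k div d)) sums ((\<Sum>n. f (Suc n)) * riemann_zeta s)"
    unfolding f_def g_def using mobius_Dirichlet_summable[OF assms] zeta_Dirichlet_summable[OF assms] riemann_zeta_sums[OF assms]
    by (intro Dirichlet_convolution_sums summable_sums) (auto intro: summable_norm_cancel simp del: of_nat_Suc)
  have 2: "(\<Sum>d | d dvd Suc k. f d * g (Suc k div d)) = (if k = 0 then 1 else 0)" for k
  proof -
    have "(\<Sum>d | d dvd Suc k. f d * g (Suc k div d)) = (\<Sum>d | d dvd Suc k. of_real (mobius d) * of_nat (Suc k) powr (- s))"
      unfolding f_def g_def by (intro sum.cong refl, subst Dirichlet_convolution_powr) auto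
    also have "\<dots> = of_real (\<Sum>d | d dvd Suc k. mobius d) * of_nat (Suc k) powr (- s)"
      by (simp add: sum_distrib_right)
    finally show ?thesis by (subst (asm) sum_mobius_divisors) auto
  qed
  have 3: "(\<lambda>k. if k = 0 then 1 else 0) sums (1::complex)"
    using sums_single[of 0 "\<lambda>_. 1::complex"] by simp
  show ?thesis using sums_unique2[OF 1[unfolded 2] 3] unfolding f_def .
qed

lemma riemann_zeta_nonzero_right: "Re s > 1 \<Longrightarrow> riemann_zeta s \<noteq> 0"
  using zeta_times_mobius_series[of s] by auto

lemma mobius_Dirichlet_sums:
  assumes "Re s > 1"
  shows "(\<lambda>n. of_real (mobius (Suc n)) * of_nat (Suc n) powr (- s)) sums (1 / riemann_zeta s)"
proof -
  have "(\<Sum>n. of_real (mobius (Suc n)) * of_nat (Suc n) powr (- s)) = 1 / riemann_zeta s"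
    using zeta_times_mobius_series[OF assms] riemann_zeta_nonzero_right[OF assms] by (simp add: field_simps)
  then show ?thesis
    using summable_norm_cancel[OF mobius_Dirichlet_summable[OF assms]] by (simp only: sums_iff)
qed

lemma norm_inverse_zeta_le:
  assumes "Re s \<ge> c" "c > 1"
  shows "norm (1 / riemann_zeta s) \<le> (\<Sum>n. real (Suc n) powr (- c))"
proof -
  have s: "Re s > 1" using assms by simp
  have "norm (1 / riemann_zeta s) \<le> (\<Sum>n. norm (of_real (mobius (Suc n)) * of_nat (Suc n) powr (- s) :: complex))"
    unfolding sums_unique[OF mobius_Dirichlet_sums[OF s]]
    by (intro summable_norm mobius_Dirichlet_summable s)
  also have "\<dots> \<le> (\<Sum>n. real (Suc n) powr (- c))"
  proof (intro suminf_le mobius_Dirichlet_summable s summable_Suc_powr assms)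
    fix n
    have "\<bar>mobius (Suc n)\<bar> * real (Suc n) powr (- Re s) \<le> 1 * real (Suc n) powr (- c)"
      using assms by (intro mult_mono abs_mobius_le_1 powr_mono) auto
    then show "norm (of_real (mobius (Suc n)) * of_nat (Suc n) powr (- s) :: complex) \<le> real (Suc n) powr (- c)"
      unfolding norm_mult powr_minus_of_nat_norm by simp
  qed
  finally show ?thesis .
qed

lemma summable_ln_powr:
  assumes "\<sigma> > (1::real)"
  shows "summable (\<lambda>n. ln (real (Suc n)) * real (Suc n) powr (- \<sigma>))"
proof -
  define \<delta> where "\<delta> = (\<sigma> - 1) / 2"
  have d: "\<delta> > 0" using assms by (simp add: \<delta>_def)
  show ?thesis
  proof (rule summable_comparison_test'[of "\<lambda>n. 1 / \<delta> * real (Suc n) powr (- (1 + \<delta>))" 0])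
    show "summable (\<lambda>n. 1 / \<delta> * real (Suc n) powr (- (1 + \<delta>)))"
      using d by (intro summable_mult summable_Suc_powr) auto
    fix n
    have "ln (real (Suc n)) \<le> real (Suc n) powr \<delta> / \<delta>"
      using d by (intro ln_powr_bound) auto
    then have "ln (real (Suc n)) * real (Suc n) powr (- \<sigma>) \<le> real (Suc n) powr \<delta> / \<delta> * real (Suc n) powr (- \<sigma>)"
      by (intro mult_right_mono) auto
    also have "\<dots> = 1 / \<delta> * real (Suc n) powr (\<delta> + - \<sigma>)"
      by (simp only: powr_add) simp
    also have "\<delta> + - \<sigma> = - (1 + \<delta>)" by (simp add: \<delta>_def field_simps)
    finally show "norm (ln (real (Suc n)) * real (Suc n) powr (- \<sigma>)) \<le> 1 / \<delta> * real (Suc n) powr (- (1 + \<delta>))"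
      by (simp add: abs_mult)
  qed
qed

lemma mangoldt_Dirichlet_summable:
  assumes "Re s > 1"
  shows "summable (\<lambda>n. norm (mangoldt (Suc n) * of_nat (Suc n) powr (- s) :: complex))"
proof (rule Dirichlet_series_absolutely_convergent[where c = "Re s"])
  show "summable (\<lambda>n. norm (mangoldt (Suc n) :: complex) * real (Suc n) powr - Re s)"
    by (rule summable_comparison_test'[OF summable_ln_powr[OF assms], of 0])
       (auto simp: mangoldt_nonneg abs_mult simp del: of_nat_Suc intro!: mult_right_mono mangoldt_le)
qed auto

text
\<open>The convolution of the von Mangoldt function with 1 is the logarithm, and multiplying the terms of the zeta series by the logarithm is, up to sign, differentiation.\<close>
lemma mangoldt_Dirichlet:
  assumes "Re s > 1"
  shows "(\<Sum>n. mangoldt (Suc n) * of_nat (Suc n) powr (- s)) = - deriv riemann_zeta s / riemann_zeta s"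
proof -
  define f where "f = (\<lambda>n. mangoldt n * of_nat n powr (- s) :: complex)"
  define g where "g = (\<lambda>n. 1 * of_nat n powr (- s) :: complex)"
  have 1: "(\<lambda>k. \<Sum>d | d dvd Suc k. f d * g (Suc k div d)) sums ((\<Sum>n. f (Suc n)) * riemann_zeta s)"
    unfolding f_def g_def using mangoldt_Dirichlet_summable[OF assms] zeta_Dirichlet_summable[OF assms] riemann_zeta_sums[OF assms]
    by (intro Dirichlet_convolution_sums summable_sums) (auto intro: summable_norm_cancel simp del: of_nat_Suc)
  have 2: "(\<Sum>d | d dvd Suc k. f d * g (Suc k div d)) = of_real (ln (real (Suc k))) * of_nat (Suc k) powr (- s)" for k
  proof -
    have "(\<Sum>d | d dvd Suc k. f d * g (Suc k div d)) = (\<Sum>d | d dvd Suc k. mangoldt d * of_nat (Suc k) powr (- s))"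
      unfolding f_def g_def by (intro sum.cong refl, subst Dirichlet_convolution_powr) auto
    also have "\<dots> = (\<Sum>d | d dvd Suc k. mangoldt d) * of_nat (Suc k) powr (- s)"
      by (simp add: sum_distrib_right)
    finally show ?thesis by (subst (asm) mangoldt_sum) auto
  qed
  obtain F F' where F: "\<And>s. Re s > 1 \<Longrightarrow> (\<lambda>n. 1 * of_nat (Suc n) powr (- s)) sums F s"
    "\<And>s. Re s > 1 \<Longrightarrow> (\<lambda>n. - of_real (ln (real (Suc n))) * 1 * of_nat (Suc n) powr (- s)) sums F' s"
    "\<And>s. Re s > 1 \<Longrightarrow> (F has_field_derivative F' s) (at s)"
    by (rule Dirichlet_series_derivative[of 1 "\<lambda>_. 1"]) (use summable_Suc_powr in simp, blast)
  have "F z = riemann_zeta z" if "Re z > 1" for z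
    using F(1)[OF that] riemann_zeta_sums[OF that] by (simp add: sums_iff)
  then have "(riemann_zeta has_field_derivative F' s) (at s)"
    using assms by (intro has_field_derivative_transform_within_open[OF F(3)[OF assms] open_halfspace_Re_gt[of 1]]) auto
  then have "deriv riemann_zeta s = F' s" by (rule DERIV_imp_deriv)
  moreover have "(\<lambda>n. of_real (ln (real (Suc n))) * of_nat (Suc n) powr (- s)) sums (- F' s)"
    using sums_minus[OF F(2)[OF assms]] by simp
  ultimately have "(\<Sum>n. f (Suc n)) * riemann_zeta s = - deriv riemann_zeta s"
    using 1 unfolding 2 using sums_unique2 by metis
  then show ?thesis using riemann_zeta_nonzero_right[OF assms] by (simp add: f_def field_simps)
qed

lemma three_four_one: "3 + 4 * cos \<theta> + cos (2 * \<theta>) \<ge> (0::real)"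
proof -
  have "3 + 4 * cos \<theta> + cos (2 * \<theta>) = 2 * (1 + cos \<theta>)\<^sup>2"
    unfolding cos_double_cos by (simp add: power2_eq_square algebra_simps)
  then show ?thesis by simp
qed

text
\<open>The trigonometric polynomial \<open>3 + 4 cos \<theta> + cos 2\<theta>\<close> is nonnegative and appears with the nonnegative weights \<open>\<Lambda>(n) n\<^bsup>-\<sigma>\<^esup>\<close>.\<close>
lemma mangoldt_three_four_one:
  fixes \<sigma> t :: real
  assumes "\<sigma> > 1"
  defines "L \<equiv> (\<lambda>s. - deriv riemann_zeta s / riemann_zeta s)"
  shows "Re (3 * L (of_real \<sigma>) + 4 * L (Complex \<sigma> t) + L (Complex \<sigma> (2 * t))) \<ge> 0"
proof -
  have S: "(\<lambda>n. mangoldt (Suc n) * of_nat (Suc n) powr (- s)) sums L s" if "Re s > 1" for s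
    unfolding L_def mangoldt_Dirichlet[OF that, symmetric]
    by (intro summable_sums summable_norm_cancel[OF mangoldt_Dirichlet_summable] that)
  have "(\<lambda>n. 3 * (mangoldt (Suc n) * of_nat (Suc n) powr (- of_real \<sigma>)) + 4 * (mangoldt (Suc n) * of_nat (Suc n) powr (- Complex \<sigma> t))
      + mangoldt (Suc n) * of_nat (Suc n) powr (- Complex \<sigma> (2 * t))) sums (3 * L (of_real \<sigma>) + 4 * L (Complex \<sigma> t) + L (Complex \<sigma> (2 * t)))"
    using assms by (intro sums_add sums_mult S) auto
  then have S1: "(\<lambda>n. Re (3 * (mangoldt (Suc n) * of_nat (Suc n) powr (- of_real \<sigma>)) + 4 * (mangoldt (Suc n) * of_nat (Suc n) powr (- Complex \<sigma> t))
      + mangoldt (Suc n) * of_nat (Suc n) powr (- Complex \<sigma> (2 * t)))) sums Re (3 * L (of_real \<sigma>) + 4 * L (Complex \<sigma> t) + L (Complex \<sigma> (2 * t)))"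
    by (rule sums_Re)
  have S2: "Re (3 * (mangoldt (Suc n) * of_nat (Suc n) powr (- of_real \<sigma>)) + 4 * (mangoldt (Suc n) * of_nat (Suc n) powr (- Complex \<sigma> t))
      + mangoldt (Suc n) * of_nat (Suc n) powr (- Complex \<sigma> (2 * t))) \<ge> 0" for n
  proof -
    define l where "l = ln (real (Suc n))"
    have pw: "of_nat (Suc n) powr (- Complex \<sigma> u) = of_real (exp (- \<sigma> * l)) * cis (- (u * l))" for u
    proof -
      have "Ln (of_nat (Suc n)) = of_real l"
        unfolding l_def by (subst of_real_of_nat_eq[symmetric], subst Ln_of_real) auto
      then have "of_nat (Suc n) powr (- Complex \<sigma> u) = exp (- Complex \<sigma> u * of_real l)"
        by (simp add: powr_def del: of_nat_Suc)
      then show ?thesis by (simp add: exp_eq_polar)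
    qed
    have \<sigma>: "of_real \<sigma> = Complex \<sigma> 0" by (simp add: complex_eq_iff)
    have "Re (3 * (mangoldt (Suc n) * of_nat (Suc n) powr (- of_real \<sigma>)) + 4 * (mangoldt (Suc n) * of_nat (Suc n) powr (- Complex \<sigma> t))
      + mangoldt (Suc n) * of_nat (Suc n) powr (- Complex \<sigma> (2 * t)))
      = mangoldt (Suc n) * exp (- \<sigma> * l) * (3 + 4 * cos (t * l) + cos (2 * (t * l)))"
      unfolding \<sigma> pw by (simp add: algebra_simps)
    then show ?thesis using three_four_one[of "t * l"] by (simp add: mangoldt_nonneg)
  qed
  show ?thesis by (rule sums_le[OF S2 sums_zero S1])
qed

text
\<open>The number \<open>n\<close> is the multiplicity of the zero. It is characterised by a limit because it will be read off along the horizontal approach \<open>\<sigma> \<rightarrow> 1+\<close>.\<close>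
lemma log_deriv_residue:
  fixes f :: "complex \<Rightarrow> complex"
  assumes f: "f holomorphic_on S" "open S" "connected S" "a \<in> S" and "\<not> f constant_on S"
  obtains n :: nat where "((\<lambda>w. (w - a) * (deriv f w / f w)) \<longlongrightarrow> of_nat n) (at a)" "f a = 0 \<Longrightarrow> n \<ge> 1"
proof (cases "f a = 0")
  case False
  have "isCont f a" "isCont (deriv f) a"
    using f holomorphic_deriv[OF f(1,2)] by (meson holomorphic_on_imp_continuous_on continuous_on_eq_continuous_at)+
  then have "((\<lambda>w. (w - a) * (deriv f w / f w)) \<longlongrightarrow> (a - a) * (deriv f a / f a)) (at a)"
    using False by (intro tendsto_intros) (auto simp: isCont_def)
  then show ?thesis using that[of 0] False by simp
next
  case True
  obtain g r n where g: "0 < n" "0 < r" "ball a r \<subseteq> S" "g holomorphic_on ball a r"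
      "\<And>w. w \<in> ball a r \<Longrightarrow> f w = (w - a) ^ n * g w" "\<And>w. w \<in> ball a r \<Longrightarrow> g w \<noteq> 0"
    using holomorphic_factor_zero_nonconstant[OF f True assms(5)] by metis
  have "isCont g a" "isCont (deriv g) a"
    using g holomorphic_deriv[OF g(4)] by (meson holomorphic_on_imp_continuous_on continuous_on_eq_continuous_at centre_in_ball open_ball)+
  then have "((\<lambda>w. of_nat n + (w - a) * (deriv g w / g w)) \<longlongrightarrow> of_nat n + (a - a) * (deriv g a / g a)) (at a)"
    using g(6)[of a] g(2) by (intro tendsto_intros) (auto simp: isCont_def)
  moreover have "eventually (\<lambda>w. w \<in> ball a r - {a}) (at a)"
    using g(2) by (intro eventually_at_in_open) auto
  then have "eventually (\<lambda>w. of_nat n + (w - a) * (deriv g w / g w) = (w - a) * (deriv f w / f w)) (at a)"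
  proof eventually_elim
    case (elim w)
    have "(g has_field_derivative deriv g w) (at w)"
      using g(4) elim by (intro holomorphic_derivI[of _ "ball a r"]) auto
    then have "((\<lambda>w. (w - a) ^ n * g w) has_field_derivative (of_nat n * (w - a) ^ (n - 1) * g w + deriv g w * (w - a) ^ n)) (at w)"
      by (auto intro!: derivative_eq_intros)
    then have "(f has_field_derivative (of_nat n * (w - a) ^ (n - 1) * g w + deriv g w * (w - a) ^ n)) (at w)"
      by (rule has_field_derivative_transform_within_open[where S = "ball a r"]) (use g(5) elim in auto)
    then have d: "deriv f w = of_nat n * (w - a) ^ (n - 1) * g w + deriv g w * (w - a) ^ n"
      by (rule DERIV_imp_deriv)
    have wn: "(w - a) ^ n = (w - a) * (w - a) ^ (n - 1)"
      using g(1) by (cases n) auto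
    have nz: "w - a \<noteq> 0" "(w - a) ^ (n - 1) \<noteq> 0" "g w \<noteq> 0" using elim g(6) by auto
    have alg: "N + u * (x / y) = u * ((N * P * y + x * (u * P)) / (u * P * y))"
      if "u \<noteq> 0" "P \<noteq> 0" "y \<noteq> 0" for N u x y P :: complex
      using that by (simp add: divide_simps) (simp add: algebra_simps)
    show ?case using g(5)[of w] elim alg[OF nz, of "of_nat n" "deriv g w"] unfolding d by (simp add: wn)
  qed
  ultimately have "((\<lambda>w. (w - a) * (deriv f w / f w)) \<longlongrightarrow> of_nat n) (at a)"
    by (simp add: tendsto_cong)
  then show ?thesis using that[of n] g(1) by simp
qed

lemma zeta_log_deriv:
  assumes "Re s > 1"
  shows "- deriv riemann_zeta s / riemann_zeta s = 1 / (s - 1) - deriv regular_zeta s / regular_zeta s"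
proof -
  have s1: "s \<noteq> 1" using assms by auto
  have "(riemann_zeta has_field_derivative deriv riemann_zeta s) (at s)"
    by (rule holomorphic_derivI[of _ "-{1}"]) (use s1 in \<open>auto intro: riemann_zeta_holomorphic\<close>)
  then have "((\<lambda>s. (s - 1) * riemann_zeta s) has_field_derivative (riemann_zeta s + (s - 1) * deriv riemann_zeta s)) (at s)"
    by (auto intro!: derivative_eq_intros)
  then have "(regular_zeta has_field_derivative (riemann_zeta s + (s - 1) * deriv riemann_zeta s)) (at s)"
    by (rule has_field_derivative_transform_within_open[where S = "-{1}"]) (use s1 in \<open>auto simp: regular_zeta_eq\<close>)
  then have d: "deriv regular_zeta s = riemann_zeta s + (s - 1) * deriv riemann_zeta s"
    by (rule DERIV_imp_deriv)
  show ?thesis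
    using s1 riemann_zeta_nonzero_right[OF assms] unfolding d regular_zeta_eq[OF s1] by (simp add: add_divide_distrib)
qed

text \<open>Constancy would give \<open>\<zeta>(10) = 1/9\<close>, less than the first term of the series.\<close>
lemma regular_zeta_nonconstant: "\<not> regular_zeta constant_on UNIV"
proof
  assume "regular_zeta constant_on UNIV"
  then obtain c where c: "\<And>s. regular_zeta s = c" by (auto simp: constant_on_def)
  with regular_zeta_1 have "regular_zeta s = 1" for s by metis
  then have "riemann_zeta s = 1 / (s - 1)" if "s \<noteq> 1" for s using that by (simp add: riemann_zeta_eq)
  then have *: "riemann_zeta 10 = 1 / 9" by auto
  have "(\<lambda>n. complex_of_nat (Suc n) powr (- 10)) sums riemann_zeta 10" by (rule riemann_zeta_sums) auto
  then have "(\<lambda>n. Re (of_nat (Suc n) powr (- 10))) sums Re (riemann_zeta 10)" by (rule sums_Re)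
  moreover have "Re (of_nat (Suc n) powr (- 10)) = real (Suc n) powr (-10)" for n
    using powr_of_real[of "real (Suc n)" "-10"] by (simp del: of_nat_Suc)
  ultimately have s: "(\<lambda>n. real (Suc n) powr (-10)) sums (1 / 9)" using * by (simp del: of_nat_Suc)
  then have "(\<Sum>n<1. real (Suc n) powr (-10)) \<le> 1 / 9"
    by (subst sums_unique[OF s], intro sum_le_suminf) (auto simp: sums_iff)
  then show False by simp
qed

text
\<open>Multiply the 3-4-1 inequality by \<open>\<sigma> - 1\<close> and let \<open>\<sigma> \<rightarrow> 1+\<close>. The pole at 1 contributes 3, a zero of multiplicity \<open>k\<close> at \<open>1 + \<i>t\<close> contributes \<open>- 4k\<close>, and one of multiplicity \<open>m\<close> at \<open>1 + 2\<i>t\<close> contributes \<open>- m\<close>; thus \<open>3 - 4k - m \<ge> 0\<close>, which forces \<open>k = 0\<close>.\<close>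
theorem regular_zeta_nonzero_line_1:
  assumes "t \<noteq> 0"
  shows "regular_zeta (Complex 1 t) \<noteq> 0"
proof
  assume zero: "regular_zeta (Complex 1 t) = 0"
  define L where "L = (\<lambda>s. - deriv riemann_zeta s / riemann_zeta s)"
  define D where "D = (\<lambda>u n. ((\<lambda>w. (w - Complex 1 u) * (deriv regular_zeta w / regular_zeta w)) \<longlongrightarrow> of_nat n) (at (Complex 1 u)))"
  have ex: "\<exists>n. D u n \<and> (regular_zeta (Complex 1 u) = 0 \<longrightarrow> n \<ge> 1)" for u
    unfolding D_def
    by (rule log_deriv_residue[of regular_zeta UNIV "Complex 1 u"]) (use regular_zeta_nonconstant in \<open>auto intro: regular_zeta_holomorphic\<close>)
  have filt: "filterlim (\<lambda>\<sigma>. Complex \<sigma> u) (at (Complex 1 u)) (at_right 1)" for u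
  proof -
    have "((\<lambda>\<sigma>. Complex \<sigma> u) \<longlongrightarrow> Complex 1 u) (at_right 1)"
      unfolding Complex_eq by (intro tendsto_intros)
    moreover have "eventually (\<lambda>\<sigma>. Complex \<sigma> u \<noteq> Complex 1 u) (at_right 1)"
      using eventually_at_right_less[of 1] by eventually_elim auto
    ultimately show ?thesis by (auto simp: filterlim_at)
  qed
  have lim: "((\<lambda>\<sigma>. of_real (\<sigma> - 1) * L (Complex \<sigma> u)) \<longlongrightarrow> (if u = 0 then 1 else 0) - of_nat n) (at_right 1)"
    if "D u n" for u n
  proof -
    have "((\<lambda>\<sigma>. (Complex \<sigma> u - Complex 1 u) * (deriv regular_zeta (Complex \<sigma> u) / regular_zeta (Complex \<sigma> u))) \<longlongrightarrow> of_nat n) (at_right 1)"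
      using filterlim_compose[OF that[unfolded D_def] filt] .
    moreover have "((\<lambda>\<sigma>. (Complex \<sigma> u - Complex 1 u) * (1 / (Complex \<sigma> u - 1))) \<longlongrightarrow> (if u = 0 then 1 else 0)) (at_right 1)"
    proof (cases "u = 0")
      case True
      have "eventually (\<lambda>\<sigma>. 1 = (Complex \<sigma> u - Complex 1 u) * (1 / (Complex \<sigma> u - 1))) (at_right 1)"
        using eventually_at_right_less[of 1]
      proof eventually_elim
        case (elim \<sigma>)
        have "Complex \<sigma> u - Complex 1 u = of_real (\<sigma> - 1)" "Complex \<sigma> u - 1 = of_real (\<sigma> - 1)"
          using True by (simp_all add: complex_eq_iff)
        then show ?case using elim by (simp del: of_real_diff)
      qed
      from tendsto_cong[OF this, of 1] show ?thesis using True by simp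
    next
      case False
      have "((\<lambda>\<sigma>. (Complex \<sigma> u - Complex 1 u) * (1 / (Complex \<sigma> u - 1))) \<longlongrightarrow> (Complex 1 u - Complex 1 u) * (1 / (Complex 1 u - 1))) (at_right 1)"
        unfolding Complex_eq using False by (intro tendsto_intros) (auto simp: complex_eq_iff)
      then show ?thesis using False by simp
    qed
    ultimately have "((\<lambda>\<sigma>. (Complex \<sigma> u - Complex 1 u) * (1 / (Complex \<sigma> u - 1))
        - (Complex \<sigma> u - Complex 1 u) * (deriv regular_zeta (Complex \<sigma> u) / regular_zeta (Complex \<sigma> u))) \<longlongrightarrow> (if u = 0 then 1 else 0) - of_nat n) (at_right 1)"
      by (intro tendsto_diff)
    moreover have "eventually (\<lambda>\<sigma>. (Complex \<sigma> u - Complex 1 u) * (1 / (Complex \<sigma> u - 1))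
        - (Complex \<sigma> u - Complex 1 u) * (deriv regular_zeta (Complex \<sigma> u) / regular_zeta (Complex \<sigma> u)) = of_real (\<sigma> - 1) * L (Complex \<sigma> u)) (at_right 1)"
      using eventually_at_right_less[of 1]
    proof eventually_elim
      case (elim \<sigma>)
      have e: "Complex \<sigma> u - Complex 1 u = of_real (\<sigma> - 1)" by (simp add: complex_eq_iff)
      have "L (Complex \<sigma> u) = 1 / (Complex \<sigma> u - 1) - deriv regular_zeta (Complex \<sigma> u) / regular_zeta (Complex \<sigma> u)"
        unfolding L_def by (rule zeta_log_deriv) (use elim in auto)
      then show ?case unfolding e by (simp only: right_diff_distrib)
    qed
    ultimately show ?thesis using tendsto_cong by fast
  qed
  obtain k where k: "D t k" "k \<ge> 1" using ex[of t] zero by auto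
  obtain m where m: "D (2 * t) m" using ex by blast
  have "D 0 0"
  proof -
    have "isCont regular_zeta 1" "isCont (deriv regular_zeta) 1"
      using regular_zeta_holomorphic[of UNIV] holomorphic_deriv[OF regular_zeta_holomorphic[of UNIV]]
      by (meson holomorphic_on_imp_continuous_on continuous_on_eq_continuous_at open_UNIV UNIV_I)+
    then have "((\<lambda>w. (w - 1) * (deriv regular_zeta w / regular_zeta w)) \<longlongrightarrow> (1 - 1) * (deriv regular_zeta 1 / regular_zeta 1)) (at 1)"
      using regular_zeta_1 by (intro tendsto_intros) (auto simp: isCont_def)
    then show ?thesis unfolding D_def Complex_eq by simp
  qed
  have "((\<lambda>\<sigma>. Re (3 * (of_real (\<sigma> - 1) * L (Complex \<sigma> 0)) + 4 * (of_real (\<sigma> - 1) * L (Complex \<sigma> t)) + of_real (\<sigma> - 1) * L (Complex \<sigma> (2 * t))))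
      \<longlongrightarrow> Re (3 * ((if (0::real) = 0 then 1 else 0) - of_nat 0) + 4 * ((if t = 0 then 1 else 0) - of_nat k) + ((if 2 * t = 0 then 1 else 0) - of_nat m))) (at_right 1)"
    by (intro tendsto_intros lim k m \<open>D 0 0\<close>)
  then have "Re (3 * ((if (0::real) = 0 then 1 else 0) - of_nat 0) + 4 * ((if t = 0 then 1 else 0) - of_nat k) + ((if 2 * t = 0 then 1 else 0) - of_nat m)) \<ge> 0"
  proof (rule tendsto_lowerbound)
    show "\<forall>\<^sub>F \<sigma> in at_right 1. 0 \<le> Re (3 * (of_real (\<sigma> - 1) * L (Complex \<sigma> 0)) + 4 * (of_real (\<sigma> - 1) * L (Complex \<sigma> t)) + of_real (\<sigma> - 1) * L (Complex \<sigma> (2 * t)))"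
      using eventually_at_right_less[of 1]
    proof eventually_elim
      case (elim \<sigma>)
      have c: "Complex \<sigma> 0 = of_real \<sigma>" by (simp add: complex_eq_iff)
      have "3 * (of_real (\<sigma> - 1) * L (Complex \<sigma> 0)) + 4 * (of_real (\<sigma> - 1) * L (Complex \<sigma> t)) + of_real (\<sigma> - 1) * L (Complex \<sigma> (2 * t))
         = of_real (\<sigma> - 1) * (3 * L (of_real \<sigma>) + 4 * L (Complex \<sigma> t) + L (Complex \<sigma> (2 * t)))"
        unfolding c by (simp add: algebra_simps)
      then show ?case
        using mangoldt_three_four_one[of \<sigma> t] elim unfolding L_def by simp
    qed
  qed simp
  then show False using assms k(2) by simp
qed

lemma regular_zeta_nonzero_right:
  assumes "Re s \<ge> 1" shows "regular_zeta s \<noteq> 0"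
proof (cases "Re s = 1")
  case True
  then have "s = Complex 1 (Im s)" by (simp add: complex_eq_iff)
  then show ?thesis using regular_zeta_nonzero_line_1[of "Im s"] regular_zeta_1
    by (cases "Im s = 0") (auto simp: Complex_eq)
next
  case False
  then have "Re s > 1" "s \<noteq> 1" using assms by auto
  then show ?thesis using riemann_zeta_nonzero_right[of s] regular_zeta_eq[of s] by auto
qed

section \<open>A Tauberian theorem of Newman\<close>

text
\<open>Cauchy's formula for a circuit cut at \<open>\<plusminus> \<i>R\<close>, where the left part may be any path that avoids 0. Subtracting \<open>G 0 / w\<close> leaves a function with a removable singularity, and branches of the logarithm on the two half planes show that \<open>1 / w\<close> contributes \<open>\<i> pi\<close> to each part.\<close>
lemma split_circle_integral_formula:
  fixes G :: "complex \<Rightarrow> complex" and R :: real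
  assumes "R > 0" "convex T" "open T" "0 \<in> T" and G: "G holomorphic_on T"
    and g1: "valid_path g1" "pathstart g1 = - \<i> * of_real R" "pathfinish g1 = \<i> * of_real R"
            "path_image g1 \<subseteq> T \<inter> {w. Re w \<ge> 0} - {0}"
    and g2: "valid_path g2" "pathstart g2 = \<i> * of_real R" "pathfinish g2 = - \<i> * of_real R"
            "path_image g2 \<subseteq> T \<inter> {w. Re w \<le> 0} - {0}"
  shows "contour_integral g1 (\<lambda>w. G w / w) + contour_integral g2 (\<lambda>w. G w / w) = 2 * of_real pi * \<i> * G 0"
proof -
  define H where "H = (\<lambda>z. if z = 0 then deriv G 0 else (G z - G 0) / (z - 0))"
  have "H holomorphic_on T" unfolding H_def
    by (rule pole_lemma[OF G]) (use assms in \<open>auto simp: interior_open\<close>)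
  then have "(H has_contour_integral 0) (g1 +++ g2)"
    using assms by (intro Cauchy_theorem_convex_simple[of _ T]) (auto simp: path_image_join valid_path_join)
  then have H0: "H contour_integrable_on g1" "H contour_integrable_on g2"
      "contour_integral g1 H + contour_integral g2 H = 0"
    using contour_integrable_joinD1[of H g1 g2] contour_integrable_joinD2[of H g1 g2] g1(1) g2(1)
    by (metis contour_integrable_on_def contour_integral_unique contour_integral_join)+
  have LnR: "Ln (\<i> * of_real R) = of_real (ln R) + \<i> * of_real pi / 2" "Ln (- (\<i> * of_real R)) = of_real (ln R) - \<i> * of_real pi / 2"
    using Ln_times_of_real[of R \<i>] Ln_times_of_real[of R "-\<i>"] Ln_of_real[OF \<open>R > 0\<close>] \<open>R > 0\<close> by (auto simp: mult_ac)
  have I1: "((\<lambda>w. 1 / w) has_contour_integral (\<i> * of_real pi)) g1"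
  proof -
    have "((\<lambda>w. 1 / w) has_contour_integral (Ln (pathfinish g1) - Ln (pathstart g1))) g1"
    proof (rule contour_integral_primitive[where S = "{w. Re w \<ge> 0} - {0}"])
      fix x :: complex assume "x \<in> {w. Re w \<ge> 0} - {0}"
      then have "x \<notin> \<real>\<^sub>\<le>\<^sub>0" by (auto simp: complex_nonpos_Reals_iff complex_eq_iff)
      then show "(Ln has_field_derivative 1 / x) (at x within {w. Re w \<ge> 0} - {0})"
        by (auto intro!: derivative_eq_intros simp: field_simps)
    qed (use g1 in auto)
    then show ?thesis using LnR by (simp add: g1)
  qed
  have I2: "((\<lambda>w. 1 / w) has_contour_integral (\<i> * of_real pi)) g2"
  proof -
    have "((\<lambda>w. 1 / w) has_contour_integral (Ln (- pathfinish g2) - Ln (- pathstart g2))) g2"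
    proof (rule contour_integral_primitive[where S = "{w. Re w \<le> 0} - {0}"])
      fix x :: complex assume x: "x \<in> {w. Re w \<le> 0} - {0}"
      then have "-x \<notin> \<real>\<^sub>\<le>\<^sub>0" by (auto simp: complex_nonpos_Reals_iff complex_eq_iff)
      then show "((\<lambda>w. Ln (- w)) has_field_derivative 1 / x) (at x within {w. Re w \<le> 0} - {0})"
        using x by (auto intro!: derivative_eq_intros simp: field_simps)
    qed (use g2 in auto)
    then show ?thesis using LnR by (simp add: g2)
  qed
  have *: "contour_integral g (\<lambda>w. G w / w) = contour_integral g H + G 0 * (\<i> * of_real pi)"
    if "H contour_integrable_on g" "((\<lambda>w. 1 / w) has_contour_integral (\<i> * of_real pi)) g" "0 \<notin> path_image g" for g
  proof -
    have "((\<lambda>w. H w + G 0 * (1 / w)) has_contour_integral (contour_integral g H + G 0 * (\<i> * of_real pi))) g"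
      using that by (intro has_contour_integral_add has_contour_integral_lmul has_contour_integral_integral)
    then have "((\<lambda>w. G w / w) has_contour_integral (contour_integral g H + G 0 * (\<i> * of_real pi))) g"
      by (rule has_contour_integral_eq) (use that(3) in \<open>auto simp: H_def field_simps\<close>)
    then show ?thesis by (rule contour_integral_unique)
  qed
  have "0 \<notin> path_image g1" "0 \<notin> path_image g2" using g1 g2 by auto
  then show ?thesis using *[OF H0(1) I1] *[OF H0(2) I2] H0(3) by (simp add: algebra_simps)
qed

text
\<open>Along a segment that leaves the imaginary axis to the left, \<open>exp (L w)\<close> decays exponentially in the parameter, so that the integral is of order \<open>1 / L\<close>.\<close>
lemma exponential_line_bound:
  fixes h :: "complex \<Rightarrow> complex" and b :: complex
  assumes "L > 0" "\<delta> > 0" and b: "Re a = 0" "Re b = - \<delta>"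
    and cont: "continuous_on (closed_segment a b) h" and M: "\<And>w. w \<in> closed_segment a b \<Longrightarrow> norm (h w) \<le> M"
  shows "norm (contour_integral (linepath a b) (\<lambda>w. h w * exp (of_real L * w))) \<le> norm (b - a) * (M / (\<delta> * L))"
proof -
  let ?f = "\<lambda>t. h (linepath a b t) * exp (of_real L * linepath a b t)"
  have M0: "M \<ge> 0" using order_trans[OF norm_ge_zero M[of a]] by simp
  have I: "((\<lambda>t. M * exp (- (\<delta> * L) * t)) has_integral
       (- M / (\<delta> * L) * exp (- (\<delta> * L) * 1) - (- M / (\<delta> * L) * exp (- (\<delta> * L) * 0)))) {0..1}"
    using assms by (intro fundamental_theorem_of_calculus)
      (auto intro!: derivative_eq_intros simp: has_real_derivative_iff_has_vector_derivative[symmetric])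
  have "norm (integral {0..1} ?f) \<le> integral {0..1} (\<lambda>t. M * exp (- (\<delta> * L) * t))"
  proof (rule integral_norm_bound_integral)
    have "linepath a b ` {0..1} = closed_segment a b" by (rule linepath_image_01)
    then have "continuous_on {0..1} (\<lambda>t. h (linepath a b t))"
      by (intro continuous_on_compose2[OF cont]) (auto intro!: continuous_intros)
    then show "?f integrable_on {0..1}"
      by (intro integrable_continuous_interval continuous_intros)
    show "(\<lambda>t. M * exp (- (\<delta> * L) * t)) integrable_on {0..1}" using I by (auto simp: integrable_on_def)
    fix t :: real assume t: "t \<in> {0..1}"
    have "Re (linepath a b t) = - \<delta> * t" using b by (simp add: linepath_def)
    then have "norm (?f t) = norm (h (linepath a b t)) * exp (- (\<delta> * L) * t)"
      by (simp add: norm_mult norm_exp_eq_Re mult_ac)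
    also have "\<dots> \<le> M * exp (- (\<delta> * L) * t)"
      using t by (intro mult_right_mono M) (auto simp: linepath_in_path)
    finally show "norm (?f t) \<le> M * exp (- (\<delta> * L) * t)" .
  qed
  also have "\<dots> = M / (\<delta> * L) * (1 - exp (- (\<delta> * L)))"
    unfolding integral_unique[OF I] by (simp add: algebra_simps)
  also have "\<dots> \<le> M / (\<delta> * L) * 1"
    using M0 assms by (intro mult_left_mono) auto
  finally show ?thesis
    using mult_left_mono[of "norm (integral {0..1} ?f)" "M / (\<delta> * L)" "norm (b - a)"]
    by (simp add: contour_integral_integral norm_mult mult_ac)
qed

text
\<open>By the mean value theorem \<open>(n+1)\<^bsup>-x-1\<^esup>\<close> is at most the \<open>n\<close>-th term of the telescoping series of \<open>n\<^bsup>-x\<^esup> / x\<close>.\<close>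
lemma Dirichlet_tail_bound:
  fixes a :: "nat \<Rightarrow> complex" and N :: nat
  assumes a: "\<And>n. norm (a n) \<le> 1" and "N \<ge> 1" and x: "Re w > 0"
    and F: "(\<lambda>n. a n * of_nat (Suc n) powr (- (1 + w))) sums Fw"
  shows "norm (Fw - (\<Sum>n<N. a n * of_nat (Suc n) powr (- (1 + w)))) \<le> real N powr (- Re w) / Re w"
proof -
  define x where "x = Re w"
  define d where "d = (\<lambda>n. (real n powr (- x) - real (Suc n) powr (- x)) / x)"
  have x0: "x > 0" using x by (simp add: x_def)
  have tel: "(\<lambda>n. d (n + N)) sums (real N powr (- x) / x)"
  proof -
    have "(\<lambda>n. real n powr (- x)) \<longlonglongrightarrow> 0" using x0 by real_asymp
    then have "(\<lambda>n. real (n + N) powr (- x)) \<longlonglongrightarrow> 0" by (rule LIMSEQ_ignore_initial_segment)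
    from telescope_sums'[OF this] have "(\<lambda>n. real (n + N) powr (- x) - real (Suc n + N) powr (- x)) sums (real N powr (- x))"
      by simp
    from sums_divide[OF this, of x] show ?thesis by (simp add: d_def)
  qed
  have bd: "norm (a n * of_nat (Suc n) powr (- (1 + w))) \<le> d n" if "n \<ge> 1" for n
  proof -
    have "\<exists>z>real n. z < real (Suc n) \<and> (real (Suc n) powr (- x)) - (real n powr (- x)) = (real (Suc n) - real n) * (- x * z powr (- x - 1))"
      using that by (intro MVT2) (auto intro!: derivative_eq_intros simp: powr_diff)
    then obtain z where z: "real n < z" "z < real (Suc n)" "real (Suc n) powr (- x) - real n powr (- x) = - x * z powr (- x - 1)"
      by auto
    then have "d n = z powr (- x - 1)" using x0 by (simp add: d_def field_simps)
    moreover have "real (Suc n) powr (- x - 1) \<le> z powr (- x - 1)"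
      using z x0 by (intro powr_mono2') auto
    moreover have "norm (a n * of_nat (Suc n) powr (- (1 + w))) \<le> 1 * real (Suc n) powr (- x - 1)"
      unfolding norm_mult powr_minus_of_nat_norm using a[of n] by (intro mult_mono powr_mono) (auto simp: x_def)
    ultimately show ?thesis by linarith
  qed
  have "(\<lambda>n. a (n + N) * of_nat (Suc (n + N)) powr (- (1 + w))) sums (Fw - (\<Sum>n<N. a n * of_nat (Suc n) powr (- (1 + w))))"
    using sums_split_initial_segment[OF F, of N] by simp
  then have eq: "Fw - (\<Sum>n<N. a n * of_nat (Suc n) powr (- (1 + w))) = (\<Sum>n. a (n + N) * of_nat (Suc (n + N)) powr (- (1 + w)))"
    by (rule sums_unique)
  have "norm (\<Sum>n. a (n + N) * of_nat (Suc (n + N)) powr (- (1 + w))) \<le> (\<Sum>n. d (n + N))"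
    by (rule norm_suminf_le[OF bd]) (use \<open>N \<ge> 1\<close> tel in \<open>auto simp: sums_iff\<close>)
  then show ?thesis unfolding eq using tel by (simp add: sums_iff x_def)
qed

text
\<open>Comparison with the integral of \<open>t\<^bsup>y-1\<^esup>\<close>, which bounds the sum itself when the powers decrease; when they increase, the last term has to be added, and this is the summand \<open>1 / N\<close>.\<close>
lemma sum_powr_le:
  fixes y :: real and N :: nat
  assumes y: "y > 0" and N: "N \<ge> 1"
  shows "(\<Sum>n<N. real (Suc n) powr (y - 1)) \<le> real N powr y * (1 / y + 1 / real N)"
proof (cases "y \<le> 1")
  case True
  have "(\<Sum>n<N. real (Suc n) powr (y - 1)) \<le> real N powr y / y"
    using N
  proof (induction N rule: dec_induct)
    case base then show ?case using True y by simp
  next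
    case (step n)
    have "\<exists>z>real n. z < real (Suc n) \<and> (real (Suc n) powr y) - (real n powr y) = (real (Suc n) - real n) * (y * z powr (y - 1))"
      using step by (intro MVT2) (auto intro!: derivative_eq_intros simp: powr_diff)
    then obtain z where z: "real n < z" "z < real (Suc n)" "real (Suc n) powr y - real n powr y = y * z powr (y - 1)" by auto
    have "real (Suc n) powr (y - 1) \<le> z powr (y - 1)"
      using z True by (intro powr_mono2') auto
    also have "\<dots> = real (Suc n) powr y / y - real n powr y / y" using z y by (simp add: field_simps)
    finally show ?case using step by simp
  qed
  also have "\<dots> \<le> real N powr y * (1 / y + 1 / real N)" by (simp add: distrib_left)
  finally show ?thesis .
next
  case False
  have "(\<Sum>n<N. real (Suc n) powr (y - 1)) \<le> real N powr y / y + real N powr (y - 1)"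
    using N
  proof (induction N rule: dec_induct)
    case base then show ?case using y by simp
  next
    case (step n)
    have "\<exists>z>real n. z < real (Suc n) \<and> (real (Suc n) powr y) - (real n powr y) = (real (Suc n) - real n) * (y * z powr (y - 1))"
      using step by (intro MVT2) (auto intro!: derivative_eq_intros simp: powr_diff)
    then obtain z where z: "real n < z" "z < real (Suc n)" "real (Suc n) powr y - real n powr y = y * z powr (y - 1)" by auto
    have "real n powr (y - 1) \<le> z powr (y - 1)"
      using z False step by (intro powr_mono2) auto
    also have "\<dots> = real (Suc n) powr y / y - real n powr y / y" using z y by (simp add: field_simps)
    finally show ?case using step by simp
  qed
  also have "\<dots> = real N powr y * (1 / y + 1 / real N)" using N by (simp add: distrib_left powr_diff)
  finally show ?thesis .
qed

lemma Dirichlet_partial_sum_bound: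
  fixes a :: "nat \<Rightarrow> complex" and N :: nat
  assumes a: "\<And>n. norm (a n) \<le> 1" and "N \<ge> 1" and x: "Re w < 0"
  shows "norm (\<Sum>n<N. a n * of_nat (Suc n) powr (- (1 + w))) \<le> real N powr (- Re w) * (1 / (- Re w) + 1 / real N)"
proof -
  have "norm (\<Sum>n<N. a n * of_nat (Suc n) powr (- (1 + w))) \<le> (\<Sum>n<N. real (Suc n) powr (- Re w - 1))"
  proof (intro sum_norm_le)
    fix n
    have "norm (a n * of_nat (Suc n) powr (- (1 + w))) \<le> 1 * real (Suc n) powr (- Re w - 1)"
      unfolding norm_mult powr_minus_of_nat_norm using a[of n] by (intro mult_mono powr_mono) auto
    then show "norm (a n * of_nat (Suc n) powr (- (1 + w))) \<le> real (Suc n) powr (- Re w - 1)" by simp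
  qed
  also have "\<dots> \<le> real N powr (- Re w) * (1 / (- Re w) + 1 / real N)"
    by (rule sum_powr_le) (use assms in auto)
  finally show ?thesis .
qed

text
\<open>On the circle \<open>R\<^sup>2 = w * cnj w\<close>, which makes the kernel equal to \<open>(w + cnj w) / R\<^sup>2\<close>. Its zeros at \<open>\<plusminus> \<i>R\<close> compensate for the bounds \<open>1 / Re w\<close> of tails and partial sums.\<close>
lemma circle_kernel_norm:
  assumes "norm w = R" "R > 0"
  shows "norm ((1 + w\<^sup>2 / (of_real R)\<^sup>2) / w) = 2 * \<bar>Re w\<bar> / R\<^sup>2"
proof -
  have R2: "(of_real R)\<^sup>2 = w * cnj w" using assms complex_norm_square[of w] by simp
  have w0: "w \<noteq> 0" using assms by auto
  have "(1 + w\<^sup>2 / (of_real R)\<^sup>2) / w = (w + cnj w) / (of_real R)\<^sup>2"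
    unfolding R2 using w0 by (simp add: field_simps power2_eq_square)
  also have "norm \<dots> = 2 * \<bar>Re w\<bar> / R\<^sup>2"
    unfolding complex_add_cnj by (simp add: norm_divide norm_power)
  finally show ?thesis .
qed

text
\<open>Newman's contour argument. With the kernel \<open>N\<^bsup>w\<^esup> (1 + w\<^sup>2 / R\<^sup>2) / w\<close>, the difference between \<open>F 0\<close> and the partial sum \<open>P N 0\<close> is an integral over three pieces: on the right half circle the tail \<open>F - P N\<close> contributes \<open>O(1 / R)\<close>; on the left half circle the entire function \<open>P N\<close> contributes \<open>O(1 / R + 1 / N)\<close>; and \<open>F\<close> itself is integrated over a path into the left half plane, inside its domain, where \<open>N\<^bsup>w\<^esup>\<close> makes the integral \<open>O(1 / ln N)\<close> for fixed \<open>R\<close>.\<close>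
theorem Newman_Tauberian:
  fixes a :: "nat \<Rightarrow> complex" and F :: "complex \<Rightarrow> complex"
  assumes a: "\<And>n. norm (a n) \<le> 1" and S: "open S" "{w. Re w \<ge> 0} \<subseteq> S" and F: "F holomorphic_on S"
    and sums: "\<And>w. Re w > 0 \<Longrightarrow> (\<lambda>n. a n * of_nat (Suc n) powr (- (1 + w))) sums F w"
  shows "(\<lambda>n. a n / of_nat (Suc n)) sums F 0"
proof -
  define P where "P = (\<lambda>N w. \<Sum>n<N. a n * of_nat (Suc n) powr (- (1 + w)))"
  have bound: "\<exists>C. \<forall>N\<ge>2. norm (F 0 - P N 0) \<le> 2 / R + 1 / real N + C / ln (real N)" if R: "R > 0" for R
  proof -
    \<comment>
    \<open>Compactness of a segment of the imaginary axis gives a strip of uniform width to its left in which \<open>F\<close> is holomorphic.\<close>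
    obtain \<epsilon> where \<epsilon>: "\<epsilon> > 0" "(\<Union>x\<in>cbox (Complex 0 (-(R+1))) (Complex 0 (R+1)). ball x \<epsilon>) \<subseteq> S"
      by (rule compact_subset_open_imp_ball_epsilon_subset[OF compact_cbox S(1), of "Complex 0 (-(R+1))" "Complex 0 (R+1)"])
         (use S(2) in \<open>auto simp: in_cbox_complex_iff\<close>)
    define T where "T = box (Complex (-\<epsilon>) (-(R+1))) (Complex (R+1) (R+1))"
    have TS: "T \<subseteq> S"
    proof
      fix w assume w: "w \<in> T"
      show "w \<in> S"
      proof (cases "Re w \<ge> 0")
        case False
        have "Complex 0 (Im w) \<in> cbox (Complex 0 (-(R+1))) (Complex 0 (R+1))"
          using w by (auto simp: T_def in_box_complex_iff in_cbox_complex_iff)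
        moreover have "w \<in> ball (Complex 0 (Im w)) \<epsilon>"
          using w False by (auto simp: T_def in_box_complex_iff dist_norm cmod_def)
        ultimately show ?thesis using \<epsilon>(2) by blast
      qed (use S(2) in auto)
    qed
    have T: "convex T" "open T" "0 \<in> T"
      using R \<epsilon>(1) by (auto simp: T_def convex_box in_box_complex_iff)
    have holF: "F holomorphic_on T" using F TS by (rule holomorphic_on_subset)
    define \<delta> where "\<delta> = \<epsilon> / 2"
    have \<delta>: "\<delta> > 0" "\<delta> < \<epsilon>" using \<epsilon>(1) by (auto simp: \<delta>_def)
    define A1 where "A1 = part_circlepath 0 R (- pi / 2) (pi / 2)"
    define A2 where "A2 = part_circlepath 0 R (pi / 2) (3 * pi / 2)"
    \<comment>
    \<open>The left part of the contour for \<open>F\<close> consists of two segments that meet at \<open>- \<delta>\<close>; a half circle need not lie in \<open>T\<close>.\<close>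
    define l1 where "l1 = linepath (\<i> * of_real R) (- of_real \<delta>)"
    define l2 where "l2 = linepath (- of_real \<delta>) (- \<i> * of_real R)"
    have ex: "exp (\<i> * complex_of_real (- pi / 2)) = - \<i>" "exp (\<i> * complex_of_real (pi / 2)) = \<i>"
             "exp (\<i> * complex_of_real (3 * pi / 2)) = - \<i>"
    proof -
      have "3 * pi / 2 = 3 / 2 * pi" by simp
      then have "cos (3 * pi / 2) = 0" "sin (3 * pi / 2) = - 1"
        by (simp_all only: cos_3over2_pi sin_3over2_pi)
      then show "exp (\<i> * complex_of_real (- pi / 2)) = - \<i>" "exp (\<i> * complex_of_real (pi / 2)) = \<i>"
             "exp (\<i> * complex_of_real (3 * pi / 2)) = - \<i>"
        by (simp_all add: complex_eq_iff Re_exp Im_exp)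
    qed
    have ends: "pathstart A1 = - \<i> * of_real R" "pathfinish A1 = \<i> * of_real R"
       "pathstart A2 = \<i> * of_real R" "pathfinish A2 = - \<i> * of_real R"
      unfolding A1_def A2_def pathstart_part_circlepath pathfinish_part_circlepath ex by simp_all
    have sph: "norm w = R" "w \<noteq> 0" if "w \<in> path_image A1 \<or> w \<in> path_image A2" for w
      using that R in_path_image_part_circlepath[of w 0 R "-pi/2" "pi/2"] in_path_image_part_circlepath[of w 0 R "pi/2" "3*pi/2"]
      by (auto simp: A1_def A2_def)
    have re1: "Re w \<ge> 0" if w: "w \<in> path_image A1" for w
    proof -
      obtain t where t: "w = of_real R * exp (\<i> * of_real t)" "- pi / 2 \<le> t" "t \<le> pi / 2"
        using w unfolding A1_def by (subst (asm) path_image_part_circlepath) auto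
      then have "Re w = R * cos t" by (simp add: Re_exp)
      then show ?thesis using t R by (simp add: cos_ge_zero)
    qed
    have re2: "Re w \<le> 0" if w: "w \<in> path_image A2" for w
    proof -
      obtain t where t: "w = of_real R * exp (\<i> * of_real t)" "pi / 2 \<le> t" "t \<le> 3 * pi / 2"
        using w unfolding A2_def by (subst (asm) path_image_part_circlepath) auto
      then have "Re w = R * cos t" by (simp add: Re_exp)
      moreover have "cos t \<le> 0" using cos_ge_zero[of "t - pi"] t by simp
      ultimately show ?thesis using R by (simp add: mult_nonneg_nonpos)
    qed
    have inT: "w \<in> T" if "norm w = R" "Re w \<ge> 0" for w
      using that abs_Re_le_cmod[of w] abs_Im_le_cmod[of w] \<epsilon>(1) by (auto simp: T_def in_box_complex_iff)
    have pts: "\<i> * of_real R \<in> T" "- of_real \<delta> \<in> T" "- \<i> * of_real R \<in> T"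
      using R \<delta> by (auto simp: T_def in_box_complex_iff)
    have seg: "closed_segment (\<sigma> * of_real R) (- of_real \<delta>) \<subseteq> T \<inter> {w. Re w \<le> 0} - {0}" if "\<sigma> = \<i> \<or> \<sigma> = - \<i>" for \<sigma>
    proof -
      have "closed_segment (\<sigma> * of_real R) (- of_real \<delta>) \<subseteq> T"
        using that pts by (intro closed_segment_subset T) auto
      moreover have "closed_segment (\<sigma> * of_real R) (- of_real \<delta>) \<subseteq> {w. Re w \<le> 0}"
        using that \<delta> by (intro closed_segment_subset convex_halfspace_Re_le) auto
      moreover have "0 \<notin> closed_segment (\<sigma> * of_real R) (- of_real \<delta>)"
      proof
        assume "0 \<in> closed_segment (\<sigma> * of_real R) (- of_real \<delta>)"
        then obtain u where u: "0 = (1 - u) *\<^sub>R (\<sigma> * of_real R) + u *\<^sub>R (- complex_of_real \<delta>)"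
          by (auto simp: in_segment)
        from arg_cong[OF u, of Re] have "u = 0" using that \<delta> by auto
        with arg_cong[OF u, of Im] show False using that R by auto
      qed
      ultimately show ?thesis by blast
    qed
    have imgl: "path_image (l1 +++ l2) \<subseteq> T \<inter> {w. Re w \<le> 0} - {0}"
      using seg[of \<i>] seg[of "-\<i>"] by (subst path_image_join) (auto simp: l1_def l2_def closed_segment_commute)
    define h where "h = (\<lambda>w. F w * ((1 + w\<^sup>2 / (of_real R)\<^sup>2) / w))"
    have conth: "continuous_on (T - {0}) h"
      unfolding h_def using holomorphic_on_imp_continuous_on[OF holF]
      by (intro continuous_intros) (use R in \<open>auto intro: continuous_on_subset\<close>)
    have "compact (path_image (l1 +++ l2))" by (intro compact_path_image) (auto simp: l1_def l2_def)
    then have "compact (h ` path_image (l1 +++ l2))"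
      using imgl by (intro compact_continuous_image continuous_on_subset[OF conth]) auto
    then obtain M where M: "\<And>w. w \<in> path_image (l1 +++ l2) \<Longrightarrow> norm (h w) \<le> M"
      by (meson compact_imp_bounded bounded_iff imageI)
    define C where "C = (norm (- of_real \<delta> - \<i> * of_real R) * (M / \<delta>) + norm (- of_real \<delta> - (- \<i> * of_real R)) * (M / \<delta>)) / (2 * pi)"
    show ?thesis
    proof (intro exI[of _ C] allI impI)
      fix N :: nat assume N: "N \<ge> 2"
      define L where "L = ln (real N)"
      have L: "L > 0" using N by (simp add: L_def)
      define E :: "complex \<Rightarrow> complex" where "E = (\<lambda>w. exp (of_real L * w) * (1 + w\<^sup>2 / (of_real R)\<^sup>2))"
      have normE: "norm (E w / w) = real N powr (Re w) * (2 * \<bar>Re w\<bar> / R\<^sup>2)" if "norm w = R" for w :: complex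
      proof -
        have "norm (E w / w) = norm (exp (of_real L * w)) * norm ((1 + w\<^sup>2 / (of_real R)\<^sup>2) / w)"
          by (simp add: E_def norm_mult norm_divide)
        then show ?thesis
          unfolding circle_kernel_norm[OF that R] using N by (simp add: norm_exp_eq_Re powr_def L_def mult.commute)
      qed
      have holE: "E holomorphic_on A" for A unfolding E_def using R by (intro holomorphic_intros) auto
      have holP: "P N holomorphic_on A" for A unfolding P_def[abs_def]
        by (intro holomorphic_intros)
      have 1: "contour_integral A1 (\<lambda>w. (F w * E w) / w) + contour_integral (l1 +++ l2) (\<lambda>w. (F w * E w) / w) = 2 * of_real pi * \<i> * (F 0 * E 0)"
        by (rule split_circle_integral_formula[OF R T, where G = "\<lambda>w. F w * E w"])
           (use imgl ends sph re1 inT in \<open>auto intro!: holomorphic_intros holF holE valid_path_join simp: A1_def l1_def l2_def\<close>)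
      have 2: "contour_integral A1 (\<lambda>w. (P N w * E w) / w) + contour_integral A2 (\<lambda>w. (P N w * E w) / w) = 2 * of_real pi * \<i> * (P N 0 * E 0)"
        by (rule split_circle_integral_formula[OF R, where G = "\<lambda>w. P N w * E w" and T = UNIV])
           (use ends sph re1 re2 inT in \<open>auto intro!: holomorphic_intros holP holE simp: A1_def A2_def\<close>)
      have E0: "E 0 = 1" by (simp add: E_def)
      have contF: "continuous_on (T - {0}) (\<lambda>w. (F w * E w) / w)"
        by (intro continuous_intros holomorphic_on_imp_continuous_on holE holomorphic_on_subset[OF holF]) auto
      have contP: "continuous_on (-{0}) (\<lambda>w. (P N w * E w) / w)"
        by (intro continuous_intros holomorphic_on_imp_continuous_on holE holP) auto
      have intF: "(\<lambda>w. (F w * E w) / w) contour_integrable_on A1"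
        unfolding A1_def by (intro contour_integrable_continuous_part_circlepath continuous_on_subset[OF contF])
           (use inT sph re1 in \<open>auto simp: A1_def\<close>)
      have intP: "(\<lambda>w. (P N w * E w) / w) contour_integrable_on A1"
        unfolding A1_def by (intro contour_integrable_continuous_part_circlepath continuous_on_subset[OF contP])
           (use sph in \<open>auto simp: A1_def\<close>)
      have intP2: "(\<lambda>w. (P N w * E w) / w) contour_integrable_on A2"
        unfolding A2_def by (intro contour_integrable_continuous_part_circlepath continuous_on_subset[OF contP])
           (use sph in \<open>auto simp: A2_def\<close>)
      have B1: "norm (contour_integral A1 (\<lambda>w. (F w * E w) / w - (P N w * E w) / w)) \<le> (2 / R\<^sup>2) * R * (pi / 2 - (- pi / 2))"
        unfolding A1_def
      \<comment> \<open>The bounds for \<open>F - P N\<close> fail at the two points of the circle on the imaginary axis.\<close>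
      proof (rule contour_integral_bound_part_circlepath_strong[where k = "{\<i> * of_real R, - \<i> * of_real R}"])
        fix w assume w: "w \<in> path_image (part_circlepath 0 R (- pi / 2) (pi / 2)) - {\<i> * of_real R, - \<i> * of_real R}"
        then have w': "norm w = R" "Re w \<ge> 0" using sph re1 by (auto simp: A1_def)
        have "Re w \<noteq> 0"
        proof
          assume "Re w = 0"
          then have "\<bar>Im w\<bar> = R" using w' by (simp add: cmod_def)
          then have "w = \<i> * of_real R \<or> w = - \<i> * of_real R"
            using \<open>Re w = 0\<close> by (auto simp: complex_eq_iff)
          then show False using w by auto
        qed
        with w' have rw: "Re w > 0" by simp
        have "norm (F w - P N w) \<le> real N powr (- Re w) / Re w"
          unfolding P_def by (rule Dirichlet_tail_bound[OF a _ rw sums[OF rw]]) (use N in auto)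
        then have "norm (F w - P N w) * norm (E w / w) \<le> real N powr (- Re w) / Re w * (real N powr (Re w) * (2 * \<bar>Re w\<bar> / R\<^sup>2))"
          unfolding normE[OF w'(1)] by (intro mult_right_mono) auto
        also have "\<dots> = 2 / R\<^sup>2" using rw N by (simp add: powr_minus field_simps)
        also have "norm (F w - P N w) * norm (E w / w) = norm ((F w * E w) / w - (P N w * E w) / w)"
          unfolding norm_mult[symmetric] by (simp add: left_diff_distrib diff_divide_distrib)
        finally show "norm ((F w * E w) / w - (P N w * E w) / w) \<le> 2 / R\<^sup>2" .
      qed (use R intF intP in \<open>auto simp: A1_def intro!: contour_integrable_diff\<close>)
      have B2: "norm (contour_integral A2 (\<lambda>w. (P N w * E w) / w)) \<le> (2 / R\<^sup>2 + 2 / (real N * R)) * R * (3 * pi / 2 - pi / 2)"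
        unfolding A2_def
      proof (rule contour_integral_bound_part_circlepath_strong[where k = "{\<i> * of_real R, - \<i> * of_real R}"])
        fix w assume w: "w \<in> path_image (part_circlepath 0 R (pi / 2) (3 * pi / 2)) - {\<i> * of_real R, - \<i> * of_real R}"
        then have w': "norm w = R" "Re w \<le> 0" using sph re2 by (auto simp: A2_def)
        have "Re w \<noteq> 0"
        proof
          assume "Re w = 0"
          then have "\<bar>Im w\<bar> = R" using w' by (simp add: cmod_def)
          then have "w = \<i> * of_real R \<or> w = - \<i> * of_real R"
            using \<open>Re w = 0\<close> by (auto simp: complex_eq_iff)
          then show False using w by auto
        qed
        with w' have rw: "Re w < 0" by simp
        have "norm (P N w) \<le> real N powr (- Re w) * (1 / (- Re w) + 1 / real N)"
          unfolding P_def by (rule Dirichlet_partial_sum_bound[OF a _ rw]) (use N in auto)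
        then have "norm (P N w) * norm (E w / w) \<le> real N powr (- Re w) * (1 / (- Re w) + 1 / real N) * (real N powr (Re w) * (2 * \<bar>Re w\<bar> / R\<^sup>2))"
          unfolding normE[OF w'(1)] by (intro mult_right_mono) auto
        also have "\<dots> = (real N powr (- Re w) * real N powr (Re w)) * ((1 / (- Re w) + 1 / real N) * (2 * (- Re w) / R\<^sup>2))"
          using rw by simp
        also have "real N powr (- Re w) * real N powr (Re w) = 1" using N by (simp add: powr_minus)
        also have "1 * ((1 / (- Re w) + 1 / real N) * (2 * (- Re w) / R\<^sup>2)) = 2 / R\<^sup>2 + 2 * (- Re w) / (real N * R\<^sup>2)"
        proof -
          have "(1 / y + 1 / n) * (2 * y / r) = 2 / r + 2 * y / (n * r)" if "y \<noteq> 0" for y n r :: real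
            using that by (simp add: distrib_right add_divide_distrib)
          from this[of "- Re w"] show ?thesis using rw by simp
        qed
        also have "2 * (- Re w) / (real N * R\<^sup>2) \<le> 2 * R / (real N * R\<^sup>2)"
          using abs_Re_le_cmod[of w] w' by (intro divide_right_mono) auto
        also have "2 * R / (real N * R\<^sup>2) = 2 / (real N * R)" using R by (simp add: power2_eq_square)
        finally show "norm ((P N w * E w) / w) \<le> 2 / R\<^sup>2 + 2 / (real N * R)"
          by (simp add: norm_mult norm_divide)
      qed (use R intP2 in \<open>auto simp: A2_def\<close>)
      have hE: "(\<lambda>w. (F w * E w) / w) = (\<lambda>w. h w * exp (of_real L * w))"
        by (auto simp: h_def E_def fun_eq_iff)
      have c1: "continuous_on (closed_segment (\<i> * of_real R) (- of_real \<delta>)) h"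
        "continuous_on (closed_segment (- \<i> * of_real R) (- of_real \<delta>)) h"
        using seg[of \<i>] seg[of "-\<i>"] by (intro continuous_on_subset[OF conth]; auto)+
      have B3: "norm (contour_integral l1 (\<lambda>w. (F w * E w) / w)) \<le> norm (- of_real \<delta> - \<i> * of_real R) * (M / (\<delta> * L))"
        unfolding hE l1_def by (rule exponential_line_bound[OF L \<delta>(1) _ _ c1(1)])
          (use M in \<open>auto simp: l1_def l2_def path_image_join\<close>)
      have B4: "norm (contour_integral (linepath (- \<i> * of_real R) (- of_real \<delta>)) (\<lambda>w. (F w * E w) / w)) \<le> norm (- of_real \<delta> - (- \<i> * of_real R)) * (M / (\<delta> * L))"
        unfolding hE by (rule exponential_line_bound[OF L \<delta>(1) _ _ c1(2)])
          (use M in \<open>auto simp: l1_def l2_def path_image_join closed_segment_commute\<close>)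
      have cs: "continuous_on (closed_segment (- of_real \<delta>) (- \<i> * of_real R)) (\<lambda>w. (F w * E w) / w)"
        "continuous_on (closed_segment (\<i> * of_real R) (- of_real \<delta>)) (\<lambda>w. (F w * E w) / w)"
        using seg[of \<i>] seg[of "-\<i>"] by (intro continuous_on_subset[OF contF]; auto simp: closed_segment_commute)+
      have l2r: "contour_integral l2 (\<lambda>w. (F w * E w) / w) = - contour_integral (linepath (- \<i> * of_real R) (- of_real \<delta>)) (\<lambda>w. (F w * E w) / w)"
        unfolding l2_def by (rule contour_integral_reverse_linepath[OF cs(1)])
      have *: "contour_integral (l1 +++ l2) (\<lambda>w. (F w * E w) / w) = contour_integral l1 (\<lambda>w. (F w * E w) / w) + contour_integral l2 (\<lambda>w. (F w * E w) / w)"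
        using cs by (intro contour_integral_join) (auto simp: l1_def l2_def intro!: contour_integrable_continuous_linepath)
      have B5: "norm (contour_integral (l1 +++ l2) (\<lambda>w. (F w * E w) / w)) \<le> 2 * pi * C / L"
      proof -
        have "2 * pi * C / L = norm (- of_real \<delta> - \<i> * of_real R) * (M / (\<delta> * L)) + norm (- of_real \<delta> - (- \<i> * of_real R)) * (M / (\<delta> * L))"
        proof -
          have "2 * pi * ((x * (M / \<delta>) + y * (M / \<delta>)) / (2 * pi)) / L = x * (M / (\<delta> * L)) + y * (M / (\<delta> * L))" for x y
            by simp (simp add: add_divide_distrib)
          then show ?thesis unfolding C_def .
        qed
        moreover have "norm (contour_integral l2 (\<lambda>w. (F w * E w) / w)) \<le> norm (- of_real \<delta> - (- \<i> * of_real R)) * (M / (\<delta> * L))"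
          using B4 unfolding l2r norm_minus_cancel .
        ultimately show ?thesis
          unfolding * using B3 norm_triangle_ineq[of "contour_integral l1 (\<lambda>w. (F w * E w) / w)" "contour_integral l2 (\<lambda>w. (F w * E w) / w)"]
          by linarith
      qed
      have "2 * of_real pi * \<i> * (F 0 - P N 0) = contour_integral A1 (\<lambda>w. (F w * E w) / w - (P N w * E w) / w)
          + contour_integral (l1 +++ l2) (\<lambda>w. (F w * E w) / w) - contour_integral A2 (\<lambda>w. (P N w * E w) / w)"
        using 1 2 unfolding E0 contour_integral_diff[OF intF intP] by (simp add: algebra_simps)
      then have "norm (2 * of_real pi * \<i> * (F 0 - P N 0)) \<le> (2 / R\<^sup>2) * R * (pi / 2 - (- pi / 2)) + 2 * pi * C / L + (2 / R\<^sup>2 + 2 / (real N * R)) * R * (3 * pi / 2 - pi / 2)"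
        using B1 B2 B5 by (smt (verit) norm_triangle_ineq norm_triangle_ineq4)
      also have "\<dots> = 2 * pi * (2 / R + 1 / real N + C / L)"
        using R N L by (simp add: field_simps power2_eq_square)
      also have "norm (2 * of_real pi * \<i> * (F 0 - P N 0)) = 2 * pi * norm (F 0 - P N 0)"
        by (simp add: norm_mult)
      finally show "norm (F 0 - P N 0) \<le> 2 / R + 1 / real N + C / ln (real N)" by (simp add: L_def)
    qed
  qed
  have "(\<lambda>N. P N 0) \<longlonglongrightarrow> F 0"
  proof (rule LIMSEQ_I)
    fix e :: real assume e: "e > 0"
    \<comment> \<open>Choose \<open>R\<close> first, to make \<open>2 / R\<close> small; then \<open>N\<close> may depend on \<open>R\<close> through \<open>C\<close>.\<close>
    define R where "R = 4 / e"
    have R: "R > 0" "2 / R = e / 2" using e by (auto simp: R_def)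
    obtain C where C: "\<And>N. N \<ge> 2 \<Longrightarrow> norm (F 0 - P N 0) \<le> 2 / R + 1 / real N + C / ln (real N)" using bound[OF R(1)] by blast
    have "(\<lambda>N. 1 / real N + C / ln (real N)) \<longlonglongrightarrow> 0" by real_asymp
    then have "eventually (\<lambda>N. 1 / real N + C / ln (real N) < e / 2) sequentially"
      using e by (intro order_tendstoD) auto
    then obtain N0 where N0: "\<And>N. N \<ge> N0 \<Longrightarrow> 1 / real N + C / ln (real N) < e / 2" by (auto simp: eventually_sequentially)
    have "norm (P N 0 - F 0) < e" if "N \<ge> max 2 N0" for N
    proof -
      have "norm (F 0 - P N 0) < e / 2 + e / 2"
        using C[of N] N0[of N] that unfolding R(2) max.bounded_iff by linarith
      then show ?thesis by (simp add: norm_minus_commute)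
    qed
    then show "\<exists>no. \<forall>n\<ge>no. norm (P n 0 - F 0) < e" by blast
  qed
  moreover have "P N 0 = (\<Sum>n<N. a n / of_nat (Suc n))" for N
    unfolding P_def by (intro sum.cong refl) (simp add: powr_minus_divide del: of_nat_Suc)
  ultimately show ?thesis by (simp add: sums_def)
qed

text
\<open>Newman's theorem for \<open>1 / \<zeta>(1 + w) = w / regular_zeta (1 + w)\<close>, which is holomorphic on a neighbourhood of \<open>Re w \<ge> 0\<close> because zeta has no zeros there, and vanishes at \<open>w = 0\<close> because of the pole.\<close>
corollary sums_mobius_over_n: "(\<lambda>n. mobius (Suc n) / real (Suc n)) sums 0"
proof -
  define S where "S = {w. regular_zeta (1 + w) \<noteq> 0}"
  have hol: "(\<lambda>w. regular_zeta (1 + w)) holomorphic_on UNIV"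
    by (intro holomorphic_on_compose_gen[OF _ regular_zeta_holomorphic[of UNIV], unfolded o_def] holomorphic_intros) auto
  have "open ((\<lambda>w. regular_zeta (1 + w)) -` (- {0}))"
    by (intro open_vimage holomorphic_on_imp_continuous_on[OF hol]) auto
  then have "open S" by (simp add: S_def vimage_def)
  have nz: "regular_zeta (1 + w) \<noteq> 0" if "Re w \<ge> 0" for w
    using that by (intro regular_zeta_nonzero_right) auto
  have "(\<lambda>n. complex_of_real (mobius (Suc n)) / of_nat (Suc n)) sums (0 / regular_zeta (1 + 0))"
  proof (rule Newman_Tauberian[where S = S and F = "\<lambda>w. w / regular_zeta (1 + w)"])
    show "(\<lambda>w. w / regular_zeta (1 + w)) holomorphic_on S"
      using holomorphic_on_subset[OF hol] by (intro holomorphic_intros) (auto simp: S_def)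
    fix w :: complex assume w: "Re w > 0"
    have "(\<lambda>n. of_real (mobius (Suc n)) * of_nat (Suc n) powr (- (1 + w))) sums (1 / riemann_zeta (1 + w))"
      by (rule mobius_Dirichlet_sums) (use w in auto)
    also have "1 / riemann_zeta (1 + w) = w / regular_zeta (1 + w)"
      using w by (auto simp: riemann_zeta_eq)
    finally show "(\<lambda>n. complex_of_real (mobius (Suc n)) * of_nat (Suc n) powr (- (1 + w))) sums (w / regular_zeta (1 + w))" .
  qed (use \<open>open S\<close> nz abs_mobius_le_1 in \<open>auto simp: S_def\<close>)
  then have "(\<lambda>n. Re (complex_of_real (mobius (Suc n)) / of_nat (Suc n))) sums Re (0 / regular_zeta (1 + 0))" by (rule sums_Re)
  moreover have "Re (complex_of_real (mobius (Suc n)) / of_nat (Suc n)) = mobius (Suc n) / real (Suc n)" for n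
    by (metis Re_complex_of_real of_real_divide of_real_of_nat_eq)
  ultimately show ?thesis by (simp only: div_0 zero_complex.sel)
qed

section \<open>Decay of Gamma and growth of zeta in vertical strips\<close>

lemma pochhammer_ratio_mono:
  fixes \<sigma> \<tau> t :: real
  assumes "0 < \<sigma>" "\<sigma> \<le> \<tau>"
  shows "pochhammer \<sigma> n * norm (pochhammer (Complex \<tau> t) n) \<le> norm (pochhammer (Complex \<sigma> t) n) * pochhammer \<tau> n"
proof (induction n)
  case (Suc n)
  define a b where "a = \<sigma> + real n" and "b = \<tau> + real n"
  have ab: "0 < a" "a \<le> b" using assms by (auto simp: a_def b_def)
  have n: "norm (Complex \<tau> t + of_nat n) = sqrt (b\<^sup>2 + t\<^sup>2)" "norm (Complex \<sigma> t + of_nat n) = sqrt (a\<^sup>2 + t\<^sup>2)"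
    by (simp_all add: cmod_def a_def b_def)
  have "a * sqrt (b\<^sup>2 + t\<^sup>2) = sqrt (a\<^sup>2 * (b\<^sup>2 + t\<^sup>2))" using ab by (simp add: real_sqrt_mult)
  also have "\<dots> \<le> sqrt ((a\<^sup>2 + t\<^sup>2) * b\<^sup>2)"
  proof -
    have "a\<^sup>2 \<le> b\<^sup>2" using ab by (intro power_mono) auto
    then have "a\<^sup>2 * t\<^sup>2 \<le> b\<^sup>2 * t\<^sup>2" by (intro mult_right_mono) auto
    then show ?thesis by (simp add: algebra_simps)
  qed
  also have "\<dots> = sqrt (a\<^sup>2 + t\<^sup>2) * b" using ab by (simp add: real_sqrt_mult)
  finally have step: "a * sqrt (b\<^sup>2 + t\<^sup>2) \<le> sqrt (a\<^sup>2 + t\<^sup>2) * b" .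
  have "(pochhammer \<sigma> n * norm (pochhammer (Complex \<tau> t) n)) * (a * sqrt (b\<^sup>2 + t\<^sup>2))
      \<le> (norm (pochhammer (Complex \<sigma> t) n) * pochhammer \<tau> n) * (sqrt (a\<^sup>2 + t\<^sup>2) * b)"
    by (rule mult_mono[OF Suc step]) (use ab assms in \<open>auto intro!: mult_nonneg_nonneg pochhammer_nonneg\<close>)
  then show ?case
    by (simp add: pochhammer_Suc norm_mult n mult_ac flip: a_def b_def)
qed auto

text
\<open>The ratio \<open>norm (\<Gamma>(\<sigma> + \<i>t)) / \<Gamma>(\<sigma>)\<close> increases with \<open>\<sigma>\<close>: in Euler's limit it is a product of the factors \<open>a / sqrt (a\<^sup>2 + t\<^sup>2)\<close> with \<open>a = \<sigma> + j\<close>, each of which increases with \<open>a\<close>. This transports the decay known on a single line to all lines to the left of it, in place of Stirling's formula.\<close>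
lemma Gamma_vertical_decay_mono:
  fixes \<sigma> \<tau> t :: real
  assumes "0 < \<sigma>" "\<sigma> \<le> \<tau>"
  shows "norm (Gamma (Complex \<sigma> t)) * Gamma \<tau> \<le> Gamma \<sigma> * norm (Gamma (Complex \<tau> t))"
proof (rule LIMSEQ_le)
  show "(\<lambda>n. norm (Gamma_series (Complex \<sigma> t) n) * Gamma_series \<tau> n) \<longlonglongrightarrow> norm (Gamma (Complex \<sigma> t)) * Gamma \<tau>"
    by (intro tendsto_intros Gamma_series_LIMSEQ)
  show "(\<lambda>n. Gamma_series \<sigma> n * norm (Gamma_series (Complex \<tau> t) n)) \<longlonglongrightarrow> Gamma \<sigma> * norm (Gamma (Complex \<tau> t))"
    by (intro tendsto_intros Gamma_series_LIMSEQ)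
  have "norm (Gamma_series (Complex \<sigma> t) n) * Gamma_series \<tau> n \<le> Gamma_series \<sigma> n * norm (Gamma_series (Complex \<tau> t) n)" for n
  proof -
    define p q P Q where "p = norm (pochhammer (Complex \<sigma> t) (n+1))" and "q = norm (pochhammer (Complex \<tau> t) (n+1))"
      and "P = pochhammer \<sigma> (n+1)" and "Q = pochhammer \<tau> (n+1)"
    have nz: "pochhammer (Complex r t) (n+1) \<noteq> 0" if "r > 0" for r
    proof
      assume "pochhammer (Complex r t) (n+1) = 0"
      then obtain k where "Complex r t = - of_nat k" by (auto simp: pochhammer_eq_0_iff)
      then have "r = - real k" by (simp add: complex_eq_iff)
      with that show False by simp
    qed
    have pos: "p > 0" "q > 0" "P > 0" "Q > 0"
      using assms nz unfolding p_def q_def P_def Q_def by (auto intro!: pochhammer_pos simp del: One_nat_def)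
    have "P * q \<le> p * Q" unfolding p_def q_def P_def Q_def by (rule pochhammer_ratio_mono[OF assms])
    then have *: "1 / (p * Q) \<le> 1 / (P * q)" using pos by (intro divide_left_mono) auto
    define c where "c = fact n * exp (\<sigma> * ln (real n)) * (fact n * exp (\<tau> * ln (real n)))"
    have "c * (1 / (p * Q)) \<le> c * (1 / (P * q))" using * by (intro mult_left_mono) (auto simp: c_def)
    then show ?thesis
      unfolding Gamma_series_def norm_divide norm_mult norm_exp_eq_Re p_def[symmetric] q_def[symmetric] P_def[symmetric] Q_def[symmetric]
      by (simp add: c_def mult_ac)
  qed
  then show "\<exists>N. \<forall>n\<ge>N. norm (Gamma_series (Complex \<sigma> t) n) * Gamma_series \<tau> n \<le> Gamma_series \<sigma> n * norm (Gamma_series (Complex \<tau> t) n)"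
    by blast
qed

text
\<open>On this line the modulus is explicit: the reflection formula gives \<open>norm (\<Gamma>(1 + \<i>t))\<^sup>2 = pi t / sinh (pi t)\<close>.\<close>
lemma norm_Gamma_line_1:
  assumes t: "\<bar>t\<bar> \<ge> 1"
  shows "norm (Gamma (Complex 1 t)) \<le> 4 * \<bar>t\<bar> * exp (- pi * \<bar>t\<bar> / 2)"
proof -
  have t0: "t \<noteq> 0" using t by auto
  define z where "z = Complex 0 t"
  have nz: "z \<notin> \<int>\<^sub>\<le>\<^sub>0" using t0 by (auto elim!: nonpos_Ints_cases simp: z_def complex_eq_iff)
  have z1: "Complex 1 t = z + 1" "cnj (Complex 1 t) = 1 - z" by (auto simp: z_def complex_eq_iff)
  have g1: "Gamma (Complex 1 t) = z * Gamma z" unfolding z1 using nz by (intro Gamma_plus1)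
  have g2: "cnj (Gamma (Complex 1 t)) = Gamma (1 - z)" unfolding z1(2)[symmetric] by (rule cnj_Gamma)
  have "Gamma (Complex 1 t) * cnj (Gamma (Complex 1 t)) = z * (of_real pi / sin (of_real pi * z))"
    unfolding g2 unfolding g1 mult.assoc Gamma_reflection_complex ..
  then have "of_real ((norm (Gamma (Complex 1 t)))\<^sup>2) = z * (of_real pi / sin (of_real pi * z))"
    by (metis complex_norm_square)
  from arg_cong[OF this, of norm] have sq: "(norm (Gamma (Complex 1 t)))\<^sup>2 = \<bar>t\<bar> * pi / norm (sin (of_real pi * z))"
  proof -
    assume h: "norm (complex_of_real ((norm (Gamma (Complex 1 t)))\<^sup>2)) = norm (z * (of_real pi / sin (of_real pi * z)))"
    have "norm z = \<bar>t\<bar>" by (simp add: z_def cmod_def)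
    then show ?thesis using h by (simp add: norm_mult norm_divide norm_power)
  qed
  have "sin (of_real pi * z) = (of_real (exp (- pi * t)) - of_real (exp (pi * t))) / (2 * \<i>)"
  proof -
    have "\<i> * (of_real pi * z) = of_real (- pi * t)" by (simp add: z_def complex_eq_iff)
    then show ?thesis unfolding sin_exp_eq by (simp add: exp_of_real[symmetric])
  qed
  also have "norm \<dots> = \<bar>exp (- pi * t) - exp (pi * t)\<bar> / 2"
    unfolding norm_divide of_real_diff[symmetric] norm_of_real by (simp add: norm_mult)
  also have "\<bar>exp (- pi * t) - exp (pi * t)\<bar> = exp (pi * \<bar>t\<bar>) - exp (- pi * \<bar>t\<bar>)"
  proof -
    have "\<bar>exp (- x) - exp x\<bar> = exp \<bar>x\<bar> - exp (- \<bar>x\<bar>)" for x :: real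
      by (cases "x \<ge> 0") auto
    from this[of "pi * t"] show ?thesis by (simp add: abs_mult)
  qed
  finally have sn: "norm (sin (of_real pi * z)) = (exp (pi * \<bar>t\<bar>) - exp (- pi * \<bar>t\<bar>)) / 2" .
  have "2 \<le> pi * \<bar>t\<bar>" using mult_mono[of 2 pi 1 "\<bar>t\<bar>"] t pi_gt3 by simp
  then have "exp (pi * \<bar>t\<bar>) \<ge> 2" using exp_ge_add_one_self[of "pi * \<bar>t\<bar>"] by linarith
  moreover have "exp (- pi * \<bar>t\<bar>) \<le> 1" by simp
  moreover have "a / 4 \<le> (a - b) / 2" if "2 \<le> a" "b \<le> 1" for a b :: real using that by (simp add: field_simps)
  ultimately have "norm (sin (of_real pi * z)) \<ge> exp (pi * \<bar>t\<bar>) / 4" unfolding sn by blast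
  then have "(norm (Gamma (Complex 1 t)))\<^sup>2 \<le> \<bar>t\<bar> * pi / (exp (pi * \<bar>t\<bar>) / 4)"
    unfolding sq by (intro divide_left_mono) (auto intro!: mult_pos_pos simp: zero_less_mult_iff intro: less_le_trans[rotated])
  also have "\<dots> = 4 * pi * \<bar>t\<bar> * exp (- pi * \<bar>t\<bar>)" by (simp add: exp_minus field_simps)
  also have "\<dots> \<le> 16 * \<bar>t\<bar>\<^sup>2 * exp (- pi * \<bar>t\<bar>)"
  proof (intro mult_right_mono)
    have "4 * pi * \<bar>t\<bar> \<le> 16 * \<bar>t\<bar>" using pi_less_4 t by (intro mult_right_mono) auto
    also have "\<dots> \<le> 16 * \<bar>t\<bar>\<^sup>2" using self_le_power[of "\<bar>t\<bar>" 2] t by simp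
    finally show "4 * pi * \<bar>t\<bar> \<le> 16 * \<bar>t\<bar>\<^sup>2" .
  qed auto
  also have "\<dots> = (4 * \<bar>t\<bar> * exp (- pi * \<bar>t\<bar> / 2))\<^sup>2"
    by (simp add: power_mult_distrib flip: exp_double)
  finally show ?thesis by (rule power2_le_imp_le) auto
qed

text
\<open>Monotonicity moves the estimate to the line \<open>Re s = 2\<close>, one application of the functional equation away from the explicit line.\<close>
lemma Gamma_strip_bound:
  obtains C where "C > 0" "\<And>\<sigma> t. 1/2 \<le> \<sigma> \<Longrightarrow> \<sigma> \<le> 2 \<Longrightarrow> \<bar>t\<bar> \<ge> 1 \<Longrightarrow> norm (Gamma (Complex \<sigma> t)) \<le> C * t\<^sup>2 * exp (- pi * \<bar>t\<bar> / 2)"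
proof -
  have "continuous_on {1/2..2} (Gamma :: real \<Rightarrow> real)"
    by (intro continuous_on_Gamma) (auto elim!: nonpos_Ints_cases)
  then have "compact (Gamma ` {1/2..2::real})" by (intro compact_continuous_image) auto
  then obtain B where B: "\<And>\<sigma>::real. 1/2 \<le> \<sigma> \<Longrightarrow> \<sigma> \<le> 2 \<Longrightarrow> \<bar>Gamma \<sigma>\<bar> \<le> B"
    by (fastforce dest!: compact_imp_bounded simp: bounded_iff)
  have B0: "B \<ge> 0" using B[of 1] by simp
  have "norm (Gamma (Complex \<sigma> t)) \<le> (8 * B + 1) * t\<^sup>2 * exp (- pi * \<bar>t\<bar> / 2)" if h: "1/2 \<le> \<sigma>" "\<sigma> \<le> 2" "\<bar>t\<bar> \<ge> 1" for \<sigma> t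
  proof -
    have G2: "Gamma (2::real) = 1" by (simp add: Gamma_numeral)
    have "norm (Gamma (Complex \<sigma> t)) * Gamma 2 \<le> Gamma \<sigma> * norm (Gamma (Complex 2 t))"
      by (rule Gamma_vertical_decay_mono) (use h in auto)
    then have 1: "norm (Gamma (Complex \<sigma> t)) \<le> Gamma \<sigma> * norm (Gamma (Complex 2 t))" unfolding G2 by simp
    also have "\<dots> \<le> B * norm (Gamma (Complex 2 t))"
      using B[OF h(1,2)] by (intro mult_right_mono) auto
    also have "Gamma (Complex 2 t) = Complex 1 t * Gamma (Complex 1 t)"
    proof -
      have "Complex 1 t \<notin> \<int>\<^sub>\<le>\<^sub>0" using h by (auto elim!: nonpos_Ints_cases simp: complex_eq_iff)
      moreover have "Complex 2 t = Complex 1 t + 1" by (simp add: complex_eq_iff)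
      ultimately show ?thesis using Gamma_plus1 by metis
    qed
    also have "norm (Complex 1 t * Gamma (Complex 1 t)) \<le> (2 * \<bar>t\<bar>) * (4 * \<bar>t\<bar> * exp (- pi * \<bar>t\<bar> / 2))"
      unfolding norm_mult
    proof (intro mult_mono norm_Gamma_line_1 h)
      have "norm (Complex 1 t) \<le> 1 + \<bar>t\<bar>" using cmod_le[of "Complex 1 t"] by simp
      then show "norm (Complex 1 t) \<le> 2 * \<bar>t\<bar>" using h by simp
    qed auto
    also have "\<dots> = 8 * t\<^sup>2 * exp (- pi * \<bar>t\<bar> / 2)" by (simp add: power2_eq_square flip: abs_mult)
    finally have "norm (Gamma (Complex \<sigma> t)) \<le> B * (8 * t\<^sup>2 * exp (- pi * \<bar>t\<bar> / 2))"
      using B0 by (simp add: mult_left_mono)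
    also have "\<dots> \<le> (8 * B + 1) * t\<^sup>2 * exp (- pi * \<bar>t\<bar> / 2)" by (simp add: algebra_simps)
    finally show ?thesis .
  qed
  then show ?thesis using that[of "8 * B + 1"] B0 by auto
qed

lemma norm_of_real_powr: "x > 0 \<Longrightarrow> norm (complex_of_real x powr s) = x powr Re s"
  by (subst norm_powr_real_powr) auto

text
\<open>The term is the difference between \<open>m\<^bsup>-s\<^esup>\<close> and the integral of \<open>x\<^bsup>-s\<^esup>\<close> over \<open>[m, m + 1]\<close>. Two applications of the mean value inequality, to \<open>x\<^bsup>-s\<^esup>\<close> and to an antiderivative of \<open>m\<^bsup>-s\<^esup> - x\<^bsup>-s\<^esup>\<close>, bound it.\<close>
lemma Euler_Maclaurin_term_bound:
  fixes s :: complex and m :: nat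
  assumes m: "m \<ge> 1" and s: "Re s > 0" "s \<noteq> 1"
  shows "norm (of_nat m powr (- s) - (of_nat (m + 1) powr (1 - s) - of_nat m powr (1 - s)) / (1 - s)) \<le> norm s * real m powr (- (1 + Re s))"
proof -
  define S where "S = closed_segment (complex_of_real (real m)) (of_real (real (m + 1)))"
  define B where "B = norm s * real m powr (- (1 + Re s))"
  have Sx: "\<exists>x. z = of_real x \<and> real m \<le> x \<and> x \<le> real m + 1" if "z \<in> S" for z
    using that unfolding S_def closed_segment_of_real by (auto simp: closed_segment_eq_real_ivl)
  have cv: "convex S" by (simp add: S_def)
  have mS: "of_real (real m) \<in> S" "of_real (real (m + 1)) \<in> S" by (auto simp: S_def)
  have inner: "norm (z powr (- s) - of_real (real m) powr (- s)) \<le> B" if z: "z \<in> S" for z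
  proof -
    have "norm (z powr (- s) - of_real (real m) powr (- s)) \<le> B * norm (z - of_real (real m))"
    proof (rule field_differentiable_bound[OF cv _ _ z mS(1)])
      fix w assume "w \<in> S"
      then obtain x where x: "w = of_real x" "real m \<le> x" using Sx by blast
      then have x0: "x > 0" using m by linarith
      show "((\<lambda>w. w powr (- s)) has_field_derivative (- s) * w powr (- s - 1)) (at w within S)"
        using x0 x by (intro has_field_derivative_powr_of_int has_field_derivative_powr[THEN has_field_derivative_at_within]) (auto simp: complex_nonpos_Reals_iff)
      have "x powr (- (1 + Re s)) \<le> real m powr (- (1 + Re s))" using x s m by (intro powr_mono2') auto
      moreover have "norm (w powr (- s - 1)) = x powr (- (1 + Re s))"
      proof -
        have "Re (- s - 1) = - (1 + Re s)" by simp
        then show ?thesis unfolding x using norm_of_real_powr[OF x0, of "- s - 1"] by metis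
      qed
      ultimately show "norm ((- s) * w powr (- s - 1)) \<le> B"
        by (simp add: B_def norm_mult mult_left_mono)
    qed
    also have "\<dots> \<le> B * 1"
    proof (intro mult_left_mono)
      obtain x where x: "z = of_real x" "real m \<le> x" "x \<le> real m + 1" using Sx z by blast
      have "norm (z - of_real (real m)) = \<bar>x - real m\<bar>" unfolding x of_real_diff[symmetric] norm_of_real ..
      then show "norm (z - of_real (real m)) \<le> 1" using x by simp
    qed (simp add: B_def)
    finally show ?thesis by simp
  qed
  define \<phi> where "\<phi> = (\<lambda>z. of_real (real m) powr (- s) * z - z powr (1 - s) / (1 - s))"
  have "norm (\<phi> (of_real (real (m + 1))) - \<phi> (of_real (real m))) \<le> B * norm (complex_of_real (real (m + 1)) - of_real (real m))"
  proof (rule field_differentiable_bound[OF cv _ _ mS(2,1)])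
    fix w assume w: "w \<in> S"
    then obtain x where x: "w = of_real x" "real m \<le> x" using Sx by blast
    then have x0: "x > 0" using m by linarith
    have wn: "w \<notin> \<real>\<^sub>\<le>\<^sub>0" using x0 x by (auto simp: complex_nonpos_Reals_iff)
    have "((\<lambda>w. w powr (1 - s)) has_field_derivative (1 - s) * w powr (1 - s - 1)) (at w within S)"
      using x0 x by (intro has_field_derivative_powr[THEN has_field_derivative_at_within]) (auto simp: complex_nonpos_Reals_iff)
    then show "(\<phi> has_field_derivative (of_real (real m) powr (- s) - w powr (- s))) (at w within S)"
      unfolding \<phi>_def using s wn by (auto intro!: derivative_eq_intros)
    show "norm (of_real (real m) powr (- s) - w powr (- s)) \<le> B"
      using inner[OF w] by (simp add: norm_minus_commute)
  qed
  also have "\<phi> (of_real (real (m + 1))) - \<phi> (of_real (real m)) =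
      of_nat m powr (- s) - (of_nat (m + 1) powr (1 - s) - of_nat m powr (1 - s)) / (1 - s)"
    by (simp add: \<phi>_def algebra_simps diff_divide_distrib)
  finally show ?thesis by (simp add: B_def)
qed

text
\<open>For \<open>Re s > 1\<close> the subtracted terms telescope to \<open>1 / (s - 1)\<close>; the corrected series converges for \<open>Re s > 0\<close>, so analytic continuation extends the formula.\<close>
lemma zeta_Euler_Maclaurin:
  assumes "Re s > 0" "s \<noteq> 1"
  shows "(\<lambda>n. of_nat (Suc n) powr (- s) - (of_nat (Suc (Suc n)) powr (1 - s) - of_nat (Suc n) powr (1 - s)) / (1 - s))
           sums (riemann_zeta s - 1 / (s - 1))"
proof -
  define f where "f = (\<lambda>n s. of_nat (Suc n) powr (- s) - (of_nat (Suc (Suc n)) powr (1 - s) - of_nat (Suc n) powr (1 - s)) / (1 - s) :: complex)"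
  define D where "D = {s. Re s > 0} - {1::complex}"
  have oD: "open D" by (auto simp: D_def open_halfspace_Re_gt)
  have cD: "connected D" unfolding D_def
    by (intro connected_open_delete) (auto simp: open_halfspace_Re_gt convex_connected convex_halfspace_Re_gt)
  have "\<exists>g g'. \<forall>x\<in>D. (\<lambda>n. f n x) sums g x \<and> (\<lambda>n. deriv (f n) x) sums g' x \<and> (g has_field_derivative g' x) (at x)"
  proof (rule series_and_derivative_comparison_local[OF oD])
    show "(f n has_field_derivative deriv (f n) x) (at x)" if "x \<in> D" for n x
    proof (rule holomorphic_derivI[of _ D])
      show "f n holomorphic_on D" unfolding f_def by (intro holomorphic_intros) (auto simp: D_def)
    qed (use that oD in auto)
    fix s assume "s \<in> D"
    then have s: "Re s > 0" by (simp add: D_def)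
    show "\<exists>d h. 0 < d \<and> summable h \<and> (\<forall>\<^sub>F n in sequentially. \<forall>y\<in>ball s d \<inter> D. norm (f n y) \<le> h n)"
    proof (intro exI conjI always_eventually allI ballI)
      show "0 < Re s / 2" using s by simp
      show "summable (\<lambda>n. (norm s + Re s / 2) * real (Suc n) powr (- (1 + Re s / 2)))"
        using s by (intro summable_mult summable_Suc_powr) auto
      fix n y assume y: "y \<in> ball s (Re s / 2) \<inter> D"
      have "\<bar>Re s - Re y\<bar> \<le> norm (s - y)" using abs_Re_le_cmod[of "s - y"] by simp
      then have ry: "Re y \<ge> Re s / 2" using y unfolding mem_ball dist_norm Int_iff by linarith
      have ny: "norm y \<le> norm s + Re s / 2" using y norm_triangle_ineq2[of y s] by (simp add: dist_norm norm_minus_commute)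
      have "norm (f n y) \<le> norm y * real (Suc n) powr (- (1 + Re y))"
        using Euler_Maclaurin_term_bound[of "Suc n" y] y by (simp add: f_def D_def del: of_nat_Suc)
      also have "\<dots> \<le> (norm s + Re s / 2) * real (Suc n) powr (- (1 + Re s / 2))"
        using ry ny s norm_ge_zero[of s] by (intro mult_mono powr_mono) (auto simp del: norm_ge_zero)
      finally show "norm (f n y) \<le> (norm s + Re s / 2) * real (Suc n) powr (- (1 + Re s / 2))" .
    qed
  qed
  then obtain g g' where g: "\<And>x. x \<in> D \<Longrightarrow> (\<lambda>n. f n x) sums g x" "\<And>x. x \<in> D \<Longrightarrow> (g has_field_derivative g' x) (at x)"
    by blast
  have "g holomorphic_on D" using g(2) oD by (subst holomorphic_on_open) auto
  have eq: "g z = riemann_zeta z - 1 / (z - 1)" if z: "Re z > 1" for z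
  proof -
    have "(\<lambda>n. real (Suc n) powr (1 - Re z)) \<longlonglongrightarrow> 0" using z by real_asymp
    moreover have "norm (of_nat (Suc n) powr (1 - z)) = real (Suc n) powr (1 - Re z)" for n
      using powr_minus_of_nat_norm[of n "z - 1"] by simp
    ultimately have "(\<lambda>n. of_nat (Suc n) powr (1 - z)) \<longlonglongrightarrow> 0"
      by (subst tendsto_norm_zero_iff[symmetric]) simp
    from telescope_sums[OF this] have "(\<lambda>n. of_nat (Suc (Suc n)) powr (1 - z) - of_nat (Suc n) powr (1 - z)) sums (0 - 1)"
      by simp
    from sums_diff[OF riemann_zeta_sums[OF z] sums_divide[OF this, of "1 - z"]]
    have "(\<lambda>n. f n z) sums (riemann_zeta z - (0 - 1) / (1 - z))" by (simp add: f_def)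
    moreover have "(0 - 1) / (1 - z) = 1 / (z - 1)" by (metis diff_0 minus_divide_divide minus_diff_eq minus_divide_left minus_divide_right)
    moreover have "z \<in> D" using z by (auto simp: D_def)
    ultimately show ?thesis using g(1) sums_unique2 by metis
  qed
  have "g s = riemann_zeta s - 1 / (s - 1)"
  proof (rule analytic_continuation_open[where s = "{s. Re s > 1}" and s' = D and f = g and g = "\<lambda>s. riemann_zeta s - 1 / (s - 1)"])
    show "{s::complex. Re s > 1} \<noteq> {}" by (auto intro: exI[of _ "2::complex"])
    show "(\<lambda>s. riemann_zeta s - 1 / (s - 1)) holomorphic_on D"
      by (intro holomorphic_intros) (auto simp: D_def)
  qed (use oD cD eq assms \<open>g holomorphic_on D\<close> in \<open>auto simp: D_def open_halfspace_Re_gt\<close>)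
  then show ?thesis using g(1)[of s] assms by (auto simp: f_def D_def)
qed

text
\<open>The abscissa \<open>1/10\<close> is the left end of the discs of radius \<open>19/10\<close> about \<open>2 + \<i>N\<close> used below.\<close>
lemma zeta_growth:
  obtains K where "K > 0" "\<And>s. Re s \<ge> 1/10 \<Longrightarrow> \<bar>Im s\<bar> \<ge> 1 \<Longrightarrow> norm (riemann_zeta s) \<le> K * norm s"
proof -
  define K where "K = (\<Sum>n. real (Suc n) powr (- (1 + 1/10)))"
  have sm: "summable (\<lambda>n. real (Suc n) powr (- (1 + 1/10)))" by (rule summable_Suc_powr) simp
  have K0: "K \<ge> 0" unfolding K_def by (intro suminf_nonneg sm) auto
  have "norm (riemann_zeta s) \<le> (K + 1) * norm s" if s: "Re s \<ge> 1/10" "\<bar>Im s\<bar> \<ge> 1" for s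
  proof -
    have s': "Re s > 0" "s \<noteq> 1" using s by auto
    have "norm (riemann_zeta s - 1 / (s - 1)) \<le> (\<Sum>n. norm s * real (Suc n) powr (- (1 + 1/10)))"
      unfolding sums_unique[OF zeta_Euler_Maclaurin[OF s']]
    proof (rule norm_suminf_le)
      fix n
      have "norm (of_nat (Suc n) powr (- s) - (of_nat (Suc (Suc n)) powr (1 - s) - of_nat (Suc n) powr (1 - s)) / (1 - s)) \<le> norm s * real (Suc n) powr (- (1 + Re s))"
        using Euler_Maclaurin_term_bound[OF _ s', of "Suc n"] by (simp del: of_nat_Suc)
      also have "\<dots> \<le> norm s * real (Suc n) powr (- (1 + 1/10))"
        using s by (intro mult_left_mono powr_mono) auto
      finally show "norm (of_nat (Suc n) powr (- s) - (of_nat (Suc (Suc n)) powr (1 - s) - of_nat (Suc n) powr (1 - s)) / (1 - s)) \<le> norm s * real (Suc n) powr (- (1 + 1/10))" .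
    qed (intro summable_mult sm)
    also have "\<dots> = norm s * K" unfolding K_def by (rule suminf_mult[OF sm])
    finally have 1: "norm (riemann_zeta s - 1 / (s - 1)) \<le> norm s * K" .
    have i: "norm (s - 1) \<ge> 1" "norm s \<ge> 1"
      using abs_Im_le_cmod[of "s - 1"] abs_Im_le_cmod[of s] s by auto
    then have "norm (1 / (s - 1)) \<le> norm s" using frac_le[of 1 1 1 "norm (s - 1)"] by (simp add: norm_divide)
    then show ?thesis using 1 norm_triangle_ineq[of "riemann_zeta s - 1 / (s - 1)" "1 / (s - 1)"] by (simp add: algebra_simps)
  qed
  then show ?thesis using that[of "K + 1"] K0 by auto
qed

section \<open>Lower bounds for zeta on horizontal lines\<close>

text
\<open>Borel--Caratheodory for \<open>k = log (G / G 0)\<close>, whose real part stays below \<open>L = ln (M / norm (G 0))\<close>: the Schwarz lemma for \<open>k / (2L - k)\<close> bounds \<open>norm k\<close>, and \<open>norm (G z) = norm (G 0) * exp (Re (k z))\<close>.\<close>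
lemma Borel_Caratheodory_lower_bound:
  fixes G :: "complex \<Rightarrow> complex"
  assumes hol: "G holomorphic_on ball 0 1" and nz: "\<And>z. z \<in> ball 0 1 \<Longrightarrow> G z \<noteq> 0"
    and M: "\<And>z. z \<in> ball 0 1 \<Longrightarrow> norm (G z) < M" and z: "norm z \<le> \<rho>" "\<rho> < 1"
  shows "norm (G z) \<ge> norm (G 0) * exp (- (2 * \<rho> / (1 - \<rho>)) * ln (M / norm (G 0)))"
proof -
  obtain h where h: "h holomorphic_on ball 0 1" "\<And>z. z \<in> ball 0 1 \<Longrightarrow> G z = exp (h z)"
    using contractible_imp_holomorphic_log[OF hol convex_imp_contractible[OF convex_ball]] nz by metis
  define L where "L = ln (M / norm (G 0))"
  define k where "k = (\<lambda>z. h z - h 0)"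
  define \<phi> where "\<phi> = (\<lambda>z. k z / (of_real (2 * L) - k z))"
  have G0: "norm (G 0) > 0" "norm (G 0) < M" using nz[of 0] M[of 0] by auto
  then have "1 < M / norm (G 0)" by (simp only: less_divide_eq_1_pos)
  then have L: "L > 0" unfolding L_def by (rule ln_gt_zero)
  have Rek: "Re (k z) < L" if "z \<in> ball 0 1" for z
  proof -
    have "exp (Re (k z)) = norm (G z) / norm (G 0)"
      using h(2)[OF that] h(2)[of 0] by (simp add: k_def norm_exp_eq_Re exp_diff)
    also have "\<dots> < M / norm (G 0)" using M[OF that] G0 by (intro divide_strict_right_mono) auto
    also have "\<dots> = exp L" unfolding L_def using \<open>1 < M / norm (G 0)\<close> by (intro exp_ln[symmetric]) linarith
    finally show ?thesis by simp
  qed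
  have den: "of_real (2 * L) - k z \<noteq> 0" if "z \<in> ball 0 1" for z
  proof
    assume "of_real (2 * L) - k z = 0"
    then have "Re (k z) = 2 * L" by (simp add: complex_eq_iff)
    then show False using Rek[OF that] L by simp
  qed
  have hol\<phi>: "\<phi> holomorphic_on ball 0 1"
    unfolding \<phi>_def k_def by (intro holomorphic_intros h(1)) (use den in \<open>auto simp: k_def\<close>)
  have lt1: "norm (\<phi> z) < 1" if "norm z < 1" for z
  proof -
    have zb: "z \<in> ball 0 1" using that by simp
    have "(norm (k z))\<^sup>2 < (norm (of_real (2 * L) - k z))\<^sup>2"
    proof -
      have "(norm (of_real (2 * L) - k z))\<^sup>2 - (norm (k z))\<^sup>2 = 4 * L * (L - Re (k z))"
        unfolding cmod_power2 by (simp add: power2_eq_square algebra_simps)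
      moreover have "4 * L * (L - Re (k z)) > 0" using L Rek[OF zb] by simp
      ultimately show ?thesis by linarith
    qed
    then have "norm (k z) < norm (of_real (2 * L) - k z)" by (rule power2_less_imp_less) simp
    then show ?thesis using den[OF zb] by (simp add: \<phi>_def norm_divide)
  qed
  have zlt: "norm z < 1" using z by simp
  have "norm (\<phi> z) \<le> norm z"
    by (rule Schwarz_Lemma(1)[OF hol\<phi> _ lt1 zlt]) (simp_all add: \<phi>_def k_def)
  then have p\<rho>: "norm (\<phi> z) \<le> \<rho>" using z by simp
  have zb: "z \<in> ball 0 1" using zlt by simp
  have p1: "1 + \<phi> z \<noteq> 0" using lt1[OF zlt] by (metis add_eq_0_iff norm_minus_cancel norm_one less_irrefl)
  have "k z * (1 + \<phi> z) = of_real (2 * L) * \<phi> z"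
    using den[OF zb] by (simp add: \<phi>_def field_simps)
  then have "norm (k z) * norm (1 + \<phi> z) = 2 * L * norm (\<phi> z)"
    using L by (metis norm_mult norm_of_real abs_of_pos mult_pos_pos zero_less_numeral)
  also have "\<dots> \<le> 2 * L * \<rho>" using p\<rho> L by simp
  finally have "norm (k z) * norm (1 + \<phi> z) \<le> 2 * L * \<rho>" .
  moreover have "norm (1 + \<phi> z) \<ge> 1 - \<rho>"
    using norm_triangle_ineq2[of 1 "- \<phi> z"] p\<rho> by simp
  then have "norm (k z) * (1 - \<rho>) \<le> norm (k z) * norm (1 + \<phi> z)" by (intro mult_left_mono) auto
  ultimately have "norm (k z) * (1 - \<rho>) \<le> 2 * L * \<rho>" by linarith
  then have "norm (k z) \<le> 2 * \<rho> / (1 - \<rho>) * L" using z by (simp add: field_simps)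
  then have "Re (k z) \<ge> - (2 * \<rho> / (1 - \<rho>)) * L" using abs_Re_le_cmod[of "k z"] by simp
  then have "exp (- (2 * \<rho> / (1 - \<rho>)) * L) \<le> exp (Re (k z))" by simp
  also have "\<dots> = norm (G z) / norm (G 0)"
    using h(2)[OF zb] h(2)[of 0] by (simp add: k_def norm_exp_eq_Re exp_diff)
  finally show ?thesis using G0 by (simp add: L_def field_simps)
qed

lemma divide_simple_zeros:
  fixes f :: "complex \<Rightarrow> complex"
  assumes "finite Z" "open S" "Z \<subseteq> S" "f holomorphic_on S" "\<And>a. a \<in> Z \<Longrightarrow> f a = 0" "\<And>a. a \<in> Z \<Longrightarrow> deriv f a \<noteq> 0"
  shows "\<exists>g. g holomorphic_on S \<and> (\<forall>z\<in>S. f z = g z * (\<Prod>a\<in>Z. z - a)) \<and> (\<forall>a\<in>Z. g a \<noteq> 0)"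
  using assms
proof (induction Z arbitrary: f rule: finite_induct)
  case empty then show ?case by auto
next
  case (insert a Z)
  have aS: "a \<in> S" using insert by auto
  define h where "h = (\<lambda>z. if z = a then deriv f a else (f z - f a) / (z - a))"
  have h: "h holomorphic_on S" unfolding h_def
    by (rule pole_lemma) (use insert aS in \<open>auto simp: interior_open\<close>)
  have fh: "f z = (z - a) * h z" for z using insert.prems by (simp add: h_def)
  then have fh': "f = (\<lambda>z. (z - a) * h z)" by (intro ext)
  have ha: "h a \<noteq> 0" using insert by (simp add: h_def)
  have hb: "h b = 0" if "b \<in> Z" for b using that insert fh[of b] by auto
  have "deriv h b \<noteq> 0" if b: "b \<in> Z" for b
  proof
    assume z: "deriv h b = 0"
    have "(h has_field_derivative deriv h b) (at b)"
      using h insert b by (intro holomorphic_derivI[of _ S]) auto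
    then have "((\<lambda>z. (z - a) * h z) has_field_derivative (h b + (b - a) * deriv h b)) (at b)"
      by (auto intro!: derivative_eq_intros)
    then have "(f has_field_derivative 0) (at b)" using hb[OF b] z unfolding fh' by simp
    then have "deriv f b = 0" by (rule DERIV_imp_deriv)
    with insert b show False by auto
  qed
  then obtain g where g: "g holomorphic_on S" "\<And>z. z \<in> S \<Longrightarrow> h z = g z * (\<Prod>a\<in>Z. z - a)" "\<And>a. a \<in> Z \<Longrightarrow> g a \<noteq> 0"
    using insert.IH[OF insert.prems(1) _ h hb] insert.prems by auto
  have "g a \<noteq> 0" using g(2)[OF aS] ha by auto
  then show ?case using g fh insert by (intro exI[of _ g]) (auto simp: mult_ac)
qed

lemma norm_unit_circle_Blaschke:
  fixes z a :: complex
  assumes "norm z = 1"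
  shows "norm (z - a) = norm (1 - cnj a * z)"
proof -
  have "z * cnj z = 1" using complex_norm_square[of z] assms by simp
  then have "1 - cnj a * z = z * cnj (z - a)" by (simp add: algebra_simps)
  then have "norm (1 - cnj a * z) = norm z * norm (cnj (z - a))" by (simp only: norm_mult)
  then show ?thesis using assms by (metis complex_mod_cnj mult_1)
qed

text
\<open>Divide out the zeros \<open>Z\<close> in the smaller disc by Blaschke factors of the unit disc. The quotient \<open>G\<close> keeps the bound \<open>B\<close>, since the factors have modulus 1 on the unit circle. Comparing \<open>f 0\<close> with \<open>G 0\<close> gives Jensen's bound for the number of zeros; on the smaller disc \<open>G\<close> has no zeros, so the Borel--Caratheodory bound applies to it, and the factors \<open>norm (z - a) / 2\<close> restore \<open>f\<close>.\<close>
proposition minimum_modulus_simple_zeros: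
  fixes f :: "complex \<Rightarrow> complex"
  assumes S: "open S" "cball 0 1 \<subseteq> S" and hol: "f holomorphic_on S" and B: "\<And>z. z \<in> cball 0 1 \<Longrightarrow> norm (f z) \<le> B" "B < M"
    and f0: "f 0 \<noteq> 0" and r: "0 < r" "r < 1" and \<rho>: "0 < \<rho>" "\<rho> < 1"
    and Z: "Z = {z \<in> ball 0 r. f z = 0}" "finite Z" and simple: "\<And>a. a \<in> Z \<Longrightarrow> deriv f a \<noteq> 0"
  defines "L \<equiv> ln (M / norm (f 0))"
  shows "real (card Z) * ln (1 / r) \<le> L"
    and "norm z \<le> \<rho> * r \<Longrightarrow> norm (f z) \<ge> norm (f 0) * exp (- (2 * \<rho> / (1 - \<rho>)) * L) * (\<Prod>a\<in>Z. norm (z - a) / 2)"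
proof -
  have ZS: "Z \<subseteq> S" using Z S r by auto
  obtain g where g: "g holomorphic_on S" "\<And>z. z \<in> S \<Longrightarrow> f z = g z * (\<Prod>a\<in>Z. z - a)" "\<And>a. a \<in> Z \<Longrightarrow> g a \<noteq> 0"
    using divide_simple_zeros[OF Z(2) S(1) ZS hol _ simple] Z by blast
  define G where "G = (\<lambda>z. g z * (\<Prod>a\<in>Z. 1 - cnj a * z))"
  have G: "G holomorphic_on S" unfolding G_def by (intro holomorphic_intros g)
  have Zr: "norm a < r" if "a \<in> Z" for a using that Z by auto
  have fact: "norm (cnj a * z) < 1" if "a \<in> Z" "norm z \<le> 1" for a z
  proof -
    have "norm (cnj a * z) \<le> norm a * 1" unfolding norm_mult using that by (intro mult_mono) auto
    then show ?thesis using Zr[OF that(1)] r by simp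
  qed
  have fnz: "1 - cnj a * z \<noteq> 0" "norm (1 - cnj a * z) \<le> 2" if "a \<in> Z" "norm z \<le> 1" for a z
    using fact[OF that] norm_triangle_ineq4[of 1 "cnj a * z"] by auto
  have GB: "norm (G z) \<le> B" if "z \<in> cball 0 1" for z
  proof (rule maximum_modulus_frontier[of G "cball 0 1"])
    show "G holomorphic_on interior (cball 0 1)" "continuous_on (closure (cball 0 1)) G"
      using holomorphic_on_subset[OF G order_trans[OF ball_subset_cball S(2)]] holomorphic_on_subset[OF G S(2)]
      by (auto intro: holomorphic_on_imp_continuous_on)
    fix w :: complex assume "w \<in> frontier (cball 0 1)"
    then have w: "norm w = 1" by simp
    have "norm (G w) = norm (g w) * (\<Prod>a\<in>Z. norm (1 - cnj a * w))" by (simp add: G_def norm_mult prod_norm)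
    also have "\<dots> = norm (g w) * (\<Prod>a\<in>Z. norm (w - a))" by (simp add: norm_unit_circle_Blaschke[OF w])
    also have "\<dots> = norm (f w)" using g(2)[of w] w S by (simp add: norm_mult prod_norm subset_eq)
    finally show "norm (G w) \<le> B" using B(1)[of w] w by simp
  qed (use that in auto)
  have f0g: "norm (f 0) = norm (G 0) * (\<Prod>a\<in>Z. norm a)"
    using g(2)[of 0] S by (simp add: G_def norm_mult prod_norm[symmetric] subset_eq)
  have le1: "(\<Prod>a\<in>Z. norm a) \<le> r ^ card Z"
  proof -
    have "(\<Prod>a\<in>Z. norm a) \<le> (\<Prod>a\<in>Z. r)" using Zr by (intro prod_mono) (auto intro: less_imp_le)
    then show ?thesis by simp
  qed
  have "(\<Prod>a\<in>Z. norm a) \<le> 1" using le1 power_le_one[of r "card Z"] r by linarith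
  then have fG: "norm (f 0) \<le> norm (G 0)" unfolding f0g by (simp add: mult_left_le)
  have f0pos: "norm (f 0) > 0" using f0 by simp
  have GM: "norm (G 0) < M" using GB[of 0] B(2) by simp
  show "real (card Z) * ln (1 / r) \<le> L"
  proof -
    have "norm (f 0) \<le> norm (G 0) * r ^ card Z" unfolding f0g using le1 by (intro mult_left_mono) auto
    also have "\<dots> \<le> M * r ^ card Z" using GM r by (intro mult_right_mono) auto
    finally have "(1 / r) ^ card Z \<le> M / norm (f 0)" using f0pos r by (simp add: power_divide field_simps)
    then have "ln ((1 / r) ^ card Z) \<le> L" unfolding L_def by (rule ln_mono) (use r in simp)
    moreover have "ln ((1 / r) ^ card Z) = real (card Z) * ln (1 / r)" by (rule ln_realpow)
    ultimately show ?thesis by (simp only:)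
  qed
  assume z: "norm z \<le> \<rho> * r"
  have zr: "norm z < r" using z mult_strict_right_mono[OF \<rho>(2) r(1)] by simp
  have Gnz: "G w \<noteq> 0" if "w \<in> ball 0 r" for w
  proof -
    have ws: "w \<in> S" "norm w \<le> 1" using that r S by auto
    have "g w \<noteq> 0"
    proof (cases "w \<in> Z")
      case False
      then have "f w \<noteq> 0" using that Z by auto
      then show ?thesis using g(2)[OF ws(1)] by auto
    qed (use g in auto)
    then show ?thesis using fnz(1)[OF _ ws(2)] Z(2) by (auto simp: G_def)
  qed
  define H where "H = (\<lambda>w. G (of_real r * w))"
  have rw: "of_real r * w \<in> ball 0 r" if "w \<in> ball 0 1" for w :: complex
    using that r by (simp add: norm_mult)
  have brS: "ball 0 r \<subseteq> S" using S r by auto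
  have "norm (H (z / of_real r)) \<ge> norm (H 0) * exp (- (2 * \<rho> / (1 - \<rho>)) * ln (M / norm (H 0)))"
  proof (rule Borel_Caratheodory_lower_bound)
    show "H holomorphic_on ball 0 1" unfolding H_def
      by (rule holomorphic_on_compose_gen[OF _ holomorphic_on_subset[OF G brS], unfolded o_def])
         (use rw in \<open>auto intro!: holomorphic_intros\<close>)
    show "H w \<noteq> 0" if "w \<in> ball 0 1" for w using Gnz[OF rw[OF that]] by (simp add: H_def)
    show "norm (H w) < M" if "w \<in> ball 0 1" for w
      using GB[of "of_real r * w"] rw[OF that] B(2) r by (auto simp: H_def)
    show "norm (z / of_real r) \<le> \<rho>" using z r by (simp add: norm_divide field_simps)
  qed (use \<rho> in auto)
  then have 1: "norm (G z) \<ge> norm (G 0) * exp (- (2 * \<rho> / (1 - \<rho>)) * ln (M / norm (G 0)))" using r by (simp add: H_def)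
  have "ln (M / norm (G 0)) \<le> L"
  proof -
    have "M > 0" "norm (G 0) > 0" using f0pos fG GM by linarith+
    then show ?thesis unfolding L_def using f0pos fG by (intro ln_mono divide_left_mono divide_pos_pos mult_pos_pos) auto
  qed
  then have "- (2 * \<rho> / (1 - \<rho>)) * L \<le> - (2 * \<rho> / (1 - \<rho>)) * ln (M / norm (G 0))"
    using \<rho> by (intro mult_left_mono_neg) auto
  then have "norm (f 0) * exp (- (2 * \<rho> / (1 - \<rho>)) * L) \<le> norm (G 0) * exp (- (2 * \<rho> / (1 - \<rho>)) * ln (M / norm (G 0)))"
    using fG by (intro mult_mono) auto
  with 1 have lower: "norm (f 0) * exp (- (2 * \<rho> / (1 - \<rho>)) * L) \<le> norm (G z)" by linarith
  have z1: "norm z \<le> 1" using zr r by simp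
  have "norm (f 0) * exp (- (2 * \<rho> / (1 - \<rho>)) * L) * (\<Prod>a\<in>Z. norm (z - a) / 2) \<le> norm (G z) * (\<Prod>a\<in>Z. norm (z - a) / norm (1 - cnj a * z))"
    using lower fnz z1 by (intro mult_mono prod_mono conjI divide_left_mono prod_nonneg) auto
  also have "\<dots> = norm (g z) * ((\<Prod>a\<in>Z. norm (1 - cnj a * z)) * (\<Prod>a\<in>Z. norm (z - a) / norm (1 - cnj a * z)))"
    by (simp add: G_def norm_mult prod_norm)
  also have "(\<Prod>a\<in>Z. norm (1 - cnj a * z)) * (\<Prod>a\<in>Z. norm (z - a) / norm (1 - cnj a * z)) = (\<Prod>a\<in>Z. norm (z - a))"
    unfolding prod.distrib[symmetric] using fnz(1)[OF _ z1] by (intro prod.cong) auto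
  also have "norm (g z) * (\<Prod>a\<in>Z. norm (z - a)) = norm (f z)"
    using g(2)[of z] z1 S by (simp add: norm_mult prod_norm subset_eq)
  finally show "norm (f z) \<ge> norm (f 0) * exp (- (2 * \<rho> / (1 - \<rho>)) * L) * (\<Prod>a\<in>Z. norm (z - a) / 2)" .
qed

text
\<open>Pigeonhole: of the \<open>n + 1\<close> points with spacing \<open>1 / (n + 1)\<close>, no two can be close to the same element of \<open>A\<close>.\<close>
lemma exists_point_far_from_finite_set:
  fixes A :: "real set" and t0 :: real
  assumes "finite A" "card A \<le> n"
  shows "\<exists>t. t0 \<le> t \<and> t \<le> t0 + 1 \<and> (\<forall>x\<in>A. \<bar>t - x\<bar> \<ge> 1 / (2 * (real n + 1)))"
proof (rule ccontr)
  assume neg: "\<not> ?thesis"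
  define p where "p = (\<lambda>j::nat. t0 + real j / (real n + 1))"
  have "\<exists>x\<in>A. \<bar>p j - x\<bar> < 1 / (2 * (real n + 1))" if "j \<le> n" for j
  proof -
    have "t0 \<le> p j" "p j \<le> t0 + 1" using that by (auto simp: p_def)
    then show ?thesis using neg not_le by blast
  qed
  then obtain x where x: "\<And>j. j \<le> n \<Longrightarrow> x j \<in> A \<and> \<bar>p j - x j\<bar> < 1 / (2 * (real n + 1))" by metis
  have "inj_on x {..n}"
  proof (rule inj_onI)
    fix i j assume ij: "i \<in> {..n}" "j \<in> {..n}" "x i = x j"
    have "\<bar>p i - p j\<bar> < 1 / (2 * (real n + 1)) + 1 / (2 * (real n + 1))"
      using x[of i] x[of j] ij by auto
    also have "\<dots> = 1 / (real n + 1)" by (simp add: field_simps)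
    also have "p i - p j = (real i - real j) / (real n + 1)" by (simp add: p_def diff_divide_distrib)
    finally have "\<bar>real i - real j\<bar> / (real n + 1) < 1 / (real n + 1)" unfolding abs_divide by simp
    then have "(real n + 1) * (\<bar>real i - real j\<bar> / (real n + 1)) < (real n + 1) * (1 / (real n + 1))"
      by (intro mult_strict_left_mono) auto
    then have "\<bar>real i - real j\<bar> < 1" by simp
    then show "i = j" by linarith
  qed
  then have "card {..n} \<le> card A" using assms x by (intro card_inj_on_le) auto
  then show False using assms by simp
qed

lemma zeta_simple_zero_deriv:
  assumes "\<rho> \<in> nontrivial_zeros" "zorder riemann_zeta \<rho> = 1"
  shows "deriv riemann_zeta \<rho> \<noteq> 0"
proof -
  have \<rho>: "\<rho> \<noteq> 1" "riemann_zeta \<rho> = 0" using assms by (auto simp: nontrivial_zeros_def)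
  define g where "g = zor_poly riemann_zeta \<rho>"
  have ex: "\<exists>w\<in>-{1}. riemann_zeta w \<noteq> 0"
    using riemann_zeta_nonzero_right[of 2] by (intro bexI[of _ 2]) auto
  have conn: "connected (- {1::complex})" by (intro connected_punctured_universe) auto
  have "\<exists>r>0. cball \<rho> r \<subseteq> -{1} \<and> g holomorphic_on cball \<rho> r
    \<and> (\<forall>w\<in>cball \<rho> r. riemann_zeta w = g w * (w - \<rho>) ^ nat (zorder riemann_zeta \<rho>) \<and> g w \<noteq> 0)"
    unfolding g_def by (rule conjunct2[OF zorder_exist_zero[OF riemann_zeta_holomorphic _ conn _ ex]]) (use \<rho> in auto)
  then obtain r where r: "r > 0" "cball \<rho> r \<subseteq> -{1}" "g holomorphic_on cball \<rho> r"
      "\<And>w. w \<in> cball \<rho> r \<Longrightarrow> riemann_zeta w = g w * (w - \<rho>) ^ nat (zorder riemann_zeta \<rho>) \<and> g w \<noteq> 0"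
    by blast
  have "(g has_field_derivative deriv g \<rho>) (at \<rho>)"
    using r holomorphic_on_subset[OF r(3) ball_subset_cball] by (intro holomorphic_derivI[of _ "ball \<rho> r"]) auto
  then have "((\<lambda>w. g w * (w - \<rho>)) has_field_derivative g \<rho>) (at \<rho>)"
    by (auto intro!: derivative_eq_intros)
  then have "(riemann_zeta has_field_derivative g \<rho>) (at \<rho>)"
    by (rule has_field_derivative_transform_within_open[of _ _ _ "ball \<rho> r"]) (use r assms(2) in auto)
  then have "deriv riemann_zeta \<rho> = g \<rho>" by (rule DERIV_imp_deriv)
  then show ?thesis using r(1,4) by auto
qed

lemma regular_zeta_finite_zeros: "compact K \<Longrightarrow> finite {s \<in> K. regular_zeta s = 0}"
  by (rule holomorphic_compact_finite_zeros[where S = UNIV]) (use regular_zeta_nonconstant in \<open>auto intro: regular_zeta_holomorphic\<close>)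

text
\<open>The minimum modulus bound for zeta on a disc about \<open>2 + \<i>N\<close>: there zeta is \<open>O(N)\<close>, and \<open>1 / norm (zeta (2 + \<i>N))\<close> is bounded, so that the disc contains \<open>O(log N)\<close> zeros. The pigeonhole principle then chooses a height whose distance to all of them is at least of order \<open>1 / log N\<close>. The resulting bound \<open>exp (O(log N * log log N))\<close> for \<open>1 / \<zeta>\<close> is weak, but far below the exponential decay of Gamma.\<close>
proposition zeta_lower_bound_on_horizontal_lines:
  assumes simple: "\<And>\<rho>. \<rho> \<in> nontrivial_zeros \<Longrightarrow> zorder riemann_zeta \<rho> = 1"
  obtains A B :: real where "A > 0" "B > 0" "\<And>N::nat. N \<ge> 4 \<Longrightarrow> \<exists>T. real N - 1/2 \<le> T \<and> T \<le> real N + 1/2 \<and>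
     (\<forall>\<sigma>. 1/2 \<le> \<sigma> \<longrightarrow> \<sigma> \<le> 3/2 \<longrightarrow> riemann_zeta (Complex \<sigma> T) \<noteq> 0 \<and>
        norm (1 / riemann_zeta (Complex \<sigma> T)) \<le> A * exp (32 * ln (B * (real N + 6))
            + 10 * ln (B * (real N + 6)) * ln (8 * (10 * ln (B * (real N + 6)) + 1))))"
proof -
  obtain K where K: "K > 0" "\<And>s. Re s \<ge> 1/10 \<Longrightarrow> \<bar>Im s\<bar> \<ge> 1 \<Longrightarrow> norm (riemann_zeta s) \<le> K * norm s"
    using zeta_growth by blast
  define A where "A = (\<Sum>n. real (Suc n) powr (- 2))"
  have smA: "summable (\<lambda>n. real (Suc n) powr (- 2))" by (rule summable_Suc_powr) simp
  have A1: "A \<ge> 1"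
    using sum_le_suminf[OF smA, of "{0}"] by (simp add: A_def)
  define B where "B = A * (K + 1)"
  have B: "B > 0" using A1 K by (simp add: B_def)
  have main: "\<exists>T. real N - 1/2 \<le> T \<and> T \<le> real N + 1/2 \<and>
     (\<forall>\<sigma>. 1/2 \<le> \<sigma> \<longrightarrow> \<sigma> \<le> 3/2 \<longrightarrow> riemann_zeta (Complex \<sigma> T) \<noteq> 0 \<and>
        norm (1 / riemann_zeta (Complex \<sigma> T)) \<le> A * exp (32 * L + 10 * L * ln (8 * (10 * L + 1))))"
    if N: "N \<ge> 4" and L_def: "L = ln (B * (real N + 6))" for N L
  proof -
    define c where "c = Complex 2 (real N)"
    \<comment>
    \<open>The disc of radius \<open>19/10\<close> stays in \<open>Re s > 0\<close>. Zeros are divided out in radius \<open>17/10\<close>, and the bound holds in radius \<open>16/10\<close>, which contains the rectangle \<open>1/2 \<le> Re s \<le> 3/2\<close>, \<open>\<bar>Im s - N\<bar> \<le> 1/2\<close>. In the unit disc these radii become \<open>17/19\<close> and \<open>(16/17) * (17/19)\<close>.\<close>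
    define R :: real where "R = 19/10"
    have R0: "complex_of_real R \<noteq> 0" by (simp add: R_def)
    define s where "s = (\<lambda>z. c + of_real R * z)"
    define f where "f = (\<lambda>z. riemann_zeta (s z))"
    define S where "S = - {(1 - c) / of_real R}"
    have sS: "s z \<noteq> 1" if "z \<in> S" for z
      using that by (auto simp: S_def s_def R_def field_simps)
    have near: "\<bar>Re (s z) - 2\<bar> \<le> R * norm z" "\<bar>Im (s z) - real N\<bar> \<le> R * norm z" for z
      using abs_Re_le_cmod[of "of_real R * z"] abs_Im_le_cmod[of "of_real R * z"]
      by (auto simp: s_def c_def norm_mult R_def)
    have big: "Re (s z) \<ge> 1/10" "\<bar>Im (s z)\<bar> \<ge> 1" "norm (s z) \<le> real N + 4" if "norm z \<le> 1" for z
    proof -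
      have "R * norm z \<le> 19/10" using that by (simp add: R_def)
      then show "Re (s z) \<ge> 1/10" "\<bar>Im (s z)\<bar> \<ge> 1" using near[of z] N by linarith+
      have "norm (s z) \<le> norm c + R * norm z" unfolding s_def by (rule order_trans[OF norm_triangle_ineq]) (simp add: norm_mult R_def)
      also have "norm c \<le> 2 + real N" using cmod_le[of c] by (simp add: c_def)
      finally show "norm (s z) \<le> real N + 4" using \<open>R * norm z \<le> 19/10\<close> by linarith
    qed
    have S: "open S" "cball 0 1 \<subseteq> S"
    proof -
      show "open S" by (simp add: S_def open_Compl)
      have "z \<in> S" if "norm z \<le> 1" for z
      proof -
        have "s ((1 - c) / of_real R) = 1" using R0 by (simp add: s_def)
        then show ?thesis using big(2)[OF that] by (auto simp: S_def)
      qed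
      then show "cball 0 1 \<subseteq> S" by auto
    qed
    have hol: "f holomorphic_on S" unfolding f_def s_def
      by (rule holomorphic_on_compose_gen[OF _ riemann_zeta_holomorphic[of "-{1}"], unfolded o_def])
         (use sS in \<open>auto intro!: holomorphic_intros simp: s_def\<close>)
    define M where "M = (K + 1) * (real N + 6)"
    have fB: "norm (f z) \<le> K * (real N + 4)" if "z \<in> cball 0 1" for z
    proof -
      have z: "norm z \<le> 1" using that by simp
      have "norm (f z) \<le> K * norm (s z)" unfolding f_def by (rule K(2)) (use big[OF z] in auto)
      also have "\<dots> \<le> K * (real N + 4)" using big[OF z] K by (intro mult_left_mono) auto
      finally show ?thesis .
    qed
    have KM: "K * (real N + 4) < M" using K unfolding M_def by (simp add: algebra_simps)
    have s0: "s 0 = c" by (simp add: s_def)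
    have f0: "f 0 \<noteq> 0" "norm (f 0) \<ge> 1 / A"
    proof -
      show nz: "f 0 \<noteq> 0" unfolding f_def s0 by (rule riemann_zeta_nonzero_right) (simp add: c_def)
      have "norm (1 / f 0) \<le> A" unfolding f_def s0 A_def by (rule norm_inverse_zeta_le) (simp_all add: c_def)
      then show "norm (f 0) \<ge> 1 / A" using nz A1 by (simp add: norm_divide field_simps)
    qed
    define Z where "Z = {z \<in> ball 0 (17/19). f z = 0}"
    have Zs: "s a \<in> nontrivial_zeros" "regular_zeta (s a) = 0" "s a \<in> cball c R" if "a \<in> Z" for a
    proof -
      have a: "norm a < 17/19" "riemann_zeta (s a) = 0" using that by (auto simp: Z_def f_def)
      then have aS: "a \<in> S" using S by auto
      then show z0: "regular_zeta (s a) = 0" using regular_zeta_eq[OF sS[OF aS]] a by simp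
      then have "Re (s a) < 1" using regular_zeta_nonzero_right[of "s a"] by fastforce
      moreover have "Re (s a) > 0" using big(1)[of a] a by simp
      ultimately show "s a \<in> nontrivial_zeros" using a by (simp add: nontrivial_zeros_def)
      show "s a \<in> cball c R" using a by (simp add: s_def R_def dist_norm norm_mult)
    qed
    have finZ: "finite Z"
    proof (rule inj_on_finite)
      show "inj_on s Z" by (auto simp: inj_on_def s_def R_def)
      show "s ` Z \<subseteq> {s \<in> cball c R. regular_zeta s = 0}" using Zs by auto
      show "finite {s \<in> cball c R. regular_zeta s = 0}" by (rule regular_zeta_finite_zeros) simp
    qed
    have simpleZ: "deriv f a \<noteq> 0" if "a \<in> Z" for a
    proof -
      have d: "deriv riemann_zeta (s a) \<noteq> 0" using Zs(1)[OF that] simple by (intro zeta_simple_zero_deriv)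
      have aS: "s a \<noteq> 1" using Zs(1)[OF that] by (auto simp: nontrivial_zeros_def)
      have "(riemann_zeta has_field_derivative deriv riemann_zeta (s a)) (at (s a))"
        by (rule holomorphic_derivI[of _ "-{1}"]) (use aS in \<open>auto intro: riemann_zeta_holomorphic\<close>)
      moreover have "(s has_field_derivative of_real R) (at a)" unfolding s_def by (auto intro!: derivative_eq_intros)
      ultimately have "(f has_field_derivative deriv riemann_zeta (s a) * of_real R) (at a)"
        unfolding f_def by (rule DERIV_chain2)
      then have "deriv f a = deriv riemann_zeta (s a) * of_real R" by (rule DERIV_imp_deriv)
      then show ?thesis using d R0 by simp
    qed
    define Lf where "Lf = ln (M / norm (f 0))"
    have LfL: "Lf \<le> L"
    proof -
      have M0: "M > 0" using K by (simp add: M_def)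
      have "M * (1 / norm (f 0)) \<le> M * A" using f0 A1 M0 by (intro mult_left_mono) (auto simp: field_simps)
      also have "M * A = B * (real N + 6)" by (simp add: M_def B_def)
      finally show ?thesis unfolding Lf_def L_def using M0 f0 by (intro ln_mono) auto
    qed
    define n where "n = card Z"
    have nL: "real n * ln (19/17) \<le> Lf"
      using minimum_modulus_simple_zeros(1)[OF S hol fB KM f0(1), of "17/19" "1/2" Z] simpleZ finZ
      by (simp add: Z_def n_def Lf_def)
    \<comment> \<open>The origin of the constant 10 in the bound.\<close>
    have "ln (19/17 :: real) \<ge> 1/10" using ln_ge_iff[of "19/17" "1/10"] exp_bound[of "1/10"] by (simp add: power2_eq_square)
    then have "real n * (1/10) \<le> real n * ln (19/17)" by (intro mult_left_mono) auto
    then have nL: "real n \<le> 10 * L" using nL LfL by linarith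
    have L0: "L \<ge> 0" using nL by simp
    obtain T where T: "real N - 1/2 \<le> T" "T \<le> real N - 1/2 + 1" "\<And>x. x \<in> (\<lambda>a. Im (s a)) ` Z \<Longrightarrow> \<bar>T - x\<bar> \<ge> 1 / (2 * (real n + 1))"
      using exists_point_far_from_finite_set[of "(\<lambda>a. Im (s a)) ` Z" n "real N - 1/2"] finZ card_image_le[OF finZ]
      unfolding n_def by blast
    show ?thesis
    proof (intro exI[of _ T] conjI allI impI)
      fix \<sigma> :: real assume \<sigma>: "1/2 \<le> \<sigma>" "\<sigma> \<le> 3/2"
      define z where "z = (Complex \<sigma> T - c) / of_real R"
      have sz: "s z = Complex \<sigma> T" using R0 by (simp add: s_def z_def)
      have "(norm (Complex \<sigma> T - c))\<^sup>2 = (2 - \<sigma>)\<^sup>2 + \<bar>T - real N\<bar>\<^sup>2"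
        by (simp add: cmod_power2 c_def power2_commute)
      also have "\<dots> \<le> (3/2)\<^sup>2 + (1/2)\<^sup>2"
      proof (intro add_mono power_mono)
        show "\<bar>T - real N\<bar> \<le> 1 / 2" unfolding abs_le_iff using T(1,2) by linarith
      qed (use \<sigma> in auto)
      also have "\<dots> \<le> (16/10)\<^sup>2" by (simp add: power2_eq_square)
      finally have "norm (Complex \<sigma> T - c) \<le> 16/10" by (rule power2_le_imp_le) simp
      then have nz: "norm z \<le> (16/17) * (17/19)" unfolding z_def norm_divide norm_of_real by (simp add: R_def)
      \<comment> \<open>The constant 32 is \<open>2 \<rho> / (1 - \<rho>)\<close> for \<open>\<rho> = 16/17\<close>.\<close>
      have "norm (f z) \<ge> norm (f 0) * exp (- (2 * (16/17) / (1 - 16/17)) * Lf) * (\<Prod>a\<in>Z. norm (z - a) / 2)"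
        unfolding Lf_def using simpleZ finZ nz
        by (intro minimum_modulus_simple_zeros(2)[OF S hol fB KM f0(1), of "17/19"]) (auto simp: Z_def)
      then have 1: "norm (f z) \<ge> norm (f 0) * exp (- 32 * Lf) * (\<Prod>a\<in>Z. norm (z - a) / 2)" by simp
      have "(\<Prod>a\<in>Z. 1 / (8 * (real n + 1))) \<le> (\<Prod>a\<in>Z. norm (z - a) / 2)"
      proof (intro prod_mono conjI)
        fix a assume a: "a \<in> Z"
        have "1 / (2 * (real n + 1)) \<le> \<bar>Im (s z) - Im (s a)\<bar>" using T(3)[of "Im (s a)"] a unfolding sz by auto
        also have "\<dots> \<le> norm (s z - s a)" using abs_Im_le_cmod[of "s z - s a"] by simp
        also have "s z - s a = of_real R * (z - a)" by (simp add: s_def algebra_simps)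
        finally have "1 / (2 * (real n + 1)) \<le> 19/10 * norm (z - a)" unfolding norm_mult norm_of_real by (simp add: R_def)
        also have "\<dots> \<le> 2 * norm (z - a)" by (intro mult_right_mono) auto
        finally show "1 / (8 * (real n + 1)) \<le> norm (z - a) / 2" by (simp add: field_simps)
      qed auto
      moreover have "(\<Prod>a\<in>Z. 1 / (8 * (real n + 1))) = exp (- (real n * ln (8 * (real n + 1))))"
        by (simp add: n_def[symmetric] power_divide exp_minus exp_of_nat_mult field_simps)
      moreover have "real n * ln (8 * (real n + 1)) \<le> 10 * L * ln (8 * (10 * L + 1))"
        using nL by (intro mult_mono ln_mono) auto
      then have "exp (- (10 * L * ln (8 * (10 * L + 1)))) \<le> exp (- (real n * ln (8 * (real n + 1))))" by simp
      ultimately have 2: "exp (- (10 * L * ln (8 * (10 * L + 1)))) \<le> (\<Prod>a\<in>Z. norm (z - a) / 2)" by linarith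
      have 3: "1 / A * exp (- 32 * L) \<le> norm (f 0) * exp (- 32 * Lf)" using f0(2) LfL by (intro mult_mono) auto
      have "1 / A * exp (- 32 * L) * exp (- (10 * L * ln (8 * (10 * L + 1)))) \<le> norm (f 0) * exp (- 32 * Lf) * (\<Prod>a\<in>Z. norm (z - a) / 2)"
        by (rule mult_mono[OF 3 2]) auto
      also note 1
      finally have "1 / A * exp (- (32 * L + 10 * L * ln (8 * (10 * L + 1)))) \<le> norm (riemann_zeta (Complex \<sigma> T))"
        by (simp add: f_def sz flip: exp_add)
      then have lower: "1 / (A * exp (32 * L + 10 * L * ln (8 * (10 * L + 1)))) \<le> norm (riemann_zeta (Complex \<sigma> T))"
        by (simp only: exp_minus) (simp add: field_simps)
      define E where "E = A * exp (32 * L + 10 * L * ln (8 * (10 * L + 1)))"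
      have E: "E > 0" using A1 by (simp add: E_def)
      have low: "1 / E \<le> norm (riemann_zeta (Complex \<sigma> T))" using lower unfolding E_def .
      have "1 / E > 0" using E by simp
      then have pos: "norm (riemann_zeta (Complex \<sigma> T)) > 0" using low by linarith
      then show "riemann_zeta (Complex \<sigma> T) \<noteq> 0" by simp
      have "norm (1 / riemann_zeta (Complex \<sigma> T)) \<le> E" using low pos E by (simp add: norm_divide field_simps)
      then show "norm (1 / riemann_zeta (Complex \<sigma> T)) \<le> A * exp (32 * L + 10 * L * ln (8 * (10 * L + 1)))" unfolding E_def .
    qed (use T in auto)
  qed
  show ?thesis using that[of A B] A1 B main[OF _ refl] by force
qed

section \<open>Mellin inversion of exp (-u) - 1\<close>

text \<open>The rate \<open>pi / 2\<close> is lowered to 1, and the polynomial factor is absorbed in the difference.\<close>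
lemma Gamma_strip_decay:
  obtains C where "C > 0" "\<And>\<sigma> t. 1/2 \<le> \<sigma> \<Longrightarrow> \<sigma> \<le> 2 \<Longrightarrow> \<bar>t\<bar> \<ge> 1 \<Longrightarrow> norm (Gamma (Complex \<sigma> t)) \<le> C * exp (- \<bar>t\<bar>)"
proof -
  obtain C where C: "C > 0" "\<And>\<sigma> t. 1/2 \<le> \<sigma> \<Longrightarrow> \<sigma> \<le> 2 \<Longrightarrow> \<bar>t\<bar> \<ge> 1 \<Longrightarrow> norm (Gamma (Complex \<sigma> t)) \<le> C * t\<^sup>2 * exp (- pi * \<bar>t\<bar> / 2)"
    using Gamma_strip_bound by blast
  have "norm (Gamma (Complex \<sigma> t)) \<le> (8 * C) * exp (- \<bar>t\<bar>)" if h: "1/2 \<le> \<sigma>" "\<sigma> \<le> 2" "\<bar>t\<bar> \<ge> 1" for \<sigma> t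
  proof -
    have "1 + \<bar>t\<bar> / 2 + (\<bar>t\<bar> / 2)\<^sup>2 / 2 \<le> exp (\<bar>t\<bar> / 2)" by (rule exp_lower_Taylor_quadratic) simp
    then have t2: "t\<^sup>2 \<le> 8 * exp (\<bar>t\<bar> / 2)" using h by (simp add: power_divide)
    have "3 * \<bar>t\<bar> \<le> pi * \<bar>t\<bar>" using pi_gt3 by (intro mult_right_mono) auto
    then have e: "exp (\<bar>t\<bar> / 2) * exp (- pi * \<bar>t\<bar> / 2) \<le> exp (- \<bar>t\<bar>)" by (simp flip: exp_add)
    have "norm (Gamma (Complex \<sigma> t)) \<le> C * (t\<^sup>2 * exp (- pi * \<bar>t\<bar> / 2))" using C(2)[OF h] by simp
    also have "\<dots> \<le> C * ((8 * exp (\<bar>t\<bar> / 2)) * exp (- pi * \<bar>t\<bar> / 2))"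
      using C(1) t2 by (intro mult_left_mono mult_right_mono) auto
    also have "\<dots> = 8 * C * (exp (\<bar>t\<bar> / 2) * exp (- pi * \<bar>t\<bar> / 2))" by simp
    also have "\<dots> \<le> 8 * C * exp (- \<bar>t\<bar>)" using C(1) e by (intro mult_left_mono) auto
    finally show ?thesis .
  qed
  then show ?thesis using that[of "8 * C"] C by auto
qed

text
\<open>All factors of the Pochhammer symbol have modulus at least \<open>\<bar>Im w\<bar> \<ge> 1\<close>. Hence Gamma decays at the same rate to the left of the strip.\<close>
lemma Gamma_shift_norm_le:
  assumes "\<bar>Im w\<bar> \<ge> 1"
  shows "norm (Gamma w) \<le> norm (Gamma (w + of_nat m))"
proof -
  have nz: "w \<notin> \<int>\<^sub>\<le>\<^sub>0" using assms by (auto elim!: nonpos_Ints_cases)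
  have "norm (pochhammer w m) \<ge> 1"
  proof (induction m)
    case (Suc m)
    have "1 \<le> norm (w + of_nat m)" using abs_Im_le_cmod[of "w + of_nat m"] assms by simp
    then have "1 * 1 \<le> norm (pochhammer w m) * norm (w + of_nat m)" using Suc by (intro mult_mono) auto
    then show ?case by (simp add: pochhammer_Suc norm_mult)
  qed auto
  moreover have "Gamma (w + of_nat m) = pochhammer w m * Gamma w"
    using pochhammer_Gamma[OF nz, of m] nz by (simp add: Gamma_eq_zero_iff)
  ultimately show ?thesis by (simp add: norm_mult mult_le_cancel_right1)
qed

lemma integrable_exp_abs:
  assumes "a > (0::real)" shows "integrable lborel (\<lambda>t. exp (- a * \<bar>t\<bar>))"
proof -
  define h where "h = (\<lambda>u::real. indicator {0..} u * exp (- a * u))"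
  have h: "integrable lborel h" unfolding h_def by (rule integral_exp_decay[OF assms])
  then have "integrable lborel (\<lambda>u. h (0 + (-1) * u))"
    by (subst lborel_integrable_real_affine_iff) auto
  with h have "integrable lborel (\<lambda>u. h u + h (0 + (-1) * u))" by (rule Bochner_Integration.integrable_add)
  then show ?thesis
    by (rule Bochner_Integration.integrable_bound) (auto intro!: AE_I2 simp: h_def indicator_def)
qed

lemma integrable_exp_decay_bound:
  fixes h :: "real \<Rightarrow> complex"
  assumes "continuous_on UNIV h" "a > 0" and bd: "\<And>t. \<bar>t\<bar> \<ge> 1 \<Longrightarrow> norm (h t) \<le> C * exp (- a * \<bar>t\<bar>)"
  shows "integrable lborel h"
proof -
  have "compact (h ` {-1..1})" using assms(1) by (intro compact_continuous_image continuous_on_subset[OF assms(1)]) auto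
  then obtain B where B: "\<And>t. t \<in> {-1..1} \<Longrightarrow> norm (h t) \<le> B" by (fastforce dest!: compact_imp_bounded simp: bounded_iff)
  have B0: "B \<ge> 0" using order_trans[OF norm_ge_zero B[of 0]] by simp
  have "C * exp (- a * \<bar>1\<bar>) \<ge> 0" using order_trans[OF norm_ge_zero bd[of 1]] by simp
  then have C0: "C \<ge> 0" by (simp add: zero_le_mult_iff)
  have bound: "norm (h t) \<le> (B * exp a + C) * exp (- a * \<bar>t\<bar>)" for t
  proof (cases "\<bar>t\<bar> \<ge> 1")
    case True
    then have "norm (h t) \<le> C * exp (- a * \<bar>t\<bar>)" by (rule bd)
    also have "\<dots> \<le> (B * exp a + C) * exp (- a * \<bar>t\<bar>)" using B0 by (intro mult_right_mono) auto
    finally show ?thesis .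
  next
    case False
    have "a * \<bar>t\<bar> \<le> a * 1" using False assms(2) by (intro mult_left_mono) auto
    then have "1 \<le> exp a * exp (- a * \<bar>t\<bar>)" by (simp flip: exp_add)
    then have "B * 1 \<le> B * (exp a * exp (- a * \<bar>t\<bar>))" using B0 by (intro mult_left_mono) auto
    also have "\<dots> \<le> (B * exp a + C) * exp (- a * \<bar>t\<bar>)" using C0 by (simp add: distrib_right)
    finally have "B \<le> (B * exp a + C) * exp (- a * \<bar>t\<bar>)" by simp
    moreover have "norm (h t) \<le> B" by (rule B) (use False in \<open>simp add: abs_le_iff not_le abs_less_iff less_imp_le\<close>)
    ultimately show ?thesis by linarith
  qed
  show ?thesis
  proof (rule Bochner_Integration.integrable_bound)
    show "integrable lborel (\<lambda>t. (B * exp a + C) * exp (- a * \<bar>t\<bar>))"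
      by (intro integrable_mult_right integrable_exp_abs assms)
    show "h \<in> borel_measurable lborel" using assms(1) by (simp add: borel_measurable_continuous_onI)
    show "AE t in lborel. norm (h t) \<le> norm ((B * exp a + C) * exp (- a * \<bar>t\<bar>))"
      using bound order_trans[OF bound abs_ge_self] by (intro AE_I2) auto
  qed
qed

lemma vertical_line_shift:
  fixes F :: "complex \<Rightarrow> complex" and T :: "nat \<Rightarrow> real"
  assumes "a < b" and T: "filterlim T at_top sequentially" "\<And>n. T n > 0"
    and P: "\<And>n. finite (P n)" "\<And>n. P n \<subseteq> box (Complex a (- T n)) (Complex b (T n))"
    and hol: "\<And>n. \<exists>S. open S \<and> convex S \<and> cbox (Complex a (- T n)) (Complex b (T n)) \<subseteq> S \<and> F holomorphic_on S - P n"
    and bot: "(\<lambda>n. integral {a..b} (\<lambda>x. F (Complex x (- T n)))) \<longlonglongrightarrow> 0"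
    and top: "(\<lambda>n. integral {a..b} (\<lambda>x. F (Complex x (T n)))) \<longlonglongrightarrow> 0"
    and int: "integrable lborel (\<lambda>y. F (Complex a y))" "integrable lborel (\<lambda>y. F (Complex b y))"
  shows "(\<lambda>n. \<Sum>p\<in>P n. residue F p) \<longlonglongrightarrow> ((LINT y|lborel. F (Complex b y)) - (LINT y|lborel. F (Complex a y))) / (2 * of_real pi)"
proof -
  have eq: "(\<Sum>p\<in>P n. residue F p) = (integral {a..b} (\<lambda>x. F (Complex x (- T n))) - integral {a..b} (\<lambda>x. F (Complex x (T n)))
           + \<i> * (integral {- T n..T n} (\<lambda>y. F (Complex b y)) - integral {- T n..T n} (\<lambda>y. F (Complex a y)))) / (2 * of_real pi * \<i>)" for n
  proof -
    obtain S where "open S" "convex S" "cbox (Complex a (- T n)) (Complex b (T n)) \<subseteq> S" "F holomorphic_on S - P n"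
      using hol by blast
    from rectangle_residue_formula[OF assms(1) _ this(1,2,3) P(1) P(2) this(4)] T(2)[of n]
    show ?thesis by simp
  qed
  have "(\<lambda>n. \<Sum>p\<in>P n. residue F p) \<longlonglongrightarrow> (0 - 0 + \<i> * ((LINT y|lborel. F (Complex b y)) - (LINT y|lborel. F (Complex a y)))) / (2 * of_real pi * \<i>)"
    unfolding eq
    by (intro tendsto_intros bot top filterlim_compose[OF tendsto_integral_symmetric T(1)] int) auto
  then show ?thesis by simp
qed

lemma integral_tendsto_0_uniform_bound:
  fixes F :: "nat \<Rightarrow> real \<Rightarrow> complex"
  assumes "a < b" "\<And>n. continuous_on {a..b} (F n)" "\<And>n x. x \<in> {a..b} \<Longrightarrow> norm (F n x) \<le> B n" "B \<longlonglongrightarrow> 0"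
  shows "(\<lambda>n. integral {a..b} (F n)) \<longlonglongrightarrow> 0"
proof (rule Lim_null_comparison)
  show "\<forall>\<^sub>F n in sequentially. norm (integral {a..b} (F n)) \<le> B n * (b - a)"
    using assms by (intro always_eventually allI integral_bound) auto
  show "(\<lambda>n. B n * (b - a)) \<longlonglongrightarrow> 0" using tendsto_mult_left_zero[OF assms(4)] .
qed

lemma powr_between_le:
  fixes u :: real
  assumes "u > 0" "a \<le> x" "x \<le> b"
  shows "u powr x \<le> u powr a + u powr b"
proof (cases "u \<ge> 1")
  case True
  then have "u powr x \<le> u powr b" using assms by (intro powr_mono) auto
  then show ?thesis by (simp add: add_increasing)
next
  case False
  then have "u powr x \<le> u powr a" using assms by (intro powr_mono') auto
  then show ?thesis by (simp add: add_increasing2)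
qed

text
\<open>The line \<open>Re w = c\<close> lies between the poles 0 and \<open>-1\<close> of Gamma. Moving it to the left by one unit at a time collects the residues \<open>(- u)\<^bsup>k\<^esup> / k!\<close> with \<open>k \<ge> 1\<close>, and the integral over the remote line tends to 0; this is the exponential series without its constant term.\<close>
context
  fixes c u :: real
  assumes c: "-1/2 \<le> c" "c < 0" and u: "u > 0"
begin

lemma Gamma_line_nonpole: "Complex (c - real k) t \<notin> \<int>\<^sub>\<le>\<^sub>0"
proof
  assume "Complex (c - real k) t \<in> \<int>\<^sub>\<le>\<^sub>0"
  then obtain n :: int where "Complex (c - real k) t = of_int n" by (auto elim!: nonpos_Ints_cases)
  then have "c = real_of_int (n + int k)" by (simp add: complex_eq_iff)
  then have "real_of_int (n + int k) < real_of_int 0" "real_of_int (- 1) < real_of_int (n + int k)" using c by auto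
  then have "n + int k < 0" "- 1 < n + int k" by (simp_all only: of_int_less_iff)
  then show False by simp
qed

lemma Mellin_kernel_continuous: "continuous_on UNIV (\<lambda>t. Gamma (Complex (c - real k) t) * of_real u powr (- Complex (c - real k) t))"
proof -
  have "continuous_on UNIV (\<lambda>t. Gamma (Complex (c - real k) t))"
  proof (rule continuous_on_compose2[OF continuous_on_Gamma])
    show "- \<int>\<^sub>\<le>\<^sub>0 \<inter> \<int>\<^sub>\<le>\<^sub>0 = ({} :: complex set)" by auto
    show "continuous_on UNIV (\<lambda>t. Complex (c - real k) t)" unfolding Complex_eq by (intro continuous_intros)
  qed (use Gamma_line_nonpole in auto)
  moreover have "continuous_on UNIV (\<lambda>t. of_real u powr (- Complex (c - real k) t))"
    unfolding Complex_eq using u by (intro continuous_intros) auto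
  ultimately show ?thesis by (rule continuous_on_mult)
qed

lemma Mellin_kernel_bound:
  obtains C where "C > 0" "\<And>x t. c - real k - 1 \<le> x \<Longrightarrow> x \<le> c - real k \<Longrightarrow> \<bar>t\<bar> \<ge> 1 \<Longrightarrow>
     norm (Gamma (Complex x t) * of_real u powr (- Complex x t)) \<le> C * exp (- \<bar>t\<bar>)"
proof -
  obtain C where C: "C > 0" "\<And>\<sigma> t. 1/2 \<le> \<sigma> \<Longrightarrow> \<sigma> \<le> 2 \<Longrightarrow> \<bar>t\<bar> \<ge> 1 \<Longrightarrow> norm (Gamma (Complex \<sigma> t)) \<le> C * exp (- \<bar>t\<bar>)"
    using Gamma_strip_decay by blast
  define D where "D = u powr (- (c - real k)) + u powr (- (c - real k - 1))"
  have D: "D > 0" using u by (simp add: D_def add_pos_pos)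
  have "norm (Gamma (Complex x t) * of_real u powr (- Complex x t)) \<le> (C * D) * exp (- \<bar>t\<bar>)"
    if x: "c - real k - 1 \<le> x" "x \<le> c - real k" and t: "\<bar>t\<bar> \<ge> 1" for x t
  proof -
    have "norm (Gamma (Complex x t)) \<le> norm (Gamma (Complex x t + of_nat (k + 2)))"
      by (rule Gamma_shift_norm_le) (use t in simp)
    also have "Complex x t + of_nat (k + 2) = Complex (x + real k + 2) t" by (simp add: complex_eq_iff)
    also have "norm (Gamma \<dots>) \<le> C * exp (- \<bar>t\<bar>)" by (rule C(2)) (use x c t in auto)
    finally have G: "norm (Gamma (Complex x t)) \<le> C * exp (- \<bar>t\<bar>)" .
    have "norm (of_real u powr (- Complex x t)) = u powr (- x)" using norm_of_real_powr[OF u] by simp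
    also have "\<dots> \<le> D" unfolding D_def by (rule powr_between_le) (use u x in auto)
    finally have "norm (of_real u powr (- Complex x t)) \<le> D" .
    then have "norm (Gamma (Complex x t) * of_real u powr (- Complex x t)) \<le> (C * exp (- \<bar>t\<bar>)) * D"
      unfolding norm_mult using G D C by (intro mult_mono) auto
    then show ?thesis by (simp add: mult_ac)
  qed
  then show ?thesis using that[of "C * D"] C D by simp
qed

lemma Mellin_kernel_integrable: "integrable lborel (\<lambda>t. Gamma (Complex (c - real k) t) * of_real u powr (- Complex (c - real k) t))"
proof -
  obtain C where C: "C > 0" "\<And>x t. c - real k - 1 \<le> x \<Longrightarrow> x \<le> c - real k \<Longrightarrow> \<bar>t\<bar> \<ge> 1 \<Longrightarrow>
     norm (Gamma (Complex x t) * of_real u powr (- Complex x t)) \<le> C * exp (- \<bar>t\<bar>)" using Mellin_kernel_bound by blast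
  show ?thesis
    by (rule integrable_exp_decay_bound[OF Mellin_kernel_continuous, of 1 _ C]) (use C(2)[of "c - real k"] in auto)
qed

lemma Mellin_shift_step:
  "(LINT t|lborel. Gamma (Complex (c - real k) t) * of_real u powr (- Complex (c - real k) t))
   - (LINT t|lborel. Gamma (Complex (c - real (Suc k)) t) * of_real u powr (- Complex (c - real (Suc k)) t))
   = 2 * of_real pi * of_real ((- u) ^ Suc k / fact (Suc k))"
proof -
  define F :: "complex \<Rightarrow> complex" where "F = (\<lambda>w. Gamma w * of_real u powr (- w))"
  define a b where "a = c - real (Suc k)" and "b = c - real k"
  define p :: complex where "p = - of_nat (Suc k)"
  define S where "S = {w. Re w > - real (Suc (Suc k))} \<inter> {w. Re w < - real k}"
  have S: "open S" "convex S" unfolding S_def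
    by (auto intro!: open_Int open_halfspace_Re_gt open_halfspace_Re_lt convex_Int convex_halfspace_Re_gt convex_halfspace_Re_lt)
  have cb: "cbox (Complex a (- t)) (Complex b t) \<subseteq> S" for t
    using c by (auto simp: in_cbox_complex_iff S_def a_def b_def)
  have pS: "p \<in> S" by (simp add: p_def S_def)
  have hol: "F holomorphic_on S - {p}"
  proof -
    have "w \<notin> \<int>\<^sub>\<le>\<^sub>0" if w: "w \<in> S - {p}" for w
    proof
      assume "w \<in> \<int>\<^sub>\<le>\<^sub>0"
      then obtain n :: int where n: "w = of_int n" by (auto elim!: nonpos_Ints_cases)
      with w have "real_of_int n > - real (Suc (Suc k))" "real_of_int n < - real k" by (auto simp: S_def)
      then have "n = - int (Suc k)" by linarith
      then have "w = p" using n by (simp add: p_def)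
      then show False using w by auto
    qed
    then show ?thesis unfolding F_def using u by (intro holomorphic_intros) auto
  qed
  have res: "residue F p = of_real ((- u) ^ Suc k / fact (Suc k))"
  proof (rule residue_simple'[OF S(1) pS hol])
    have "(\<lambda>z. Gamma z * (z + of_nat (Suc k))) \<midarrow>p\<rightarrow> (-1) ^ Suc k / fact (Suc k)"
      unfolding p_def by (rule Gamma_residues)
    moreover have "(\<lambda>z. complex_of_real u powr (- z)) \<midarrow>p\<rightarrow> of_real u powr (- p)"
      using u by (intro tendsto_intros) auto
    ultimately have "(\<lambda>z. (Gamma z * (z + of_nat (Suc k))) * of_real u powr (- z)) \<midarrow>p\<rightarrow> ((-1) ^ Suc k / fact (Suc k)) * of_real u powr (- p)"
      by (intro tendsto_mult)
    moreover have "((-1) ^ Suc k / fact (Suc k)) * of_real u powr (- p) = of_real ((- u) ^ Suc k / fact (Suc k))"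
    proof -
      have pw: "of_real u powr (- p) = complex_of_real u ^ Suc k"
        using u unfolding p_def minus_minus by (subst powr_nat') auto
      have "of_real ((- u) ^ Suc k / fact (Suc k)) = (- complex_of_real u) ^ Suc k / fact (Suc k)"
        by (simp only: of_real_divide of_real_power of_real_minus of_real_fact)
      also have "(- complex_of_real u) ^ Suc k = (-1) ^ Suc k * complex_of_real u ^ Suc k" by (rule power_minus)
      finally show ?thesis unfolding pw by (simp only: times_divide_eq_left)
    qed
    moreover have "(\<lambda>z. (Gamma z * (z + of_nat (Suc k))) * of_real u powr (- z)) = (\<lambda>w. F w * (w - p))"
      by (simp add: F_def p_def fun_eq_iff algebra_simps)
    ultimately show "(\<lambda>w. F w * (w - p)) \<midarrow>p\<rightarrow> of_real ((- u) ^ Suc k / fact (Suc k))" by (simp only:)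
  qed
  obtain C where C: "C > 0" "\<And>x t. c - real k - 1 \<le> x \<Longrightarrow> x \<le> c - real k \<Longrightarrow> \<bar>t\<bar> \<ge> 1 \<Longrightarrow>
     norm (Gamma (Complex x t) * of_real u powr (- Complex x t)) \<le> C * exp (- \<bar>t\<bar>)" using Mellin_kernel_bound by blast
  have horiz: "(\<lambda>n. integral {a..b} (\<lambda>x. F (Complex x (\<sigma> * (real n + 1))))) \<longlonglongrightarrow> 0" if \<sigma>: "\<bar>\<sigma>\<bar> = 1" for \<sigma>
  proof (rule integral_tendsto_0_uniform_bound)
    show "a < b" by (simp add: a_def b_def)
    show "continuous_on {a..b} (\<lambda>x. F (Complex x (\<sigma> * (real n + 1))))" for n
    proof (rule continuous_on_compose2[OF holomorphic_on_imp_continuous_on[OF hol]])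
      show "continuous_on {a..b} (\<lambda>x. Complex x (\<sigma> * (real n + 1)))" unfolding Complex_eq by (intro continuous_intros)
      show "(\<lambda>x. Complex x (\<sigma> * (real n + 1))) ` {a..b} \<subseteq> S - {p}"
        using c \<sigma> by (auto simp: S_def a_def b_def p_def complex_eq_iff)
    qed
    show "(\<lambda>n. C * exp (- (real n + 1))) \<longlonglongrightarrow> 0" by real_asymp
    fix n x assume x: "x \<in> {a..b}"
    have "\<bar>\<sigma> * (real n + 1)\<bar> = real n + 1" using \<sigma> by (simp add: abs_mult)
    then show "norm (F (Complex x (\<sigma> * (real n + 1)))) \<le> C * exp (- (real n + 1))"
      using C(2)[of x "\<sigma> * (real n + 1)"] x by (simp add: F_def a_def b_def)
  qed
  have "(\<lambda>n::nat. \<Sum>p\<in>{p}. residue F p) \<longlonglongrightarrow> ((LINT y|lborel. F (Complex b y)) - (LINT y|lborel. F (Complex a y))) / (2 * of_real pi)"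
  proof (rule vertical_line_shift[where T = "\<lambda>n. real n + 1"])
    show "filterlim (\<lambda>n. real n + 1) at_top sequentially" by real_asymp
    show "{p} \<subseteq> box (Complex a (- (real n + 1))) (Complex b (real n + 1))" for n
      using c by (auto simp: p_def in_box_complex_iff a_def b_def)
    show "\<exists>S. open S \<and> convex S \<and> cbox (Complex a (- (real n + 1))) (Complex b (real n + 1)) \<subseteq> S \<and> F holomorphic_on S - {p}" for n
      using S cb hol by blast
    show "(\<lambda>n. integral {a..b} (\<lambda>x. F (Complex x (- (real n + 1))))) \<longlonglongrightarrow> 0" using horiz[of "-1"] by simp
    show "(\<lambda>n. integral {a..b} (\<lambda>x. F (Complex x (real n + 1)))) \<longlonglongrightarrow> 0" using horiz[of 1] by simp
  qed (use Mellin_kernel_integrable[of k] Mellin_kernel_integrable[of "Suc k"] in \<open>auto simp: F_def a_def b_def\<close>)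
  then have "residue F p = ((LINT y|lborel. F (Complex b y)) - (LINT y|lborel. F (Complex a y))) / (2 * of_real pi)"
    by (simp add: LIMSEQ_const_iff)
  then show ?thesis unfolding res by (simp add: F_def a_def b_def field_simps)
qed

text
\<open>Each step to the left divides Gamma by a number of modulus at least \<open>k\<close>, so that the integral over the \<open>k\<close>-th line is \<open>O(u\<^bsup>k\<^esup> / k!)\<close>.\<close>
lemma Mellin_far_left_tendsto_0:
  "(\<lambda>k. LINT t|lborel. Gamma (Complex (c - real k) t) * of_real u powr (- Complex (c - real k) t)) \<longlonglongrightarrow> 0"
proof (rule Lim_null_comparison)
  define I where "I = (LINT t|lborel. norm (Gamma (Complex (c - real 0) t) * of_real u powr (- Complex (c - real 0) t)))"
  have bd: "norm (Gamma (Complex (c - real k) t) * of_real u powr (- Complex (c - real k) t))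
      \<le> u ^ k / fact k * norm (Gamma (Complex (c - real 0) t) * of_real u powr (- Complex (c - real 0) t))" for k t
  proof -
    have g: "fact k * norm (Gamma (Complex (c - real k) t)) \<le> norm (Gamma (Complex c t))"
    proof (induction k)
      case (Suc k)
      have "Complex (c - real k) t = Complex (c - real (Suc k)) t + 1" by (simp add: complex_eq_iff)
      then have "Gamma (Complex (c - real k) t) = Complex (c - real (Suc k)) t * Gamma (Complex (c - real (Suc k)) t)"
        using Gamma_plus1[OF Gamma_line_nonpole] by metis
      then have eq: "norm (Gamma (Complex (c - real k) t)) = norm (Complex (c - real (Suc k)) t) * norm (Gamma (Complex (c - real (Suc k)) t))"
        by (simp only: norm_mult)
      have "real (Suc k) \<le> norm (Complex (c - real (Suc k)) t)"
        using abs_Re_le_cmod[of "Complex (c - real (Suc k)) t"] c by simp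
      then have h1: "fact k * (real (Suc k) * norm (Gamma (Complex (c - real (Suc k)) t))) \<le> fact k * norm (Gamma (Complex (c - real k) t))"
        unfolding eq by (intro mult_left_mono mult_right_mono) auto
      have "fact (Suc k) * norm (Gamma (Complex (c - real (Suc k)) t)) = fact k * (real (Suc k) * norm (Gamma (Complex (c - real (Suc k)) t)))"
        by (simp only: fact_Suc mult_ac)
      then show ?case using order_trans[OF h1 Suc] by (simp only:)
    qed auto
    have n: "norm (of_real u powr (- Complex (c - real k) t)) = u ^ k * norm (of_real u powr (- Complex (c - real 0) t))"
      using u by (simp add: norm_of_real_powr powr_add[symmetric] powr_realpow[symmetric] add.commute)
    have "norm (Gamma (Complex (c - real k) t)) \<le> norm (Gamma (Complex c t)) / fact k" using g by (simp add: field_simps)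
    then have "norm (Gamma (Complex (c - real k) t)) * (u ^ k * norm (of_real u powr (- Complex (c - real 0) t)))
       \<le> norm (Gamma (Complex c t)) / fact k * (u ^ k * norm (of_real u powr (- Complex (c - real 0) t)))"
      using u by (intro mult_right_mono) auto
    moreover have "c - real 0 = c" by simp
    ultimately show ?thesis
      unfolding norm_mult n by (simp only: mult_ac times_divide_eq_left times_divide_eq_right)
  qed
  show "\<forall>\<^sub>F k in sequentially. norm (LINT t|lborel. Gamma (Complex (c - real k) t) * of_real u powr (- Complex (c - real k) t)) \<le> u ^ k / fact k * I"
  proof (intro always_eventually allI)
    fix k
    have "norm (LINT t|lborel. Gamma (Complex (c - real k) t) * of_real u powr (- Complex (c - real k) t))
       \<le> (LINT t|lborel. norm (Gamma (Complex (c - real k) t) * of_real u powr (- Complex (c - real k) t)))"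
      by (rule integral_norm_bound)
    also have "\<dots> \<le> (LINT t|lborel. u ^ k / fact k * norm (Gamma (Complex (c - real 0) t) * of_real u powr (- Complex (c - real 0) t)))"
      by (intro integral_mono integrable_norm integrable_mult_right Mellin_kernel_integrable bd)
    also have "\<dots> = u ^ k / fact k * I" unfolding I_def by (rule integral_mult_right_zero)
    finally show "norm (LINT t|lborel. Gamma (Complex (c - real k) t) * of_real u powr (- Complex (c - real k) t)) \<le> u ^ k / fact k * I" .
  qed
  have "(\<lambda>k. u ^ k / fact k) \<longlonglongrightarrow> 0"
    using summable_LIMSEQ_zero[OF summable_exp[of u]] by (simp add: divide_inverse mult.commute)
  then show "(\<lambda>k. u ^ k / fact k * I) \<longlonglongrightarrow> 0" by (rule tendsto_mult_left_zero)
qed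

theorem Mellin_inversion_exp_minus_1:
  "(LINT t|lborel. Gamma (Complex c t) * of_real u powr (- Complex c t)) = of_real (2 * pi * (exp (- u) - 1))"
proof -
  define J where "J = (\<lambda>k. LINT t|lborel. Gamma (Complex (c - real k) t) * of_real u powr (- Complex (c - real k) t))"
  have step: "J k - J (Suc k) = 2 * of_real pi * of_real ((- u) ^ Suc k / fact (Suc k))" for k
    unfolding J_def by (rule Mellin_shift_step)
  have "(\<lambda>k. J k - J (Suc k)) sums (J 0 - 0)"
    by (rule telescope_sums') (use Mellin_far_left_tendsto_0 in \<open>simp add: J_def\<close>)
  moreover have "(\<lambda>k. (- u) ^ Suc k / fact (Suc k)) sums (exp (- u) - 1)"
    using exp_converges[of "-u"] by (subst sums_Suc_iff) (simp add: divide_inverse mult.commute)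
  then have "(\<lambda>k. 2 * complex_of_real pi * of_real ((- u) ^ Suc k / fact (Suc k))) sums (2 * of_real pi * of_real (exp (- u) - 1))"
    by (intro sums_mult sums_of_real)
  ultimately have "J 0 - 0 = 2 * of_real pi * of_real (exp (- u) - 1)" unfolding step by (rule sums_unique2)
  then show ?thesis by (simp add: J_def)
qed

end

section \<open>The integrand of the Hardy-Littlewood-Ramanujan identity\<close>

lemma not_nonpos_Int_if_Re_pos: "Re z > 0 \<Longrightarrow> z \<notin> \<int>\<^sub>\<le>\<^sub>0"
  by (auto elim!: nonpos_Ints_cases)

definition mobius_exp_series :: "real \<Rightarrow> real" where
  "mobius_exp_series u = (\<Sum>n. mobius (Suc n) / real (Suc n) * exp (- (u / real (Suc n) ^ 2)))"

text
\<open>Since \<open>\<mu>(n) / n\<close> has sum 0, the exponential may be diminished by 1. This makes the series absolutely convergent, and is what a Mellin integral on a line between 0 and \<open>-1\<close> produces.\<close>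
lemma
  assumes u: "u > 0"
  shows mobius_exp_series_summable: "summable (\<lambda>n. mobius (Suc n) / real (Suc n) * exp (- (u / real (Suc n) ^ 2)))"
    and mobius_exp_series_sums: "(\<lambda>n. mobius (Suc n) / real (Suc n) * (exp (- (u / real (Suc n) ^ 2)) - 1)) sums mobius_exp_series u"
proof -
  have "summable (\<lambda>n. mobius (Suc n) / real (Suc n) * (exp (- (u / real (Suc n) ^ 2)) - 1))"
  proof (rule summable_comparison_test')
    show "summable (\<lambda>n. u * real (Suc n) powr (- 2))" by (intro summable_mult summable_Suc_powr) auto
    fix n :: nat
    define m where "m = real (Suc n)"
    have m: "m \<ge> 1" by (simp add: m_def)
    have "exp (- (u / m\<^sup>2)) \<ge> 1 - u / m\<^sup>2" using exp_ge_add_one_self[of "- (u / m\<^sup>2)"] by simp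
    moreover have "exp (- (u / m\<^sup>2)) \<le> 1" using u by simp
    ultimately have e: "\<bar>exp (- (u / m\<^sup>2)) - 1\<bar> \<le> u / m\<^sup>2" by simp
    have "\<bar>mobius (Suc n)\<bar> / m \<le> 1" using abs_mobius_le_1[of "Suc n"] m by (simp add: divide_le_eq_1)
    then have "\<bar>mobius (Suc n)\<bar> / m * \<bar>exp (- (u / m\<^sup>2)) - 1\<bar> \<le> 1 * (u / m\<^sup>2)"
      using e m by (intro mult_mono) auto
    moreover have "m powr (- 2) = 1 / m\<^sup>2" using m by (simp add: powr_minus_divide)
    ultimately show "norm (mobius (Suc n) / real (Suc n) * (exp (- (u / real (Suc n) ^ 2)) - 1)) \<le> u * real (Suc n) powr (- 2)"
      unfolding m_def[symmetric] using m by (simp add: abs_mult)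
  qed
  then obtain S where S: "(\<lambda>n. mobius (Suc n) / real (Suc n) * (exp (- (u / real (Suc n) ^ 2)) - 1)) sums S" by (auto simp: summable_def)
  from sums_add[OF S sums_mobius_over_n]
  have S': "(\<lambda>n. mobius (Suc n) / real (Suc n) * exp (- (u / real (Suc n) ^ 2))) sums S" by (simp add: right_diff_distrib)
  then show "summable (\<lambda>n. mobius (Suc n) / real (Suc n) * exp (- (u / real (Suc n) ^ 2)))" by (rule sums_summable)
  show "(\<lambda>n. mobius (Suc n) / real (Suc n) * (exp (- (u / real (Suc n) ^ 2)) - 1)) sums mobius_exp_series u"
    using S sums_unique[OF S'] by (simp add: mobius_exp_series_def)
qed

lemma theta_moment_cnj: "theta_moment (cnj z) = cnj (theta_moment z)"
proof -
  have "theta_moment (cnj z) = (LINT u|lborel. cnj (of_real (theta_weight u) * exp (of_real u * z)))"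
    by (simp add: theta_moment_def exp_cnj)
  then show ?thesis by (simp only: theta_moment_def Bochner_Integration.integral_cnj)
qed

lemma regular_zeta_cnj: "regular_zeta (cnj s) = cnj (regular_zeta s)"
proof -
  have "completed_zeta (cnj s) = cnj (completed_zeta s)"
    using theta_moment_cnj[of "s / 2"] theta_moment_cnj[of "(1 - s) / 2"] by (simp add: completed_zeta_def)
  moreover have "rGamma (cnj s / 2 + 1) = cnj (rGamma (s / 2 + 1))" by (simp add: cnj_rGamma)
  moreover have "exp (cnj s / 2 * of_real (ln pi)) = cnj (exp (s / 2 * of_real (ln pi)))" by (simp add: exp_cnj)
  ultimately show ?thesis by (simp add: regular_zeta_def)
qed

lemma completed_zeta_eq_0_iff:
  assumes "Re s > -2"
  shows "completed_zeta s = 0 \<longleftrightarrow> regular_zeta s = 0"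
proof -
  have "s / 2 + 1 \<notin> \<int>\<^sub>\<le>\<^sub>0"
  proof
    assume "s / 2 + 1 \<in> \<int>\<^sub>\<le>\<^sub>0"
    then obtain n :: int where "s / 2 + 1 = of_int n" "n \<le> 0" by (auto elim!: nonpos_Ints_cases)
    then have "Re (s / 2 + 1) \<le> 0" by simp
    then show False using assms by simp
  qed
  then show ?thesis by (simp add: regular_zeta_def rGamma_eq_zero_iff)
qed

lemma regular_zeta_zero_reflect:
  assumes "- 2 < Re s" "Re s < 3" "regular_zeta s = 0"
  shows "regular_zeta (1 - s) = 0"
proof -
  have "completed_zeta (1 - s) = 0"
    unfolding completed_zeta_reflect using assms completed_zeta_eq_0_iff[of s] by blast
  moreover have "Re (1 - s) > - 2" using assms by simp
  ultimately show ?thesis using completed_zeta_eq_0_iff[of "1 - s"] by blast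
qed

text
\<open>The trivial zeros start at \<open>-2\<close>; the functional equation and the absence of zeros in \<open>Re s \<ge> 1\<close> leave only the open strip.\<close>
lemma regular_zeta_zero_nontrivial:
  assumes "- 2 < Re s" "regular_zeta s = 0"
  shows "s \<in> nontrivial_zeros"
proof -
  have 1: "Re s < 1" using regular_zeta_nonzero_right[of s] assms by fastforce
  then have "regular_zeta (1 - s) = 0" using assms by (intro regular_zeta_zero_reflect) auto
  then have "Re s > 0" using regular_zeta_nonzero_right[of "1 - s"] by fastforce
  moreover have "s \<noteq> 1" using 1 by auto
  ultimately show ?thesis using 1 assms(2) regular_zeta_eq[of s] by (auto simp: nontrivial_zeros_def)
qed

lemma nontrivial_zerosD: "\<rho> \<in> nontrivial_zeros \<Longrightarrow> regular_zeta \<rho> = 0 \<and> 0 < Re \<rho> \<and> Re \<rho> < 1 \<and> \<rho> \<noteq> 1"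
  using regular_zeta_eq[of \<rho>] by (cases "\<rho> = 1") (auto simp: nontrivial_zeros_def)

lemma finite_nontrivial_zeros_le: "finite {\<rho> \<in> nontrivial_zeros. \<bar>Im \<rho>\<bar> \<le> T}"
proof (rule finite_subset)
  show "finite {s \<in> cbox (Complex 0 (-T)) (Complex 1 T). regular_zeta s = 0}" by (rule regular_zeta_finite_zeros) simp
  show "{\<rho> \<in> nontrivial_zeros. \<bar>Im \<rho>\<bar> \<le> T} \<subseteq> {s \<in> cbox (Complex 0 (-T)) (Complex 1 T). regular_zeta s = 0}"
    by (auto simp: in_cbox_complex_iff abs_le_iff dest!: nontrivial_zerosD)
qed

text
\<open>This is \<open>y\<^bsup>s\<^esup> \<Gamma>((1 - s)/2) / \<zeta>(s)\<close>. At \<open>s = 1\<close> the poles of Gamma and zeta cancel; written with \<open>\<Gamma>((3 - s)/2)\<close> and the entire function \<open>(s - 1) \<zeta>(s)\<close>, the formula is correct there too.\<close>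
definition HLR_integrand :: "real \<Rightarrow> complex \<Rightarrow> complex" where
  "HLR_integrand y s = - 2 * of_real y powr s * Gamma ((3 - s) / 2) / regular_zeta s"

lemma Gamma_half_plus: "Re s < 1 \<Longrightarrow> Gamma ((3 - s) / 2) = (1 - s) / 2 * Gamma ((1 - s) / 2)"
proof -
  assume "Re s < 1"
  then have "(1 - s) / 2 \<notin> \<int>\<^sub>\<le>\<^sub>0"
  proof -
    have "Re ((1 - s) / 2) > 0" using \<open>Re s < 1\<close> by simp
    then show ?thesis by (rule not_nonpos_Int_if_Re_pos)
  qed
  from Gamma_plus1[OF this] show ?thesis by (simp add: field_simps)
qed

text
\<open>The functional equation for \<open>\<zeta>\<inverse>\<close>: in terms of the completed zeta function the Gamma factors form the product \<open>\<Gamma>((3 - s)/2) \<Gamma>(s/2 + 1)\<close>, which is symmetric under \<open>s \<mapsto> 1 - s\<close>, and the powers of \<open>y\<close> and \<open>pi\<close> exchange \<open>y\<close> with \<open>pi / y\<close>.\<close>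
lemma HLR_integrand_reflect:
  assumes y: "y > 0"
  shows "HLR_integrand y (1 - s) = of_real (y / sqrt pi) * HLR_integrand (pi / y) s"
proof -
  have FF: "HLR_integrand v s = - 4 * (exp (s * of_real (ln v)) * exp (- (s / 2 * of_real (ln pi)))) * (Gamma ((3 - s) / 2) * Gamma (s / 2 + 1)) / completed_zeta s"
    if "v > 0" for v s
  proof -
    have alg: "- 2 * p * g / (X * e * inverse G / 2) = - 4 * (p * inverse e) * (g * G) / X" for p g X e G :: complex
    proof -
      have "- 2 * p * g / (Y / 2) = - 4 * (p * g) / Y" for Y by simp
      moreover have "b / (X * e * inverse G) = b * (inverse e * G) / X" for b
        by (simp only: divide_inverse inverse_mult_distrib inverse_inverse_eq mult_ac)
      ultimately show ?thesis by (simp only: mult_ac)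
    qed
    have pw: "of_real v powr s = exp (s * of_real (ln v))" using that by (simp add: powr_def Ln_of_real)
    show ?thesis
      unfolding HLR_integrand_def regular_zeta_def rGamma_inverse_Gamma exp_minus[of "s / 2 * of_real (ln pi)"] pw by (rule alg)
  qed
  have e1: "exp ((1 - s) * of_real (ln y)) * exp (- ((1 - s) / 2 * of_real (ln pi)))
      = of_real (y / sqrt pi) * (exp (s * of_real (ln (pi / y))) * exp (- (s / 2 * of_real (ln pi))))"
  proof -
    have "sqrt pi = exp (ln pi / 2)" by (simp add: powr_half_sqrt[symmetric] powr_def)
    then have "y / sqrt pi = exp (ln y - ln pi / 2)" using y by (simp add: exp_diff)
    then have c: "of_real (y / sqrt pi) = exp (complex_of_real (ln y - ln pi / 2))" by (simp only: exp_of_real)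
    have l: "ln (pi / y) = ln pi - ln y" using y by (simp add: ln_div)
    show ?thesis unfolding c l exp_add[symmetric] by (rule arg_cong[where f = exp]) (simp add: field_simps)
  qed
  have g1: "Gamma ((3 - (1 - s)) / 2) * Gamma ((1 - s) / 2 + 1) = Gamma ((3 - s) / 2) * Gamma (s / 2 + 1)"
  proof -
    have "(3 - (1 - s)) / 2 = s / 2 + 1" "(1 - s) / 2 + 1 = (3 - s) / 2" by (auto simp: field_simps)
    then show ?thesis by (simp only: mult.commute)
  qed
  have alg: "- 4 * (c * E) * G / X = c * (- 4 * E * G / X)" for c E G X :: complex by simp
  show ?thesis
    unfolding FF[OF y] FF[OF divide_pos_pos[OF pi_gt_zero y]] completed_zeta_reflect e1 g1 by (rule alg)
qed

lemma HLR_integrand_holomorphic: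
  "HLR_integrand y holomorphic_on {s. -1 < Re s \<and> Re s < 2} - nontrivial_zeros"
proof (cases "y = 0")
  case True
  then have "HLR_integrand y = (\<lambda>s. 0)" by (auto simp: HLR_integrand_def)
  then show ?thesis by simp
next
  case False
  have "regular_zeta s \<noteq> 0" if "s \<in> {s. -1 < Re s \<and> Re s < 2} - nontrivial_zeros" for s
    using regular_zeta_zero_nontrivial[of s] that by auto
  moreover have "(3 - s) / 2 \<notin> \<int>\<^sub>\<le>\<^sub>0" if "Re s < 2" for s
  proof -
    have "Re ((3 - s) / 2) > 0" using that by simp
    then show ?thesis by (rule not_nonpos_Int_if_Re_pos)
  qed
  ultimately show ?thesis unfolding HLR_integrand_def[abs_def] using False
    by (intro holomorphic_intros) auto
qed

lemma HLR_integrand_residue: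
  assumes \<rho>: "\<rho> \<in> nontrivial_zeros" "zorder riemann_zeta \<rho> = 1" and x: "x > 0"
  shows "residue (HLR_integrand (pi / sqrt x)) \<rho> = HLR_zero_term x \<rho>"
proof -
  define y where "y = pi / sqrt x"
  have y: "y > 0" using x by (simp add: y_def)
  note z = nontrivial_zerosD[OF \<rho>(1)]
  have z0: "riemann_zeta \<rho> = 0" using \<rho> by (simp add: nontrivial_zeros_def)
  have d: "deriv riemann_zeta \<rho> \<noteq> 0" by (rule zeta_simple_zero_deriv[OF \<rho>])
  have "(riemann_zeta has_field_derivative deriv riemann_zeta \<rho>) (at \<rho>)"
    by (rule holomorphic_derivI[of _ "-{1}"]) (use z in \<open>auto intro: riemann_zeta_holomorphic\<close>)
  then have "((\<lambda>s. (s - 1) * riemann_zeta s) has_field_derivative ((\<rho> - 1) * deriv riemann_zeta \<rho>)) (at \<rho>)"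
    using z0 by (auto intro!: derivative_eq_intros)
  then have dz: "(regular_zeta has_field_derivative ((\<rho> - 1) * deriv riemann_zeta \<rho>)) (at \<rho>)"
    by (rule has_field_derivative_transform_within_open[where S = "-{1}"]) (use z in \<open>auto simp: regular_zeta_eq\<close>)
  have G: "Gamma ((3 - \<rho>) / 2) = (1 - \<rho>) / 2 * Gamma ((1 - \<rho>) / 2)" using z by (intro Gamma_half_plus) auto
  have Gnz: "Gamma ((1 - \<rho>) / 2) \<noteq> 0"
  proof -
    have "Re ((1 - \<rho>) / 2) > 0" using z by simp
    then have "(1 - \<rho>) / 2 \<notin> \<int>\<^sub>\<le>\<^sub>0" by (rule not_nonpos_Int_if_Re_pos)
    then show ?thesis by (simp add: Gamma_eq_zero_iff)
  qed
  have "residue (HLR_integrand y) \<rho> = (- 2 * of_real y powr \<rho> * Gamma ((3 - \<rho>) / 2)) / ((\<rho> - 1) * deriv riemann_zeta \<rho>)"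
    unfolding HLR_integrand_def
  proof (rule residue_simple_pole_deriv[where s = "{s. Re s < 1}"])
    have "(3 - s) / 2 \<notin> \<int>\<^sub>\<le>\<^sub>0" if "Re s < 1" for s
    proof -
      have "Re ((3 - s) / 2) > 0" using that by simp
      then show ?thesis by (rule not_nonpos_Int_if_Re_pos)
    qed
    then show "(\<lambda>s. - 2 * of_real y powr s * Gamma ((3 - s) / 2)) holomorphic_on {s. Re s < 1}"
      using y by (intro holomorphic_intros) auto
    show "connected {s::complex. Re s < 1}" by (intro convex_connected convex_halfspace_Re_lt)
    show "- 2 * of_real y powr \<rho> * Gamma ((3 - \<rho>) / 2) \<noteq> 0" unfolding G using Gnz z y by auto
  qed (use z d dz in \<open>auto intro: regular_zeta_holomorphic open_halfspace_Re_lt\<close>)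
  also have "\<dots> = of_real y powr \<rho> * Gamma ((1 - \<rho>) / 2) / deriv riemann_zeta \<rho>"
  proof -
    have "- 2 * a * ((1 - \<rho>) / 2 * b) / ((\<rho> - 1) * c) = a * b / c" if "c \<noteq> 0" for a b c
      using z that by (simp add: divide_simps) (simp add: algebra_simps)
    then show ?thesis unfolding G using d by blast
  qed
  finally show ?thesis by (simp add: HLR_zero_term_def y_def)
qed

text
\<open>With \<open>w = (1 - s) / 2\<close> the line \<open>Re s = 3/2\<close> becomes \<open>Re w = -1/4\<close>, where Mellin inversion applies to \<open>u = v\<^sup>2\<close>.\<close>
lemma
  assumes v: "v > 0"
  shows Mellin_line_integrable: "integrable lborel (\<lambda>t. of_real v powr Complex (3/2) t * Gamma ((1 - Complex (3/2) t) / 2))"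
    and Mellin_line_integral: "(LINT t|lborel. of_real v powr Complex (3/2) t * Gamma ((1 - Complex (3/2) t) / 2)) = of_real (4 * pi * v * (exp (- v\<^sup>2) - 1))"
proof -
  define K where "K = (\<lambda>t. Gamma (Complex (-1/4) t) * of_real (v\<^sup>2) powr (- Complex (-1/4) t))"
  have K: "integrable lborel K" "(LINT t|lborel. K t) = of_real (2 * pi * (exp (- v\<^sup>2) - 1))"
    using Mellin_kernel_integrable[of "-1/4" "v\<^sup>2" 0] Mellin_inversion_exp_minus_1[of "-1/4" "v\<^sup>2"] v unfolding K_def by auto
  have eq: "of_real v powr Complex (3/2) t * Gamma ((1 - Complex (3/2) t) / 2) = of_real v * K (0 + (-1/2) * t)" for t
  proof -
    have a: "(1 - Complex (3/2) t) / 2 = Complex (-1/4) (0 + (-1/2) * t)" by (simp add: complex_eq_iff)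
    have b: "Complex (3/2) t = 1 + 2 * (- Complex (-1/4) (0 + (-1/2) * t))" by (simp add: complex_eq_iff)
    have l: "ln (v\<^sup>2) = 2 * ln v" using v by (simp add: ln_realpow)
    have pw: "of_real v powr (1 + 2 * w) = of_real v * of_real (v\<^sup>2) powr w" for w :: complex
    proof -
      have "of_real (v\<^sup>2) powr w = exp (w * of_real (2 * ln v))"
        using v Ln_of_real[of "v\<^sup>2"] by (simp add: powr_def l del: of_real_power)
      moreover have "of_real v powr (1 + 2 * w) = exp (of_real (ln v)) * exp (w * of_real (2 * ln v))"
        using v by (simp add: powr_def Ln_of_real exp_add[symmetric] algebra_simps)
      moreover have "exp (complex_of_real (ln v)) = of_real v" using v by (simp add: exp_of_real)
      ultimately show ?thesis by simp
    qed
    show ?thesis unfolding a K_def by (subst b, subst pw) (simp only: mult_ac)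
  qed
  have i: "integrable lborel (\<lambda>t. K (0 + (-1/2) * t))"
    using K(1) by (subst lborel_integrable_real_affine_iff) auto
  show "integrable lborel (\<lambda>t. of_real v powr Complex (3/2) t * Gamma ((1 - Complex (3/2) t) / 2))"
    unfolding eq using i by (rule integrable_mult_right)
  have "(LINT t|lborel. K t) = \<bar>-1/2\<bar> *\<^sub>R (LINT t|lborel. K (0 + (-1/2) * t))"
    by (rule lborel_integral_real_affine) simp
  then have "(LINT t|lborel. K (0 + (-1/2) * t)) = 2 * (LINT t|lborel. K t)"
    by (simp only: scaleR_conv_of_real) simp
  then show "(LINT t|lborel. of_real v powr Complex (3/2) t * Gamma ((1 - Complex (3/2) t) / 2)) = of_real (4 * pi * v * (exp (- v\<^sup>2) - 1))"
    unfolding eq integral_mult_right_zero K(2) by simp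
qed

text
\<open>To the right of 1 the factor \<open>1 / \<zeta>\<close> is its absolutely convergent Moebius series, and each term is a Mellin integral for \<open>v = y / n\<close>.\<close>
lemma
  assumes y: "y > 0"
  shows HLR_integrand_right_integrable: "integrable lborel (\<lambda>t. HLR_integrand y (Complex (3/2) t))"
    and HLR_integrand_right_integral: "(LINT t|lborel. HLR_integrand y (Complex (3/2) t)) = of_real (4 * pi * y * mobius_exp_series (y\<^sup>2))"
proof -
  define s where "s = Complex (3/2)"
  define B where "B = (\<lambda>t. of_real y powr s t * Gamma ((1 - s t) / 2))"
  define f where "f = (\<lambda>n t. of_real (mobius (Suc n)) * of_nat (Suc n) powr (- s t) * B t)"
  have iB: "integrable lborel B" unfolding B_def s_def by (rule Mellin_line_integrable[OF y])
  have fv: "f n t = of_real (mobius (Suc n)) * (of_real (y / real (Suc n)) powr s t * Gamma ((1 - s t) / 2))" for n t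
  proof -
    define m where "m = real (Suc n)"
    have m: "m > 0" by (simp add: m_def)
    have "of_nat (Suc n) powr (- s t) * of_real y powr s t = of_real m powr (- s t) * of_real y powr s t"
      by (simp only: m_def of_real_of_nat_eq)
    also have "\<dots> = of_real (y / m) powr s t"
    proof -
      have "of_real (y / m) powr s t = exp (s t * of_real (ln (y / m)))"
        using y m Ln_of_real[of "y / m"] by (simp add: powr_def del: of_real_divide)
      also have "ln (y / m) = ln y - ln m" using y m by (simp add: ln_div)
      also have "exp (s t * of_real (ln y - ln m)) = exp (- s t * of_real (ln m)) * exp (s t * of_real (ln y))"
        by (simp add: exp_add[symmetric] algebra_simps)
      finally show ?thesis using y m by (simp add: powr_def Ln_of_real)
    qed
    finally have h: "of_nat (Suc n) powr (- s t) * of_real y powr s t = of_real (y / m) powr s t" .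
    show ?thesis unfolding f_def B_def m_def[symmetric] h[symmetric] by (simp only: mult.assoc)
  qed
  have intf: "integrable lborel (f n)" for n
    unfolding fv s_def by (intro integrable_mult_right Mellin_line_integrable) (use y in auto)
  have valf: "(LINT t|lborel. f n t) = of_real (4 * pi * y * (mobius (Suc n) / real (Suc n) * (exp (- (y\<^sup>2 / real (Suc n) ^ 2)) - 1)))" for n
  proof -
    have "(LINT t|lborel. f n t) = of_real (mobius (Suc n)) * of_real (4 * pi * (y / real (Suc n)) * (exp (- (y / real (Suc n))\<^sup>2) - 1))"
      unfolding fv s_def integral_mult_right_zero by (subst Mellin_line_integral) (use y in auto)
    then show ?thesis by (simp add: power_divide mult_ac del: of_nat_Suc)
  qed
  have normf: "norm (f n t) = \<bar>mobius (Suc n)\<bar> * real (Suc n) powr (- (3/2)) * norm (B t)" for n t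
    unfolding f_def norm_mult powr_minus_of_nat_norm by (simp add: s_def)
  have sm0: "summable (\<lambda>n. \<bar>mobius (Suc n)\<bar> * real (Suc n) powr (- (3/2)))"
    by (rule summable_comparison_test'[OF summable_Suc_powr[of "3/2"], of 0])
       (use abs_mobius_le_1 in \<open>auto simp: abs_mult intro!: mult_left_le_one_le\<close>)
  have sm: "summable (\<lambda>n. LINT t|lborel. norm (f n t))"
    unfolding normf by (simp del: of_nat_Suc add: summable_mult2 sm0)
  have sm1: "summable (\<lambda>n. norm (f n t))" for t unfolding normf by (intro summable_mult2 sm0)
  have sumf: "(\<Sum>n. f n t) = HLR_integrand y (Complex (3/2) t)" for t
  proof -
    have s1: "s t \<noteq> 1" "Re (s t) > 1" by (auto simp: s_def complex_eq_iff)
    have "(\<lambda>n. f n t) sums (1 / riemann_zeta (s t) * B t)"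
      unfolding f_def by (intro sums_mult2 mobius_Dirichlet_sums s1)
    then have "(\<Sum>n. f n t) = B t / riemann_zeta (s t)" by (simp add: sums_iff)
    also have "\<dots> = HLR_integrand y (s t)"
    proof -
      have nn: "(1 - s t) / 2 \<notin> \<int>\<^sub>\<le>\<^sub>0"
      proof
        assume "(1 - s t) / 2 \<in> \<int>\<^sub>\<le>\<^sub>0"
        then obtain n :: int where "(1 - s t) / 2 = of_int n" by (auto elim!: nonpos_Ints_cases)
        from arg_cong[OF this, of Re] have "real_of_int (4 * n) = real_of_int (-1)" by (simp add: s_def)
        then have "4 * n = - 1" by (simp only: of_int_eq_iff)
        then show False by presburger
      qed
      have "Gamma ((3 - s t) / 2) = Gamma ((1 - s t) / 2 + 1)" by (simp add: field_simps)
      also have "\<dots> = (1 - s t) / 2 * Gamma ((1 - s t) / 2)" by (rule Gamma_plus1[OF nn])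
      finally have G: "Gamma ((3 - s t) / 2) = (1 - s t) / 2 * Gamma ((1 - s t) / 2)" .
      have alg: "- 2 * a * ((1 - z) / 2 * b) / ((z - 1) * c) = a * b / c" if "c \<noteq> 0" "z \<noteq> 1" for a b c z :: complex
        using that by (simp add: divide_simps) (simp add: algebra_simps)
      show ?thesis unfolding HLR_integrand_def G regular_zeta_eq[OF s1(1)] B_def
        by (rule alg[symmetric]) (use riemann_zeta_nonzero_right[OF s1(2)] s1 in auto)
    qed
    finally show ?thesis by (simp add: s_def)
  qed
  show "integrable lborel (\<lambda>t. HLR_integrand y (Complex (3/2) t))"
    unfolding sumf[symmetric] by (rule integrable_suminf[OF intf _ sm]) (use sm1 in simp)
  have "(\<lambda>n. LINT t|lborel. f n t) sums (LINT t|lborel. HLR_integrand y (Complex (3/2) t))"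
    unfolding sumf[symmetric] by (rule sums_integral[OF intf _ sm]) (use sm1 in simp)
  moreover have "(\<lambda>n. LINT t|lborel. f n t) sums of_real (4 * pi * y * mobius_exp_series (y\<^sup>2))"
    unfolding valf by (intro sums_of_real sums_mult mobius_exp_series_sums) (use y in auto)
  ultimately show "(LINT t|lborel. HLR_integrand y (Complex (3/2) t)) = of_real (4 * pi * y * mobius_exp_series (y\<^sup>2))"
    by (rule sums_unique2)
qed

text \<open>Reflection carries this line to \<open>Re s = 3/2\<close>.\<close>
lemma
  assumes y: "y > 0"
  shows HLR_integrand_left_integrable: "integrable lborel (\<lambda>t. HLR_integrand y (Complex (-1/2) t))"
    and HLR_integrand_left_integral: "(LINT t|lborel. HLR_integrand y (Complex (-1/2) t)) = of_real (4 * pi * sqrt pi * mobius_exp_series ((pi / y)\<^sup>2))"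
proof -
  define h where "h = (\<lambda>t. HLR_integrand (pi / y) (Complex (3/2) t))"
  have py: "pi / y > 0" using y by simp
  have eq: "HLR_integrand y (Complex (-1/2) t) = of_real (y / sqrt pi) * h (0 + (-1) * t)" for t
  proof -
    have "Complex (-1/2) t = 1 - Complex (3/2) (0 + (-1) * t)" by (simp add: complex_eq_iff)
    then show ?thesis unfolding h_def using HLR_integrand_reflect[OF y] by metis
  qed
  have i: "integrable lborel h" unfolding h_def by (rule HLR_integrand_right_integrable[OF py])
  then have i': "integrable lborel (\<lambda>t. h (0 + (-1) * t))" by (subst lborel_integrable_real_affine_iff) auto
  show "integrable lborel (\<lambda>t. HLR_integrand y (Complex (-1/2) t))" unfolding eq using i' by (rule integrable_mult_right)
  have "(LINT t|lborel. h t) = \<bar>-1\<bar> *\<^sub>R (LINT t|lborel. h (0 + (-1) * t))" by (rule lborel_integral_real_affine) simp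
  then have v: "(LINT t|lborel. h (0 + (-1) * t)) = of_real (4 * pi * (pi / y) * mobius_exp_series ((pi / y)\<^sup>2))"
    using HLR_integrand_right_integral[OF py] by (simp add: h_def)
  have "y / sqrt pi * (4 * pi * (pi / y) * r) = 4 * pi * sqrt pi * r" for r
  proof -
    have "pi / sqrt pi = sqrt pi" by (simp add: real_div_sqrt)
    then have "4 * pi * (pi / sqrt pi) * r = 4 * pi * sqrt pi * r" by simp
    then show ?thesis using y by (simp add: field_simps)
  qed
  then show "(LINT t|lborel. HLR_integrand y (Complex (-1/2) t)) = of_real (4 * pi * sqrt pi * mobius_exp_series ((pi / y)\<^sup>2))"
    unfolding eq integral_mult_right_zero v of_real_mult[symmetric] by simp
qed

section \<open>Shifting the contour across the zeros\<close>

text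
\<open>The bound \<open>exp (O(log N * log log N))\<close> for \<open>1 / \<zeta>\<close> against the decay \<open>exp (- N / 2)\<close> that Gamma will supply.\<close>
lemma good_heights:
  assumes simple: "\<And>\<rho>. \<rho> \<in> nontrivial_zeros \<Longrightarrow> zorder riemann_zeta \<rho> = 1"
  obtains T b :: "nat \<Rightarrow> real" where "\<And>n. T n \<ge> 2" "filterlim T at_top sequentially"
    "\<And>n \<sigma>. 1/2 \<le> \<sigma> \<Longrightarrow> \<sigma> \<le> 3/2 \<Longrightarrow> regular_zeta (Complex \<sigma> (T n)) \<noteq> 0 \<and> norm (1 / regular_zeta (Complex \<sigma> (T n))) \<le> b n"
    "(\<lambda>n. b n * exp (- T n / 2)) \<longlonglongrightarrow> 0"
proof -
  obtain A B :: real where AB: "A > 0" "B > 0" and main: "\<And>N::nat. N \<ge> 4 \<Longrightarrow> \<exists>T. real N - 1/2 \<le> T \<and> T \<le> real N + 1/2 \<and>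
     (\<forall>\<sigma>. 1/2 \<le> \<sigma> \<longrightarrow> \<sigma> \<le> 3/2 \<longrightarrow> riemann_zeta (Complex \<sigma> T) \<noteq> 0 \<and>
        norm (1 / riemann_zeta (Complex \<sigma> T)) \<le> A * exp (32 * ln (B * (real N + 6))
            + 10 * ln (B * (real N + 6)) * ln (8 * (10 * ln (B * (real N + 6)) + 1))))"
    using zeta_lower_bound_on_horizontal_lines[OF simple] by metis
  \<comment> \<open>The offset 4 keeps the discs about \<open>2 + \<i>N\<close> away from the pole.\<close>
  define b where "b = (\<lambda>n. A * exp (32 * ln (B * (real (n + 4) + 6))
            + 10 * ln (B * (real (n + 4) + 6)) * ln (8 * (10 * ln (B * (real (n + 4) + 6)) + 1))))"
  have "\<exists>T. real (n + 4) - 1/2 \<le> T \<and> T \<le> real (n + 4) + 1/2 \<and>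
     (\<forall>\<sigma>. 1/2 \<le> \<sigma> \<longrightarrow> \<sigma> \<le> 3/2 \<longrightarrow> riemann_zeta (Complex \<sigma> T) \<noteq> 0 \<and> norm (1 / riemann_zeta (Complex \<sigma> T)) \<le> b n)" for n
    unfolding b_def by (rule main) simp
  then obtain T where T: "\<And>n. real (n + 4) - 1/2 \<le> T n"
     "\<And>n \<sigma>. 1/2 \<le> \<sigma> \<Longrightarrow> \<sigma> \<le> 3/2 \<Longrightarrow> riemann_zeta (Complex \<sigma> (T n)) \<noteq> 0 \<and> norm (1 / riemann_zeta (Complex \<sigma> (T n))) \<le> b n"
    by metis
  have T2: "T n \<ge> 2" "T n \<ge> real n" for n using T(1)[of n] by auto
  have "filterlim T at_top sequentially"
    by (rule filterlim_at_top_mono[OF filterlim_real_sequentially]) (use T2 in auto)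
  moreover have "regular_zeta (Complex \<sigma> (T n)) \<noteq> 0 \<and> norm (1 / regular_zeta (Complex \<sigma> (T n))) \<le> b n"
    if \<sigma>: "1/2 \<le> \<sigma>" "\<sigma> \<le> 3/2" for n \<sigma>
  proof -
    define s where "s = Complex \<sigma> (T n)"
    have z: "riemann_zeta s \<noteq> 0" "norm (1 / riemann_zeta s) \<le> b n" using T(2)[OF \<sigma>] by (auto simp: s_def)
    have s1: "s \<noteq> 1" using T2(1)[of n] by (auto simp: s_def complex_eq_iff)
    have "norm (s - 1) \<ge> 1" using abs_Im_le_cmod[of "s - 1"] T2(1)[of n] by (simp add: s_def)
    then have "norm (1 / riemann_zeta s) / norm (s - 1) \<le> norm (1 / riemann_zeta s) / 1"
      by (intro divide_left_mono) auto
    then have "norm (1 / regular_zeta s) \<le> norm (1 / riemann_zeta s)"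
      unfolding regular_zeta_eq[OF s1] norm_divide norm_mult by (simp only: norm_one divide_divide_eq_left mult.commute div_by_1)
    then show ?thesis using z s1 regular_zeta_eq[OF s1] by (auto simp: s_def)
  qed
  moreover have "(\<lambda>n. b n * exp (- T n / 2)) \<longlonglongrightarrow> 0"
  proof (rule Lim_null_comparison)
    show "\<forall>\<^sub>F n in sequentially. norm (b n * exp (- T n / 2)) \<le> b n * exp (- real n / 2)"
      using T2(2) AB by (intro always_eventually allI) (auto simp: b_def abs_mult)
    show "(\<lambda>n. b n * exp (- real n / 2)) \<longlonglongrightarrow> 0" unfolding b_def using AB by real_asymp
  qed
  ultimately show ?thesis using that[of T b] T2 by blast
qed

lemma HLR_integrand_right_half_bound:
  assumes v: "v > 0" and T: "\<And>n. T n \<ge> (2::real)"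
    and b: "\<And>n \<sigma>. 1/2 \<le> \<sigma> \<Longrightarrow> \<sigma> \<le> 3/2 \<Longrightarrow> norm (1 / regular_zeta (Complex \<sigma> (T n))) \<le> b n"
  obtains D where "D > 0" "\<And>n \<sigma> t. 1/2 \<le> \<sigma> \<Longrightarrow> \<sigma> \<le> 3/2 \<Longrightarrow> \<bar>t\<bar> = T n \<Longrightarrow> norm (HLR_integrand v (Complex \<sigma> t)) \<le> D * (b n * exp (- T n / 2))"
proof -
  obtain C where C: "C > 0" "\<And>\<sigma> t. 1/2 \<le> \<sigma> \<Longrightarrow> \<sigma> \<le> 2 \<Longrightarrow> \<bar>t\<bar> \<ge> 1 \<Longrightarrow> norm (Gamma (Complex \<sigma> t)) \<le> C * exp (- \<bar>t\<bar>)"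
    using Gamma_strip_decay by blast
  define Y where "Y = v powr (1/2) + v powr (3/2)"
  have Y: "Y > 0" using v by (simp add: Y_def add_pos_pos)
  have "norm (HLR_integrand v (Complex \<sigma> t)) \<le> (2 * Y * C) * (b n * exp (- T n / 2))"
    if \<sigma>: "1/2 \<le> \<sigma>" "\<sigma> \<le> 3/2" and t: "\<bar>t\<bar> = T n" for n \<sigma> t
  proof -
    have "norm (1 / regular_zeta (Complex \<sigma> t)) = norm (1 / regular_zeta (Complex \<sigma> (T n)))"
    proof (cases "t \<ge> 0")
      case False
      then have "Complex \<sigma> t = cnj (Complex \<sigma> (T n))" using t by (simp add: complex_eq_iff)
      then show ?thesis by (simp add: regular_zeta_cnj norm_divide)
    qed (use t in simp)
    then have Z: "norm (1 / regular_zeta (Complex \<sigma> t)) \<le> b n" using b[OF \<sigma>] by simp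
    then have b0: "b n \<ge> 0" by (rule order_trans[OF norm_ge_zero])
    have "(3 - Complex \<sigma> t) / 2 = Complex ((3 - \<sigma>) / 2) (- t / 2)" by (simp add: complex_eq_iff)
    moreover have "norm (Gamma (Complex ((3 - \<sigma>) / 2) (- t / 2))) \<le> C * exp (- \<bar>- t / 2\<bar>)"
      by (rule C(2)) (use \<sigma> t T[of n] in auto)
    ultimately have G: "norm (Gamma ((3 - Complex \<sigma> t) / 2)) \<le> C * exp (- T n / 2)" using t by simp
    have P: "norm (of_real v powr Complex \<sigma> t) \<le> Y"
      unfolding norm_of_real_powr[OF v] Y_def complex.sel by (rule powr_between_le) (use v \<sigma> in auto)
    have "norm (HLR_integrand v (Complex \<sigma> t))
        = 2 * (norm (of_real v powr Complex \<sigma> t) * (norm (Gamma ((3 - Complex \<sigma> t) / 2)) * norm (1 / regular_zeta (Complex \<sigma> t))))"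
      by (simp add: HLR_integrand_def norm_mult norm_divide)
    also have "\<dots> \<le> 2 * (Y * ((C * exp (- T n / 2)) * b n))"
      using P G Z Y C b0 by (intro mult_left_mono mult_mono) auto
    finally show ?thesis by (simp add: mult_ac)
  qed
  then show ?thesis using that[of "2 * Y * C"] Y C by simp
qed

text
\<open>Move the line of integration from \<open>Re s = 3/2\<close> to \<open>Re s = -1/2\<close>. The residues inside the rectangle of height \<open>T n\<close> are a partial sum over the zeros, the horizontal sides tend to 0, and the vertical sides tend to the two exponential Moebius series. This determines the limit along the heights \<open>T n\<close>, and the assumed convergence makes it the sum of the series.\<close>
theorem HLR_zero_sum_eq:
  assumes simple: "\<And>\<rho>. \<rho> \<in> nontrivial_zeros \<Longrightarrow> zorder riemann_zeta \<rho> = 1"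
    and sm: "zeros_summable (HLR_zero_term x)" and x: "x > 0"
  shows "zeros_sum (HLR_zero_term x) = of_real (2 * (pi / sqrt x) * mobius_exp_series (pi\<^sup>2 / x) - 2 * sqrt pi * mobius_exp_series x)"
proof -
  \<comment>
  \<open>With this choice \<open>y\<^sup>2\<close> and \<open>(pi / y)\<^sup>2\<close> are the parameters of the two series in the identity.\<close>
  define y where "y = pi / sqrt x"
  have y: "y > 0" "y\<^sup>2 = pi\<^sup>2 / x" "(pi / y)\<^sup>2 = x" using x by (auto simp: y_def power_divide)
  have py: "pi / y > 0" using y by simp
  define F where "F = HLR_integrand y"
  obtain T b where T: "\<And>n. T n \<ge> (2::real)" "filterlim T at_top sequentially"
    and b: "\<And>n \<sigma>. 1/2 \<le> \<sigma> \<Longrightarrow> \<sigma> \<le> 3/2 \<Longrightarrow> regular_zeta (Complex \<sigma> (T n)) \<noteq> 0 \<and> norm (1 / regular_zeta (Complex \<sigma> (T n))) \<le> b n"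
    and lim: "(\<lambda>n. b n * exp (- T n / 2)) \<longlonglongrightarrow> 0"
    by (rule good_heights[OF simple that])
  have T0: "T n > 0" for n using T(1)[of n] by simp
  have b0: "b n \<ge> 0" for n
  proof -
    have "norm (1 / regular_zeta (Complex 1 (T n))) \<le> b n" using b[of 1 n] by simp
    then show ?thesis by (rule order_trans[OF norm_ge_zero])
  qed
  have nz1: "regular_zeta (Complex \<sigma> t) \<noteq> 0" if "1/2 \<le> \<sigma>" "\<sigma> \<le> 3/2" "\<bar>t\<bar> = T n" for \<sigma> t n
  proof (cases "t \<ge> 0")
    case False
    then have "Complex \<sigma> t = cnj (Complex \<sigma> (T n))" using that by (simp add: complex_eq_iff)
    then show ?thesis using b[OF that(1,2)] by (simp add: regular_zeta_cnj)
  qed (use b that in auto)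
  have nz: "regular_zeta (Complex \<sigma> t) \<noteq> 0" if \<sigma>: "-1/2 \<le> \<sigma>" "\<sigma> \<le> 3/2" and t: "\<bar>t\<bar> = T n" for \<sigma> t n
  proof (cases "\<sigma> \<ge> 1/2")
    case False
    have "1 - Complex \<sigma> t = Complex (1 - \<sigma>) (- t)" by (simp add: complex_eq_iff)
    then have "regular_zeta (1 - Complex \<sigma> t) \<noteq> 0" using nz1[of "1 - \<sigma>" "- t" n] False \<sigma> t by simp
    moreover have "- 2 < Re (Complex \<sigma> t)" "Re (Complex \<sigma> t) < 3" using \<sigma> by auto
    ultimately show ?thesis using regular_zeta_zero_reflect by blast
  qed (use nz1 \<sigma> t in auto)
  define P where "P = (\<lambda>n. {\<rho> \<in> nontrivial_zeros. \<bar>Im \<rho>\<bar> \<le> T n})"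
  have Im_ne: "\<bar>Im \<rho>\<bar> \<noteq> T n" if "\<rho> \<in> nontrivial_zeros" for \<rho> n
  proof -
    have "regular_zeta (Complex (Re \<rho>) (Im \<rho>)) = 0" "- 1 / 2 \<le> Re \<rho>" "Re \<rho> \<le> 3 / 2"
      using nontrivial_zerosD[OF that] by auto
    then show ?thesis using nz by blast
  qed
  obtain D1 where D1: "D1 > 0" "\<And>n \<sigma> t. 1/2 \<le> \<sigma> \<Longrightarrow> \<sigma> \<le> 3/2 \<Longrightarrow> \<bar>t\<bar> = T n \<Longrightarrow> norm (HLR_integrand y (Complex \<sigma> t)) \<le> D1 * (b n * exp (- T n / 2))"
    by (rule HLR_integrand_right_half_bound[where T = T and b = b, OF y(1) T(1)]) (use b in blast, blast)
  obtain D2 where D2: "D2 > 0" "\<And>n \<sigma> t. 1/2 \<le> \<sigma> \<Longrightarrow> \<sigma> \<le> 3/2 \<Longrightarrow> \<bar>t\<bar> = T n \<Longrightarrow> norm (HLR_integrand (pi / y) (Complex \<sigma> t)) \<le> D2 * (b n * exp (- T n / 2))"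
    by (rule HLR_integrand_right_half_bound[where T = T and b = b, OF py T(1)]) (use b in blast, blast)
  define D where "D = D1 + y / sqrt pi * D2"
  have bound: "norm (F (Complex \<sigma> t)) \<le> D * (b n * exp (- T n / 2))" if \<sigma>: "-1/2 \<le> \<sigma>" "\<sigma> \<le> 3/2" and t: "\<bar>t\<bar> = T n" for \<sigma> t n
  proof (cases "\<sigma> \<ge> 1/2")
    case True
    have "norm (F (Complex \<sigma> t)) \<le> D1 * (b n * exp (- T n / 2))" unfolding F_def by (rule D1(2)) (use True \<sigma> t in auto)
    also have "\<dots> \<le> D * (b n * exp (- T n / 2))" using b0[of n] D2(1) y(1) by (intro mult_right_mono) (auto simp: D_def)
    finally show ?thesis .
  next
    case False
    have "Complex \<sigma> t = 1 - Complex (1 - \<sigma>) (- t)" by (simp add: complex_eq_iff)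
    then have Feq: "F (Complex \<sigma> t) = of_real (y / sqrt pi) * HLR_integrand (pi / y) (Complex (1 - \<sigma>) (- t))"
      unfolding F_def using HLR_integrand_reflect[OF y(1)] by metis
    have "norm (F (Complex \<sigma> t)) = y / sqrt pi * norm (HLR_integrand (pi / y) (Complex (1 - \<sigma>) (- t)))"
      unfolding Feq norm_mult norm_of_real using y(1) by simp
    also have "\<dots> \<le> y / sqrt pi * (D2 * (b n * exp (- T n / 2)))"
      using False \<sigma> t y(1) by (intro mult_left_mono D2(2)) auto
    also have "\<dots> = (y / sqrt pi * D2) * (b n * exp (- T n / 2))" by simp
    also have "\<dots> \<le> D * (b n * exp (- T n / 2))" using b0[of n] D1(1) by (intro mult_right_mono) (auto simp: D_def)
    finally show ?thesis .
  qed
  have horiz: "(\<lambda>n. integral {-1/2..3/2} (\<lambda>\<sigma>. F (Complex \<sigma> (\<epsilon> * T n)))) \<longlonglongrightarrow> 0" if \<epsilon>: "\<bar>\<epsilon>\<bar> = 1" for \<epsilon>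
  proof (rule integral_tendsto_0_uniform_bound)
    have t: "\<bar>\<epsilon> * T n\<bar> = T n" for n using \<epsilon> T0[of n] by (simp add: abs_mult)
    show "continuous_on {-1/2..3/2} (\<lambda>\<sigma>. F (Complex \<sigma> (\<epsilon> * T n)))" for n
    proof (rule continuous_on_compose2[OF holomorphic_on_imp_continuous_on[OF HLR_integrand_holomorphic[of y, folded F_def]]])
      show "continuous_on {-1/2..3/2} (\<lambda>\<sigma>. Complex \<sigma> (\<epsilon> * T n))" unfolding Complex_eq by (intro continuous_intros)
      show "(\<lambda>\<sigma>. Complex \<sigma> (\<epsilon> * T n)) ` {-1/2..3/2} \<subseteq> {s. -1 < Re s \<and> Re s < 2} - nontrivial_zeros"
      proof safe
        fix \<sigma> :: real assume \<sigma>: "\<sigma> \<in> {-1/2..3/2}"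
        then show "-1 < Re (Complex \<sigma> (\<epsilon> * T n))" "Re (Complex \<sigma> (\<epsilon> * T n)) < 2" by auto
        assume "Complex \<sigma> (\<epsilon> * T n) \<in> nontrivial_zeros"
        then show False using nz[of \<sigma> "\<epsilon> * T n" n] t[of n] \<sigma> nontrivial_zerosD(1) by auto
      qed
    qed
    show "(\<lambda>n. D * (b n * exp (- T n / 2))) \<longlonglongrightarrow> 0" using tendsto_mult_right_zero[OF lim] .
    show "norm (F (Complex \<sigma> (\<epsilon> * T n))) \<le> D * (b n * exp (- T n / 2))" if "\<sigma> \<in> {-1/2..3/2}" for n \<sigma>
      using that by (intro bound t) auto
  qed simp
  have "(\<lambda>n. \<Sum>p\<in>P n. residue F p) \<longlonglongrightarrow> ((LINT t|lborel. F (Complex (3/2) t)) - (LINT t|lborel. F (Complex (-1/2) t))) / (2 * of_real pi)"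
  proof (rule vertical_line_shift[where T = T])
    show "P n \<subseteq> box (Complex (-1/2) (- T n)) (Complex (3/2) (T n))" for n
    proof
      fix \<rho> assume "\<rho> \<in> P n"
      then have \<rho>: "\<rho> \<in> nontrivial_zeros" "\<bar>Im \<rho>\<bar> \<le> T n" by (auto simp: P_def)
      then have "\<bar>Im \<rho>\<bar> < T n" using Im_ne[of \<rho> n] by simp
      then show "\<rho> \<in> box (Complex (-1/2) (- T n)) (Complex (3/2) (T n))"
        using nontrivial_zerosD[OF \<rho>(1)] by (auto simp: in_box_complex_iff)
    qed
    show "\<exists>S. open S \<and> convex S \<and> cbox (Complex (-1/2) (- T n)) (Complex (3/2) (T n)) \<subseteq> S \<and> F holomorphic_on S - P n" for n
    proof -
      \<comment>
      \<open>The next height occurring among the zeros leaves room for an open neighbourhood of the rectangle without further poles.\<close>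
      define H where "H = (\<lambda>\<rho>. \<bar>Im \<rho>\<bar>) ` {\<rho> \<in> nontrivial_zeros. \<bar>Im \<rho>\<bar> \<le> T n + 1} \<inter> {T n<..}"
      have finH: "finite H" unfolding H_def using finite_nontrivial_zeros_le[of "T n + 1"] by auto
      define m where "m = Min (insert (T n + 1) H)"
      have m: "T n < m" "m \<le> T n + 1" "\<And>h. h \<in> H \<Longrightarrow> m \<le> h"
        using finH by (auto simp: m_def H_def)
      define S where "S = {s. Re s > -1} \<inter> {s. Re s < 2} \<inter> {s. Im s > - m} \<inter> {s. Im s < m}"
      have "open S" unfolding S_def by (intro open_Int open_halfspace_Re_gt open_halfspace_Re_lt open_halfspace_Im_gt open_halfspace_Im_lt)
      moreover have "convex S" unfolding S_def by (intro convex_Int convex_halfspace_Re_gt convex_halfspace_Re_lt convex_halfspace_Im_gt convex_halfspace_Im_lt)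
      moreover have "cbox (Complex (-1/2) (- T n)) (Complex (3/2) (T n)) \<subseteq> S"
        using m(1) by (auto simp: S_def in_cbox_complex_iff)
      moreover have "S - P n \<subseteq> {s. -1 < Re s \<and> Re s < 2} - nontrivial_zeros"
      proof
        fix s assume s: "s \<in> S - P n"
        have "s \<notin> nontrivial_zeros"
        proof
          assume z: "s \<in> nontrivial_zeros"
          then have "\<bar>Im s\<bar> > T n" "\<bar>Im s\<bar> < m" using s by (auto simp: P_def S_def)
          then have "\<bar>Im s\<bar> \<in> H" using z m(2) by (auto simp: H_def)
          then show False using m(3)[of "\<bar>Im s\<bar>"] \<open>\<bar>Im s\<bar> < m\<close> by linarith
        qed
        then show "s \<in> {s. -1 < Re s \<and> Re s < 2} - nontrivial_zeros" using s by (auto simp: S_def)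
      qed
      then have "F holomorphic_on S - P n"
        unfolding F_def by (rule holomorphic_on_subset[OF HLR_integrand_holomorphic])
      ultimately show ?thesis by blast
    qed
    show "(\<lambda>n. integral {-1/2..3/2} (\<lambda>\<sigma>. F (Complex \<sigma> (- T n)))) \<longlonglongrightarrow> 0" using horiz[of "-1"] by simp
    show "(\<lambda>n. integral {-1/2..3/2} (\<lambda>\<sigma>. F (Complex \<sigma> (T n)))) \<longlonglongrightarrow> 0" using horiz[of 1] by simp
    show "integrable lborel (\<lambda>t. F (Complex (-1/2) t))" unfolding F_def by (rule HLR_integrand_left_integrable[OF y(1)])
    show "integrable lborel (\<lambda>t. F (Complex (3/2) t))" unfolding F_def by (rule HLR_integrand_right_integrable[OF y(1)])
  qed (use T T0 finite_nontrivial_zeros_le in \<open>auto simp: P_def\<close>)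
  moreover have "(\<Sum>p\<in>P n. residue F p) = zeros_partial_sum (HLR_zero_term x) (T n)" for n
    unfolding zeros_partial_sum_def P_def F_def y_def
    by (intro sum.cong refl HLR_integrand_residue) (use simple x in auto)
  moreover have "((LINT t|lborel. F (Complex (3/2) t)) - (LINT t|lborel. F (Complex (-1/2) t))) / (2 * of_real pi)
     = of_real (2 * y * mobius_exp_series (pi\<^sup>2 / x) - 2 * sqrt pi * mobius_exp_series x)"
  proof -
    have "(LINT t|lborel. F (Complex (3/2) t)) = of_real (4 * pi * y * mobius_exp_series (pi\<^sup>2 / x))"
      unfolding F_def using HLR_integrand_right_integral[OF y(1)] y(2) by simp
    moreover have "(LINT t|lborel. F (Complex (-1/2) t)) = of_real (4 * pi * sqrt pi * mobius_exp_series x)"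
      unfolding F_def using HLR_integrand_left_integral[OF y(1)] y(3) by simp
    moreover have "(4 * pi * y * r - 4 * pi * sqrt pi * q) / (2 * pi) = 2 * y * r - 2 * sqrt pi * q" for r q
      by (simp add: diff_divide_distrib)
    moreover have "(of_real a - of_real c) / (2 * of_real pi) = complex_of_real ((a - c) / (2 * pi))" for a c by simp
    ultimately show ?thesis by (simp only:)
  qed
  ultimately have 1: "(\<lambda>n. zeros_partial_sum (HLR_zero_term x) (T n)) \<longlonglongrightarrow> of_real (2 * y * mobius_exp_series (pi\<^sup>2 / x) - 2 * sqrt pi * mobius_exp_series x)"
    by simp
  obtain L where L: "(zeros_partial_sum (HLR_zero_term x) \<longlongrightarrow> L) at_top" using sm by (auto simp: zeros_summable_def)
  have "(\<lambda>n. zeros_partial_sum (HLR_zero_term x) (T n)) \<longlonglongrightarrow> L" by (rule filterlim_compose[OF L T(2)])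
  with 1 have "L = of_real (2 * y * mobius_exp_series (pi\<^sup>2 / x) - 2 * sqrt pi * mobius_exp_series x)"
    using LIMSEQ_unique by blast
  moreover have "zeros_sum (HLR_zero_term x) = L" unfolding zeros_sum_def by (rule tendsto_Lim[OF _ L]) simp
  ultimately show ?thesis by (simp only: y_def)
qed

theorem HLR_identity_holds:
  assumes simple: "\<And>\<rho>. \<rho> \<in> nontrivial_zeros \<Longrightarrow> zorder riemann_zeta \<rho> = 1"
    and sm: "\<And>x::real. x > 0 \<Longrightarrow> zeros_summable (HLR_zero_term x)"
  shows HLR_identity
  unfolding HLR_identity_def
proof (intro allI impI)
  fix x :: real assume x: "x > 0"
  have e: "pi ^ 2 / (real (Suc n) ^ 2 * x) = pi\<^sup>2 / x / real (Suc n) ^ 2" for n by (simp add: mult.commute del: of_nat_Suc)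
  have px: "pi\<^sup>2 / x > 0" using x by simp
  define G1 G2 where "G1 = mobius_exp_series x" and "G2 = mobius_exp_series (pi\<^sup>2 / x)"
  have Z: "zeros_sum (HLR_zero_term x) = of_real (2 * (pi / sqrt x) * G2 - 2 * sqrt pi * G1)"
    unfolding G1_def G2_def by (rule HLR_zero_sum_eq[OF simple sm[OF x] x])
  have "sqrt (pi / x) * G2 - 1 / (2 * sqrt pi) * (2 * (pi / sqrt x) * G2 - 2 * sqrt pi * G1) = G1"
  proof -
    have "pi / sqrt pi = sqrt pi" by (simp add: real_div_sqrt)
    moreover have "1 / (2 * sqrt pi) * (2 * (pi / sqrt x) * G2) = (pi / sqrt pi) / sqrt x * G2" by simp
    ultimately have "1 / (2 * sqrt pi) * (2 * (pi / sqrt x) * G2) = sqrt (pi / x) * G2"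
      by (simp only: real_sqrt_divide)
    moreover have "1 / (2 * sqrt pi) * (2 * sqrt pi * G1) = G1" by simp
    ultimately show ?thesis by (simp only: right_diff_distrib)
  qed
  then have "complex_of_real G1 = of_real (sqrt (pi / x) * G2) - of_real (1 / (2 * sqrt pi)) * zeros_sum (HLR_zero_term x)"
    unfolding Z of_real_mult[symmetric] of_real_diff[symmetric] by simp
  then show "summable (\<lambda>n. mobius (Suc n) / real (Suc n) * exp (- (x / real (Suc n) ^ 2))) \<and>
        summable (\<lambda>n. mobius (Suc n) / real (Suc n) * exp (- (pi ^ 2 / (real (Suc n) ^ 2 * x)))) \<and>
        complex_of_real (\<Sum>n. mobius (Suc n) / real (Suc n) * exp (- (x / real (Suc n) ^ 2))) =
        complex_of_real (sqrt (pi / x) *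
          (\<Sum>n. mobius (Suc n) / real (Suc n) * exp (- (pi ^ 2 / (real (Suc n) ^ 2 * x)))))
        - complex_of_real (1 / (2 * sqrt pi)) * zeros_sum (HLR_zero_term x)"
    unfolding e using mobius_exp_series_summable[OF x] mobius_exp_series_summable[OF px]
    unfolding G1_def G2_def mobius_exp_series_def by blast
qed

theorem mainTheorem4:
  assumes "\<And>\<rho>. \<rho> \<in> nontrivial_zeros \<Longrightarrow> zorder riemann_zeta \<rho> = 1"
    and "\<And>x::real. x > 0 \<Longrightarrow> zeros_summable (HLR_zero_term x)"
  shows "(Jacobi_theta_relation \<longleftrightarrow> zeta_inverse_functional_equation) \<and>
         (zeta_inverse_functional_equation \<longleftrightarrow> HLR_identity)"
  using Jacobi_theta_relation_holds zeta_inverse_functional_equation_holds HLR_identity_holds[OF assms] by blast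

end
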